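(* Let $(M,\Sigma,g_c)$ be a sub-Riemannian manifold, let $TM=\Sigma\oplus\Sigma'$ be a splitting and let $g$ be an orthogonal extension of $g_c$. Denote by $d\mathrm{vol}$ the Riemannian measure of $g$ and by $\mathrm{H}^\bot$ the mean curvature of $\Sigma'$. Let $u$ be a positive smooth function on $M$ and set $d\mu=u\,d\mathrm{vol}$. Then $$-\int_M(\Delta^{\mathcal{H}}e)\,f\,d\mu=\int_Mg_c(\nabla^{\mathcal{H}}e,\nabla^{\mathcal{H}}f)\,d\mu$$ holds for all $e,f\in C_0^\infty(M)$ if and only if $\ln u$ is the horizontal potential of $\mathrm{H}^\bot$, i.e. $$\nabla^{\mathcal{H}}(\ln u)=\mathrm{H}^\bot.$$
   Context: A sub-Riemannian manifold $(M,\Sigma,g_c)$ is a smooth manifold $M$ of dimension $m$ with a smooth distribution (subbundle) $\Sigma\subset TM$ of rank $k<m$, assumed not integrable, and a smooth inner product $g_c$ on $\Sigma$. $\Gamma(\Sigma)$ denotes the smooth (horizontal) vector fields tangent to $\Sigma$. Given a complement $\Sigma'$ of $\Sigma$, $TM=\Sigma\oplus\Sigma'$, let $\mathcal P$, also written $(\cdot)^{\mathcal H}$, be the projection onto $\Sigma$ along $\Sigma'$. An orthogonal extension of $g_c$ is a Riemannian metric $g$ on $M$ with $g|_\Sigma=g_c$ and $\Sigma\perp\Sigma'$; $\nabla$ denotes its Levi-Civita connection. The horizontal connection $D$ is the unique connection on $\Sigma$ with, for all $X,Y,Z\in\Gamma(\Sigma)$, $Xg_c(Y,Z)=g_c(D_XY,Z)+g_c(Y,D_XZ)$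 and $D_XY-D_YX=[X,Y]^{\mathcal H}$ (equivalently $D_XY=\mathcal P(\nabla_XY)$ for any orthogonal extension $g$). The horizontal gradient $\nabla^{\mathcal H}f\in\Gamma(\Sigma)$ of a smooth function $f$ is defined by $g_c(\nabla^{\mathcal H}f,X)=Xf$ for all $X\in\Gamma(\Sigma)$. The horizontal divergence is $\mathrm{div}^{\mathcal H}X=\sum_{i=1}^kg_c(D_{X_i}X,X_i)$ for $X\in\Gamma(\Sigma)$ and any (local) orthonormal basis $\{X_i\}$ of $\Sigma$. Put $\Delta^{\mathcal H}=\mathrm{div}^{\mathcal H}\circ\nabla^{\mathcal H}$. The mean curvature of $\Sigma'$ is the horizontal vector field $\mathrm{H}^\bot=\sum_{\beta=1}^{m-k}\mathcal P(\nabla_{T_\beta}T_\beta)=\sum_{\beta=1}^{m-k}\sum_{i=1}^kg(\nabla_{T_\beta}T_\beta,X_i)X_i$, where $\{X_i\}_{i=1}^k$ and $\{T_\beta\}_{\beta=1}^{m-k}$ are (local) $g$-orthonormal bases of $\Sigma$ and $\Sigma'$. $C_0^\infty(M)$ denotes smooth functions with compact support. *)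

theory Defs
  imports "HOL-Analysis.Analysis"
begin

text \<open>
  Only ever used on open sets \<open>S\<close>, where the Frechet derivative is unique and does not depend
  on values outside \<open>S\<close>.
\<close>

primrec Ck_on :: "nat \<Rightarrow> 'x::real_normed_vector set \<Rightarrow> ('x \<Rightarrow> 'y::real_normed_vector) \<Rightarrow> bool" where
  "Ck_on 0 S f \<longleftrightarrow> continuous_on S f"
| "Ck_on (Suc n) S f \<longleftrightarrow>
     (\<forall>x\<in>S. f differentiable (at x)) \<and> (\<forall>v. Ck_on n S (\<lambda>x. frechet_derivative f (at x) v))"

definition smooth_on :: "'x::real_normed_vector set \<Rightarrow> ('x \<Rightarrow> 'y::real_normed_vector) \<Rightarrow> bool" where
  "smooth_on S f \<longleftrightarrow> (\<forall>n. Ck_on n S f)"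


section \<open>Smooth manifolds\<close>

text \<open>
  The manifold is the whole Hausdorff, second countable type \<open>'a\<close>; its dimension is \<open>CARD('n)\<close>.
  An atlas need not be maximal; it determines the smooth structure.
\<close>

type_synonym ('a, 'n) chart = "'a set \<times> ('a \<Rightarrow> real ^ 'n)"
type_synonym ('a, 'n) atlas = "('a, 'n) chart set"

definition cdom :: "('a, 'n::finite) chart \<Rightarrow> 'a set" where
  "cdom c = fst c"

definition cmap :: "('a, 'n::finite) chart \<Rightarrow> 'a \<Rightarrow> real ^ 'n" where
  "cmap c = snd c"

definition cinv :: "('a, 'n::finite) chart \<Rightarrow> real ^ 'n \<Rightarrow> 'a" where
  "cinv c = inv_into (cdom c) (cmap c)"

definition is_chart :: "('a::topological_space, 'n::finite) chart \<Rightarrow> bool" where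
  "is_chart c \<longleftrightarrow> open (cdom c) \<and> open (cmap c ` cdom c) \<and>
     homeomorphism (cdom c) (cmap c ` cdom c) (cmap c) (cinv c)"

definition compatible :: "('a, 'n::finite) chart \<Rightarrow> ('a, 'n) chart \<Rightarrow> bool" where
  "compatible c d \<longleftrightarrow>
     smooth_on (cmap c ` (cdom c \<inter> cdom d)) (cmap d \<circ> cinv c) \<and>
     smooth_on (cmap d ` (cdom c \<inter> cdom d)) (cmap c \<circ> cinv d)"

definition smooth_atlas ::
  "('a::{t2_space,second_countable_topology}, 'n::finite) atlas \<Rightarrow> bool" where
  "smooth_atlas A \<longleftrightarrow>
     (\<forall>c\<in>A. is_chart c) \<and> (\<Union>c\<in>A. cdom c) = UNIV \<and> (\<forall>c\<in>A. \<forall>d\<in>A. compatible c d)"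

definition smooth_fun_on ::
  "('a, 'n::finite) atlas \<Rightarrow> 'a set \<Rightarrow> ('a \<Rightarrow> 'y::real_normed_vector) \<Rightarrow> bool" where
  "smooth_fun_on A W f \<longleftrightarrow> (\<forall>c\<in>A. smooth_on (cmap c ` (cdom c \<inter> W)) (f \<circ> cinv c))"

definition smooth_compact_support ::
  "('a::topological_space, 'n::finite) atlas \<Rightarrow> ('a \<Rightarrow> real) set" where
  "smooth_compact_support A =
     {f. smooth_fun_on A UNIV f \<and> compact (closure {p. f p \<noteq> 0})}"


section \<open>Tangent vectors and vector fields\<close>

text \<open>
  For every point \<open>p\<close> a chart around \<open>p\<close> is chosen, and the tangent space at \<open>p\<close> is represented
  by \<open>real ^ 'n\<close> via the coordinates in that chart. The choice at different points is unrelated,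
  so a vector field is a function \<open>X :: 'a \<Rightarrow> real ^ 'n\<close> whose smoothness must be (and is) read
  off in a fixed chart, never from \<open>X\<close> directly.
\<close>

definition chart_at :: "('a, 'n::finite) atlas \<Rightarrow> 'a \<Rightarrow> ('a, 'n) chart" where
  "chart_at A p = (SOME c. c \<in> A \<and> p \<in> cdom c)"

text \<open>
  \<open>tdiff A f p v\<close> is the derivative at \<open>p\<close> of \<open>f\<close> (with values in a normed space) in the direction
  of the tangent vector \<open>v\<close>. In particular \<open>tdiff A (cmap c) p v\<close> are the coordinates of \<open>v\<close>
  in the chart \<open>c\<close>, and \<open>tvec A c p\<close> is the inverse of \<open>tdiff A (cmap c) p\<close>.
\<close>

definition tdiff ::
  "('a, 'n::finite) atlas \<Rightarrow> ('a \<Rightarrow> 'y::real_normed_vector) \<Rightarrow> 'a \<Rightarrow> real ^ 'n \<Rightarrow> 'y" where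
  "tdiff A f p v =
     frechet_derivative (f \<circ> cinv (chart_at A p)) (at (cmap (chart_at A p) p)) v"

definition tvec ::
  "('a, 'n::finite) atlas \<Rightarrow> ('a, 'n) chart \<Rightarrow> 'a \<Rightarrow> real ^ 'n \<Rightarrow> real ^ 'n" where
  "tvec A c p w = frechet_derivative (cmap (chart_at A p) \<circ> cinv c) (at (cmap c p)) w"

definition smooth_vf_on ::
  "('a, 'n::finite) atlas \<Rightarrow> 'a set \<Rightarrow> ('a \<Rightarrow> real ^ 'n) \<Rightarrow> bool" where
  "smooth_vf_on A W X \<longleftrightarrow>
     (\<forall>c\<in>A. smooth_on (cmap c ` (cdom c \<inter> W)) ((\<lambda>q. tdiff A (cmap c) q (X q)) \<circ> cinv c))"

text \<open>
  The coordinate formula \<open>[X,Y]\<^sup>i = X(Y\<^sup>i) - Y(X\<^sup>i)\<close>, evaluated at \<open>p\<close> in the chart that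
  represents the tangent space at \<open>p\<close>.
\<close>

definition lie_bracket ::
  "('a, 'n::finite) atlas \<Rightarrow> ('a \<Rightarrow> real ^ 'n) \<Rightarrow> ('a \<Rightarrow> real ^ 'n) \<Rightarrow> 'a \<Rightarrow> real ^ 'n" where
  "lie_bracket A X Y p =
     tdiff A (\<lambda>q. tdiff A (cmap (chart_at A p)) q (Y q)) p (X p) -
     tdiff A (\<lambda>q. tdiff A (cmap (chart_at A p)) q (X q)) p (Y p)"


section \<open>Distributions and metrics on them\<close>

text \<open>A distribution assigns to each point a subspace of the tangent space at that point.\<close>

type_synonym ('a, 'n) distribution = "'a \<Rightarrow> (real ^ 'n) set"
type_synonym ('a, 'n) fibre_form = "'a \<Rightarrow> real ^ 'n \<Rightarrow> real ^ 'n \<Rightarrow> real"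

abbreviation tangent_bundle :: "('a, 'n::finite) distribution" where
  "tangent_bundle \<equiv> (\<lambda>_. UNIV)"

definition sections ::
  "('a, 'n::finite) atlas \<Rightarrow> ('a, 'n) distribution \<Rightarrow> 'a set \<Rightarrow> ('a \<Rightarrow> real ^ 'n) set" where
  "sections A E W = {X. smooth_vf_on A W X \<and> (\<forall>p\<in>W. X p \<in> E p)}"

definition smooth_distribution ::
  "('a::topological_space, 'n::finite) atlas \<Rightarrow> nat \<Rightarrow> ('a, 'n) distribution \<Rightarrow> bool" where
  "smooth_distribution A r E \<longleftrightarrow>
     (\<forall>p. subspace (E p) \<and> dim (E p) = r) \<and>
     (\<forall>p. \<exists>W X. open W \<and> p \<in> W \<and> (\<forall>i<r. X i \<in> sections A E W) \<and>
        (\<forall>q\<in>W. span ((\<lambda>i. X i q) ` {..<r}) = E q))"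

text \<open>
  Integrability: around every point there is a flat chart, in which the distribution is a
  constant subspace, i.e. it is tangent to the leaves of a foliation.
\<close>

definition integrable_distribution ::
  "('a::topological_space, 'n::finite) atlas \<Rightarrow> ('a, 'n) distribution \<Rightarrow> bool" where
  "integrable_distribution A E \<longleftrightarrow>
     (\<forall>p. \<exists>c. is_chart c \<and> p \<in> cdom c \<and> (\<forall>d\<in>A. compatible c d) \<and>
        (\<exists>L. \<forall>q\<in>cdom c. tdiff A (cmap c) q ` E q = L))"

text \<open>Smooth inner product on the subbundle \<open>E\<close>; values outside \<open>E\<close> are irrelevant.\<close>

definition fibre_metric ::
  "('a::topological_space, 'n::finite) atlas \<Rightarrow> ('a, 'n) distribution \<Rightarrow> ('a, 'n) fibre_form \<Rightarrow> bool" where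
  "fibre_metric A E g \<longleftrightarrow>
     (\<forall>p. \<forall>x\<in>E p. \<forall>y\<in>E p. \<forall>z\<in>E p. \<forall>a b. g p (a *\<^sub>R x + b *\<^sub>R y) z = a * g p x z + b * g p y z) \<and>
     (\<forall>p. \<forall>x\<in>E p. \<forall>y\<in>E p. g p x y = g p y x) \<and>
     (\<forall>p. \<forall>x\<in>E p. x \<noteq> 0 \<longrightarrow> g p x x > 0) \<and>
     (\<forall>W. open W \<longrightarrow> (\<forall>X\<in>sections A E W. \<forall>Y\<in>sections A E W.
        smooth_fun_on A W (\<lambda>p. g p (X p) (Y p))))"

definition sub_riemannian ::
  "('a::{t2_space,second_countable_topology}, 'n::finite) atlas \<Rightarrow> nat \<Rightarrow>
     ('a, 'n) distribution \<Rightarrow> ('a, 'n) fibre_form \<Rightarrow> bool" where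
  "sub_riemannian A k H gc \<longleftrightarrow>
     smooth_atlas A \<and> k < CARD('n) \<and> smooth_distribution A k H \<and>
     \<not> integrable_distribution A H \<and> fibre_metric A H gc"

definition splitting ::
  "('a::topological_space, 'n::finite) atlas \<Rightarrow> nat \<Rightarrow>
     ('a, 'n) distribution \<Rightarrow> ('a, 'n) distribution \<Rightarrow> bool" where
  "splitting A k H V \<longleftrightarrow>
     smooth_distribution A (CARD('n) - k) V \<and>
     (\<forall>p. H p \<inter> V p = {0} \<and> {x + y |x y. x \<in> H p \<and> y \<in> V p} = UNIV)"

definition proj ::
  "('a, 'n::finite) distribution \<Rightarrow> ('a, 'n) distribution \<Rightarrow> 'a \<Rightarrow> real ^ 'n \<Rightarrow> real ^ 'n" where
  "proj H V p v = (THE h. h \<in> H p \<and> v - h \<in> V p)"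

definition orthogonal_extension ::
  "('a::topological_space, 'n::finite) atlas \<Rightarrow> ('a, 'n) distribution \<Rightarrow> ('a, 'n) distribution \<Rightarrow>
     ('a, 'n) fibre_form \<Rightarrow> ('a, 'n) fibre_form \<Rightarrow> bool" where
  "orthogonal_extension A H V gc g \<longleftrightarrow>
     fibre_metric A tangent_bundle g \<and>
     (\<forall>p. \<forall>x\<in>H p. \<forall>y\<in>H p. g p x y = gc p x y) \<and>
     (\<forall>p. \<forall>x\<in>H p. \<forall>y\<in>V p. g p x y = 0)"

definition orthonormal_frame ::
  "('a::topological_space, 'n::finite) atlas \<Rightarrow> ('a, 'n) distribution \<Rightarrow> ('a, 'n) fibre_form \<Rightarrow>
     nat \<Rightarrow> 'a set \<Rightarrow> (nat \<Rightarrow> 'a \<Rightarrow> real ^ 'n) \<Rightarrow> bool" where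
  "orthonormal_frame A E g r W X \<longleftrightarrow>
     open W \<and> (\<forall>i<r. X i \<in> sections A E W) \<and>
     (\<forall>p\<in>W. span ((\<lambda>i. X i p) ` {..<r}) = E p \<and>
        (\<forall>i<r. \<forall>j<r. g p (X i p) (X j p) = (if i = j then 1 else 0)))"

text \<open>An orthonormal frame on some neighbourhood of \<open>p\<close>.\<close>

definition frame_at ::
  "('a::topological_space, 'n::finite) atlas \<Rightarrow> ('a, 'n) distribution \<Rightarrow> ('a, 'n) fibre_form \<Rightarrow>
     nat \<Rightarrow> 'a \<Rightarrow> nat \<Rightarrow> 'a \<Rightarrow> real ^ 'n" where
  "frame_at A E g r p = (SOME X. \<exists>W. p \<in> W \<and> orthonormal_frame A E g r W X)"


section \<open>Connections\<close>

text \<open>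
  \<open>D X Y\<close> is the derivative of \<open>Y\<close> along \<open>X\<close>, where both are sections of \<open>E\<close>. The axioms are
  required for sections over every open set \<open>W\<close>, since local frames get differentiated.
\<close>

type_synonym ('a, 'n) conn =
  "('a \<Rightarrow> real ^ 'n) \<Rightarrow> ('a \<Rightarrow> real ^ 'n) \<Rightarrow> 'a \<Rightarrow> real ^ 'n"

definition connection ::
  "('a::topological_space, 'n::finite) atlas \<Rightarrow> ('a, 'n) distribution \<Rightarrow> ('a, 'n) conn \<Rightarrow> bool" where
  "connection A E D \<longleftrightarrow>
     (\<forall>W. open W \<longrightarrow> (\<forall>X\<in>sections A E W. \<forall>Y\<in>sections A E W.
        D X Y \<in> sections A E W \<and>
        (\<forall>Z\<in>sections A E W. \<forall>p\<in>W.
           D (\<lambda>q. X q + Z q) Y p = D X Y p + D Z Y p \<and>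
           D X (\<lambda>q. Y q + Z q) p = D X Y p + D X Z p) \<and>
        (\<forall>f::'a \<Rightarrow> real. smooth_fun_on A W f \<longrightarrow> (\<forall>p\<in>W.
           D (\<lambda>q. f q *\<^sub>R X q) Y p = f p *\<^sub>R D X Y p \<and>
           D X (\<lambda>q. f q *\<^sub>R Y q) p = tdiff A f p (X p) *\<^sub>R Y p + f p *\<^sub>R D X Y p))))"

definition metric_connection ::
  "('a::topological_space, 'n::finite) atlas \<Rightarrow> ('a, 'n) distribution \<Rightarrow> ('a, 'n) fibre_form \<Rightarrow>
     ('a, 'n) conn \<Rightarrow> bool" where
  "metric_connection A E g D \<longleftrightarrow>
     connection A E D \<and>
     (\<forall>W. open W \<longrightarrow> (\<forall>X\<in>sections A E W. \<forall>Y\<in>sections A E W. \<forall>Z\<in>sections A E W. \<forall>p\<in>W.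
        tdiff A (\<lambda>q. g q (Y q) (Z q)) p (X p) = g p (D X Y p) (Z p) + g p (Y p) (D X Z p)))"

text \<open>
  The next two predicates determine the connection uniquely (on smooth sections).
\<close>

definition levi_civita ::
  "('a::topological_space, 'n::finite) atlas \<Rightarrow> ('a, 'n) fibre_form \<Rightarrow> ('a, 'n) conn \<Rightarrow> bool" where
  "levi_civita A g N \<longleftrightarrow>
     metric_connection A tangent_bundle g N \<and>
     (\<forall>W. open W \<longrightarrow> (\<forall>X\<in>sections A tangent_bundle W. \<forall>Y\<in>sections A tangent_bundle W. \<forall>p\<in>W.
        N X Y p - N Y X p = lie_bracket A X Y p))"

definition horizontal_connection ::
  "('a::topological_space, 'n::finite) atlas \<Rightarrow> ('a, 'n) distribution \<Rightarrow> ('a, 'n) distribution \<Rightarrow>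
     ('a, 'n) fibre_form \<Rightarrow> ('a, 'n) conn \<Rightarrow> bool" where
  "horizontal_connection A H V gc D \<longleftrightarrow>
     metric_connection A H gc D \<and>
     (\<forall>W. open W \<longrightarrow> (\<forall>X\<in>sections A H W. \<forall>Y\<in>sections A H W. \<forall>p\<in>W.
        D X Y p - D Y X p = proj H V p (lie_bracket A X Y p)))"


section \<open>Horizontal operators, mean curvature and Riemannian measure\<close>

definition hgrad ::
  "('a::topological_space, 'n::finite) atlas \<Rightarrow> ('a, 'n) distribution \<Rightarrow> ('a, 'n) fibre_form \<Rightarrow>
     ('a \<Rightarrow> real) \<Rightarrow> 'a \<Rightarrow> real ^ 'n" where
  "hgrad A H gc f =
     (THE G. G \<in> sections A H UNIV \<and>
        (\<forall>X\<in>sections A H UNIV. \<forall>p. gc p (G p) (X p) = tdiff A f p (X p)))"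

definition hdiv ::
  "('a::topological_space, 'n::finite) atlas \<Rightarrow> nat \<Rightarrow> ('a, 'n) distribution \<Rightarrow>
     ('a, 'n) fibre_form \<Rightarrow> ('a, 'n) conn \<Rightarrow> ('a \<Rightarrow> real ^ 'n) \<Rightarrow> 'a \<Rightarrow> real" where
  "hdiv A k H gc D X p =
     (let F = frame_at A H gc k p in \<Sum>i<k. gc p (D (F i) X p) (F i p))"

definition hlap ::
  "('a::topological_space, 'n::finite) atlas \<Rightarrow> nat \<Rightarrow> ('a, 'n) distribution \<Rightarrow>
     ('a, 'n) fibre_form \<Rightarrow> ('a, 'n) conn \<Rightarrow> ('a \<Rightarrow> real) \<Rightarrow> 'a \<Rightarrow> real" where
  "hlap A k H gc D = hdiv A k H gc D \<circ> hgrad A H gc"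

text \<open>The mean curvature of the complement \<open>V\<close> of \<open>H\<close>; \<open>N\<close> is the Levi-Civita connection of \<open>g\<close>.\<close>

definition mean_curvature ::
  "('a::topological_space, 'n::finite) atlas \<Rightarrow> nat \<Rightarrow> ('a, 'n) distribution \<Rightarrow>
     ('a, 'n) distribution \<Rightarrow> ('a, 'n) fibre_form \<Rightarrow> ('a, 'n) conn \<Rightarrow> 'a \<Rightarrow> real ^ 'n" where
  "mean_curvature A k H V g N p =
     (let T = frame_at A V g (CARD('n) - k) p in
        \<Sum>b<CARD('n) - k. proj H V p (N (T b) (T b) p))"

text \<open>The matrix of \<open>g\<close> at \<open>q\<close> in the coordinate basis of the chart \<open>c\<close>.\<close>

definition gram ::
  "('a, 'n::finite) atlas \<Rightarrow> ('a, 'n) fibre_form \<Rightarrow> ('a, 'n) chart \<Rightarrow> 'a \<Rightarrow> real ^ 'n ^ 'n" where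
  "gram A g c q = (\<chi> i j. g q (tvec A c q (axis i 1)) (tvec A c q (axis j 1)))"

text \<open>The Borel measure given by \<open>sqrt (det g) dx\<close> in every chart; this determines it uniquely.\<close>

definition riemannian_measure ::
  "('a::topological_space, 'n::finite) atlas \<Rightarrow> ('a, 'n) fibre_form \<Rightarrow> 'a measure \<Rightarrow> bool" where
  "riemannian_measure A g M \<longleftrightarrow>
     sets M = sets borel \<and>
     (\<forall>c\<in>A. \<forall>B\<in>sets borel. B \<subseteq> cdom c \<longrightarrow>
        emeasure M B =
          (\<integral>\<^sup>+ y. ennreal (sqrt (det (gram A g c (cinv c y)))) * indicator (cmap c ` B) y \<partial>lborel))"

end

theory Submission
  imports Defs
begin

text \<open>
  Let \<open>X\<close> be a horizontal vector field, and let \<open>F i\<close> and \<open>T b\<close> form local orthonormal frames of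
  the distribution \<open>H\<close> and of its complement \<open>V\<close>. Both connections enter the statement only through
  traces, and in these traces they can be traded for Lie brackets: the torsion condition replaces
  \<open>D (F i) X\<close> by the horizontal part of \<open>[F i, X]\<close> plus \<open>D X (F i)\<close>; the latter is orthogonal to
  the unit field \<open>F i\<close>, and the vertical part of the bracket is orthogonal to it anyway. The same
  argument applies to \<open>nabla\<close> and \<open>T b\<close>. Hence the horizontal divergence \<open>div_H X\<close> is the sum
  of the \<open>g ([F i, X], F i)\<close>, while the product \<open>gc (X, H_perp)\<close> with the mean curvature \<open>H_perp\<close>
  of \<open>V\<close> is minus the sum of the \<open>g ([T b, X], T b)\<close>. Their difference \<open>div_H X - gc (X, H_perp)\<close>
  is the sum of \<open>g ([Y, X], Y)\<close> over a full orthonormal frame (\<open>adapted_frame\<close>). In every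
  chart this sum equals the Riemannian divergence of \<open>X\<close>, that is, the Euclidean divergence of the
  components of \<open>X\<close> multiplied by the square root of the Gram determinant, divided by that
  square root (\<open>frame_divergence_in_chart\<close>, \<open>divergence_in_chart\<close>).
  This needs the coordinate formula of the Lie bracket in a chart other than the one in which it is
  defined, hence Schwarz's theorem (\<open>tdiff_lie_bracket\<close>), and Jacobi's formula for the
  derivative of a determinant (\<open>has_derivative_det_orthonormal\<close>).

  Since the integral of a derivative of a compactly supported function on \<open>real ^ 'n\<close> vanishes,
  cutting a compactly supported function \<open>w\<close> into pieces supported in charts gives the divergence
  theorem (\<open>divergence_theorem\<close>): the integral of
  \<open>w (div_H X - gc (X, H_perp)) + X w\<close> is zero. For \<open>X = grad_H e\<close> and \<open>w = f u\<close> this says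
  that the two sides of the integration by parts formula with respect to \<open>u vol\<close> differ by the
  integral of \<open>f u gc (grad_H e, grad_H (ln u) - H_perp)\<close> (\<open>integration_by_parts\<close>).
  So the formula holds if \<open>grad_H (ln u) = H_perp\<close>. Conversely, if these two vectors differ at
  \<open>p\<close>, some test function \<open>e\<close> makes the continuous function
  \<open>u gc (grad_H e, grad_H (ln u) - H_perp)\<close> positive near \<open>p\<close>, and a bump function \<open>f\<close> supported
  there makes the integral positive.
\<close>

section \<open>Calculus of smooth maps on open sets\<close>

lemma has_derivative_cong_open:
  assumes "open S" "x \<in> S" "\<And>y. y \<in> S \<Longrightarrow> f y = g y"
  shows "(f has_derivative F) (at x) \<longleftrightarrow> (g has_derivative F) (at x)"
  using has_derivative_transform_within_open[of f F x UNIV S g]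
    has_derivative_transform_within_open[of g F x UNIV S f] assms by auto

lemma frechet_derivative_cong_open:
  assumes "open S" "x \<in> S" "\<And>y. y \<in> S \<Longrightarrow> f y = g y"
  shows "frechet_derivative f (at x) = frechet_derivative g (at x)"
  unfolding frechet_derivative_def using has_derivative_cong_open[OF assms] by simp

lemma differentiable_cong_open:
  assumes "open S" "x \<in> S" "\<And>y. y \<in> S \<Longrightarrow> f y = g y"
  shows "f differentiable (at x) \<longleftrightarrow> g differentiable (at x)"
  unfolding differentiable_def using has_derivative_cong_open[OF assms] by simp

lemma frechet_derivative_eq:
  "(f has_derivative F) (at x) \<Longrightarrow> frechet_derivative f (at x) = F"
  by (metis frechet_derivative_at)

lemma Ck_on_cong:
  assumes "open S" "\<And>x. x \<in> S \<Longrightarrow> f x = g x"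
  shows "Ck_on n S f \<longleftrightarrow> Ck_on n S g"
  using assms(2)
proof (induction n arbitrary: f g)
  case 0
  then show ?case by (simp cong: continuous_on_cong)
next
  case (Suc n)
  have "Ck_on n S (\<lambda>x. frechet_derivative f (at x) v) \<longleftrightarrow> Ck_on n S (\<lambda>x. frechet_derivative g (at x) v)" for v
    by (rule Suc.IH) (metis frechet_derivative_cong_open assms(1) Suc.prems)
  moreover have "f differentiable (at x) \<longleftrightarrow> g differentiable (at x)" if "x \<in> S" for x
    using differentiable_cong_open[OF assms(1) that] Suc.prems by blast
  ultimately show ?case by simp
qed

lemma Ck_on_SucD: "Ck_on (Suc n) S f \<Longrightarrow> Ck_on n S f"
proof (induction n arbitrary: f)
  case 0
  then show ?case
    by (auto intro!: continuous_at_imp_continuous_on differentiable_imp_continuous_within)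
next
  case (Suc n)
  then show ?case by (metis Ck_on.simps(2))
qed

lemma Ck_on_subset: "Ck_on n S f \<Longrightarrow> T \<subseteq> S \<Longrightarrow> Ck_on n T f"
  by (induction n arbitrary: f) (auto intro: continuous_on_subset)

lemma Ck_on_locally:
  assumes "\<And>x. x \<in> S \<Longrightarrow> \<exists>T. open T \<and> x \<in> T \<and> Ck_on n T f"
  shows "Ck_on n S f"
  using assms
proof (induction n arbitrary: f)
  case 0
  then show ?case
    by (metis Ck_on.simps(1) continuous_at_imp_continuous_on continuous_on_eq_continuous_at)
next
  case (Suc n)
  have "Ck_on n S (\<lambda>x. frechet_derivative f (at x) v)" for v
    by (rule Suc.IH) (metis Suc.prems Ck_on.simps(2))
  moreover have "f differentiable (at x)" if "x \<in> S" for x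
    using Suc.prems[OF that] by auto
  ultimately show ?case by simp
qed

lemma Ck_on_const [simp]: "Ck_on n S (\<lambda>x. c)"
  by (induction n arbitrary: c) auto

lemma Ck_on_bounded_linear:
  assumes "bounded_linear f"
  shows "Ck_on n S f"
proof (cases n)
  case 0
  then show ?thesis using linear_continuous_on[OF assms] by simp
next
  case (Suc m)
  have "(f has_derivative f) (at x)" for x
    by (simp add: assms bounded_linear_imp_has_derivative)
  then have "frechet_derivative f (at x) = f" "f differentiable (at x)" for x
    by (auto simp: frechet_derivative_eq differentiable_def)
  then show ?thesis using Suc by simp
qed

lemma Ck_on_add:
  assumes "open S" "Ck_on n S f" "Ck_on n S g"
  shows "Ck_on n S (\<lambda>x. f x + g x)"
  using assms(2,3)
proof (induction n arbitrary: f g)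
  case 0
  then show ?case by (auto intro: continuous_intros)
next
  case (Suc n)
  have "Ck_on n S (\<lambda>x. frechet_derivative (\<lambda>x. f x + g x) (at x) v)" for v
    by (subst Ck_on_cong[OF assms(1), where
          g = "\<lambda>x. frechet_derivative f (at x) v + frechet_derivative g (at x) v"])
      (use Suc in \<open>auto simp: frechet_derivative_works intro!: fun_cong[OF frechet_derivative_eq] derivative_intros\<close>)
  then show ?case using Suc.prems by (auto intro: differentiable_add)
qed

text \<open>One Leibniz rule serves products of numbers, scalar multiples and inner products alike.\<close>

lemma Ck_on_bilinear:
  assumes "bounded_bilinear pr" "open S" "Ck_on n S f" "Ck_on n S g"
  shows "Ck_on n S (\<lambda>x. pr (f x) (g x))"
  using assms(3,4)
proof (induction n arbitrary: f g)
  case 0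
  then show ?case using bounded_bilinear.continuous_on[OF assms(1)] by auto
next
  case (Suc n)
  have D: "((\<lambda>x. pr (f x) (g x)) has_derivative (\<lambda>v. pr (f x) (frechet_derivative g (at x) v) +
      pr (frechet_derivative f (at x) v) (g x))) (at x)" if "x \<in> S" for x
    using Suc.prems that
    by (intro bounded_bilinear.FDERIV[OF assms(1)]) (auto simp: frechet_derivative_works)
  have "Ck_on n S (\<lambda>x. frechet_derivative (\<lambda>x. pr (f x) (g x)) (at x) v)" for v
  proof (subst Ck_on_cong[OF assms(2)])
    show "frechet_derivative (\<lambda>x. pr (f x) (g x)) (at x) v = pr (f x) (frechet_derivative g (at x) v) +
        pr (frechet_derivative f (at x) v) (g x)" if "x \<in> S" for x
      using frechet_derivative_eq[OF D[OF that]] by simp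
    have "Ck_on n S f" "Ck_on n S g" using Suc.prems Ck_on_SucD by blast+
    then show "Ck_on n S (\<lambda>x. pr (f x) (frechet_derivative g (at x) v) +
        pr (frechet_derivative f (at x) v) (g x))"
      using Suc.prems by (intro Ck_on_add[OF assms(2)] Suc.IH) auto
  qed
  then show ?case using D by (auto simp: differentiable_def)
qed

lemma Ck_on_sum:
  assumes "open S" "\<And>i. i \<in> I \<Longrightarrow> Ck_on n S (f i)"
  shows "Ck_on n S (\<lambda>x. \<Sum>i\<in>I. f i x)"
  using assms(2) by (induction I rule: infinite_finite_induct) (auto intro: Ck_on_add[OF assms(1)])

lemma linear_euclidean_expand:
  fixes L :: "'x::euclidean_space \<Rightarrow> 'y::real_vector"
  assumes "linear L"
  shows "L v = (\<Sum>b\<in>Basis. (v \<bullet> b) *\<^sub>R L b)"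
proof -
  have "L v = L (\<Sum>b\<in>Basis. (v \<bullet> b) *\<^sub>R b)" by (simp add: euclidean_representation)
  then show ?thesis by (simp add: linear_sum[OF assms] linear_cmul[OF assms])
qed

lemma Ck_on_compose:
  fixes f :: "'y::euclidean_space \<Rightarrow> 'z::real_normed_vector"
  assumes "open S" "open T" "Ck_on n T f" "Ck_on n S g" "g ` S \<subseteq> T"
  shows "Ck_on n S (\<lambda>x. f (g x))"
  using assms(3,4)
proof (induction n arbitrary: f)
  case 0
  then show ?case using continuous_on_compose2[OF _ _ assms(5)] by simp
next
  case (Suc n)
  have lin: "linear (frechet_derivative f (at (g x)))" if "x \<in> S" for x
    using Suc.prems that assms(5) by (intro linear_frechet_derivative) auto
  have D: "((\<lambda>x. f (g x)) has_derivative (\<lambda>v. frechet_derivative f (at (g x)) (frechet_derivative g (at x) v)))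
      (at x)" if "x \<in> S" for x
  proof -
    have "(g has_derivative frechet_derivative g (at x)) (at x)"
      using Suc.prems(2) that frechet_derivative_works by auto
    moreover have "g x \<in> T" using assms(5) that by blast
    then have "(f has_derivative frechet_derivative f (at (g x))) (at (g x))"
      using Suc.prems(1) frechet_derivative_works by auto
    ultimately show ?thesis using has_derivative_compose by fast
  qed
  have "Ck_on n S (\<lambda>x. frechet_derivative (\<lambda>x. f (g x)) (at x) v)" for v
  proof (subst Ck_on_cong[OF assms(1)])
    show "frechet_derivative (\<lambda>x. f (g x)) (at x) v =
        (\<Sum>b\<in>Basis. (frechet_derivative g (at x) v \<bullet> b) *\<^sub>R frechet_derivative f (at (g x)) b)"
      if "x \<in> S" for x
      by (rule trans[OF fun_cong[OF frechet_derivative_eq[OF D[OF that]]] linear_euclidean_expand[OF lin[OF that]]])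
    have "Ck_on n S g" using Suc.prems Ck_on_SucD by blast
    then show "Ck_on n S (\<lambda>x. \<Sum>b\<in>Basis. (frechet_derivative g (at x) v \<bullet> b) *\<^sub>R frechet_derivative f (at (g x)) b)"
      using Suc.prems
      by (intro Ck_on_sum[OF assms(1)] Ck_on_bilinear[OF bounded_bilinear_scaleR assms(1)]
          Ck_on_bilinear[OF bounded_bilinear_inner assms(1)] Suc.IH) auto
  qed
  then show ?case using D by (auto simp: differentiable_def)
qed

lemma Ck_on_Suc_realI:
  fixes f :: "real \<Rightarrow> real"
  assumes "open S" "\<And>t. t \<in> S \<Longrightarrow> (f has_real_derivative f' t) (at t)" "Ck_on n S f'"
  shows "Ck_on (Suc n) S f"
proof -
  have D: "(f has_derivative (\<lambda>v. f' t * v)) (at t)" if "t \<in> S" for t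
    using assms(2)[OF that] by (simp add: has_field_derivative_def)
  have "Ck_on n S (\<lambda>t. frechet_derivative f (at t) v)" for v
    by (subst Ck_on_cong[OF assms(1), where g = "\<lambda>t. f' t * v"])
      (auto simp: frechet_derivative_eq[OF D] intro: Ck_on_bilinear[OF bounded_bilinear_mult assms(1)] assms)
  then show ?thesis using D by (auto simp: differentiable_def)
qed

lemma smooth_on_Ck: "smooth_on S f \<Longrightarrow> Ck_on n S f"
  by (simp add: smooth_on_def)

lemma smooth_on_differentiable: "smooth_on S f \<Longrightarrow> x \<in> S \<Longrightarrow> f differentiable (at x)"
  using smooth_on_Ck[of S f "Suc 0"] by simp

lemma smooth_on_has_derivative:
  "smooth_on S f \<Longrightarrow> x \<in> S \<Longrightarrow> (f has_derivative frechet_derivative f (at x)) (at x)"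
  using smooth_on_differentiable frechet_derivative_works by blast

lemma smooth_on_continuous: "smooth_on S f \<Longrightarrow> continuous_on S f"
  using smooth_on_Ck[of S f 0] by simp

lemma smooth_on_subset: "smooth_on S f \<Longrightarrow> T \<subseteq> S \<Longrightarrow> smooth_on T f"
  unfolding smooth_on_def using Ck_on_subset by blast

lemma smooth_on_cong:
  "open S \<Longrightarrow> (\<And>x. x \<in> S \<Longrightarrow> f x = g x) \<Longrightarrow> smooth_on S f \<longleftrightarrow> smooth_on S g"
  unfolding smooth_on_def using Ck_on_cong by blast

lemma smooth_on_locally:
  assumes "\<And>x. x \<in> S \<Longrightarrow> \<exists>T. open T \<and> x \<in> T \<and> smooth_on T f"
  shows "smooth_on S f"
  unfolding smooth_on_def using Ck_on_locally assms smooth_on_Ck by metis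

lemma smooth_on_const [simp]: "smooth_on S (\<lambda>x. c)"
  by (simp add: smooth_on_def)

lemma smooth_on_bounded_linear: "bounded_linear f \<Longrightarrow> smooth_on S f"
  by (simp add: smooth_on_def Ck_on_bounded_linear)

lemma smooth_on_ident [simp]: "smooth_on S (\<lambda>x. x)"
  by (simp add: smooth_on_bounded_linear bounded_linear_ident)

lemma smooth_on_add:
  "open S \<Longrightarrow> smooth_on S f \<Longrightarrow> smooth_on S g \<Longrightarrow> smooth_on S (\<lambda>x. f x + g x)"
  by (simp add: smooth_on_def Ck_on_add)

lemma smooth_on_bilinear:
  "bounded_bilinear pr \<Longrightarrow> open S \<Longrightarrow> smooth_on S f \<Longrightarrow> smooth_on S g \<Longrightarrow> smooth_on S (\<lambda>x. pr (f x) (g x))"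
  by (simp add: smooth_on_def Ck_on_bilinear)

lemmas smooth_on_mult = smooth_on_bilinear[OF bounded_bilinear_mult]
lemmas smooth_on_scaleR = smooth_on_bilinear[OF bounded_bilinear_scaleR]
lemmas smooth_on_inner = smooth_on_bilinear[OF bounded_bilinear_inner]

lemma smooth_on_sum:
  "open S \<Longrightarrow> (\<And>i. i \<in> I \<Longrightarrow> smooth_on S (f i)) \<Longrightarrow> smooth_on S (\<lambda>x. \<Sum>i\<in>I. f i x)"
  by (simp add: smooth_on_def Ck_on_sum)

lemma smooth_on_prod:
  fixes f :: "'i \<Rightarrow> 'x::real_normed_vector \<Rightarrow> real"
  shows "open S \<Longrightarrow> (\<And>i. i \<in> I \<Longrightarrow> smooth_on S (f i)) \<Longrightarrow> smooth_on S (\<lambda>x. \<Prod>i\<in>I. f i x)"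
  by (induction I rule: infinite_finite_induct) (auto intro: smooth_on_mult)

lemma smooth_on_compose:
  fixes f :: "'y::euclidean_space \<Rightarrow> 'z::real_normed_vector"
  shows "open S \<Longrightarrow> open T \<Longrightarrow> smooth_on T f \<Longrightarrow> smooth_on S g \<Longrightarrow> g ` S \<subseteq> T \<Longrightarrow>
    smooth_on S (\<lambda>x. f (g x))"
  unfolding smooth_on_def using Ck_on_compose by blast

lemma smooth_on_linear_compose:
  fixes L :: "'y::euclidean_space \<Rightarrow> 'z::real_normed_vector"
  shows "open S \<Longrightarrow> bounded_linear L \<Longrightarrow> smooth_on S g \<Longrightarrow> smooth_on S (\<lambda>x. L (g x))"
  by (rule smooth_on_compose[of S UNIV]) (auto intro: smooth_on_bounded_linear)

lemma smooth_on_minus: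
  fixes f :: "'x::real_normed_vector \<Rightarrow> 'y::euclidean_space"
  shows "open S \<Longrightarrow> smooth_on S f \<Longrightarrow> smooth_on S (\<lambda>x. - f x)"
  by (rule smooth_on_linear_compose) (auto intro: bounded_linear_minus bounded_linear_ident)

lemma smooth_on_diff:
  fixes f :: "'x::real_normed_vector \<Rightarrow> 'y::euclidean_space"
  shows "open S \<Longrightarrow> smooth_on S f \<Longrightarrow> smooth_on S g \<Longrightarrow> smooth_on S (\<lambda>x. f x - g x)"
  using smooth_on_add[of S f "\<lambda>x. - g x"] smooth_on_minus[of S g] by simp

lemma smooth_on_vec_nth:
  fixes f :: "'x::real_normed_vector \<Rightarrow> real ^ 'n"
  shows "open S \<Longrightarrow> smooth_on S f \<Longrightarrow> smooth_on S (\<lambda>x. f x $ i)"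
  by (rule smooth_on_linear_compose) (auto intro: bounded_linear_vec_nth)

lemma smooth_on_frechet_derivative:
  fixes f :: "'x::euclidean_space \<Rightarrow> 'y::real_normed_vector"
  assumes "open S" "smooth_on S f" "smooth_on S h"
  shows "smooth_on S (\<lambda>x. frechet_derivative f (at x) (h x))"
proof (subst smooth_on_cong[OF assms(1)])
  show "frechet_derivative f (at x) (h x) = (\<Sum>b\<in>Basis. (h x \<bullet> b) *\<^sub>R frechet_derivative f (at x) b)"
    if "x \<in> S" for x
    by (rule linear_euclidean_expand)
      (use smooth_on_differentiable[OF assms(2) that] in \<open>auto intro: linear_frechet_derivative\<close>)
  have "smooth_on S (\<lambda>x. frechet_derivative f (at x) b)" for b
    using assms(2) unfolding smooth_on_def by (metis Ck_on.simps(2))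
  then show "smooth_on S (\<lambda>x. \<Sum>b\<in>Basis. (h x \<bullet> b) *\<^sub>R frechet_derivative f (at x) b)"
    using assms by (intro smooth_on_sum smooth_on_scaleR smooth_on_inner) auto
qed

lemma smooth_on_inverse:
  fixes f :: "'x::real_normed_vector \<Rightarrow> real"
  assumes "open S" "smooth_on S f" "\<And>x. x \<in> S \<Longrightarrow> f x \<noteq> 0"
  shows "smooth_on S (\<lambda>x. inverse (f x))"
proof -
  have op: "open (- {0::real})" by auto
  have "Ck_on n (- {0}) (inverse :: real \<Rightarrow> real)" for n
  proof (induction n)
    case 0
    then show ?case by (auto intro!: continuous_intros)
  next
    case (Suc n)
    have "Ck_on n (- {0}) (\<lambda>t::real. (-1) * (inverse t * inverse t))"
      by (intro Ck_on_bilinear[OF bounded_bilinear_mult op] Suc Ck_on_const)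
    moreover have "(inverse has_real_derivative (-1) * (inverse t * inverse t)) (at t)"
      if "t \<in> - {0}" for t :: real
      using DERIV_inverse[of t] that by (simp add: power2_eq_square)
    ultimately show ?case by (rule Ck_on_Suc_realI[OF op, rotated])
  qed
  then have "smooth_on (- {0}) (inverse :: real \<Rightarrow> real)" by (simp add: smooth_on_def)
  moreover have "f ` S \<subseteq> - {0}" using assms(3) by auto
  ultimately show ?thesis using smooth_on_compose[OF assms(1) op _ assms(2)] by blast
qed

lemma smooth_on_divide:
  fixes f :: "'x::real_normed_vector \<Rightarrow> real"
  shows "open S \<Longrightarrow> smooth_on S f \<Longrightarrow> smooth_on S g \<Longrightarrow> (\<And>x. x \<in> S \<Longrightarrow> g x \<noteq> 0) \<Longrightarrow> smooth_on S (\<lambda>x. f x / g x)"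
  unfolding divide_inverse by (intro smooth_on_mult smooth_on_inverse) auto

lemma smooth_on_sqrt:
  fixes f :: "'x::real_normed_vector \<Rightarrow> real"
  assumes "open S" "smooth_on S f" "\<And>x. x \<in> S \<Longrightarrow> f x > 0"
  shows "smooth_on S (\<lambda>x. sqrt (f x))"
proof -
  have "Ck_on n {0<..} sqrt" for n
  proof (induction n)
    case 0
    then show ?case by (auto intro!: continuous_intros)
  next
    case (Suc n)
    have "Ck_on n {0<..} (\<lambda>t. inverse (sqrt t))"
      by (rule Ck_on_compose[of "{0<..}" "- {0::real}"])
        (use Suc smooth_on_Ck[OF smooth_on_inverse[of "- {0}" "\<lambda>t. t"]] in auto)
    then have "Ck_on n {0<..} (\<lambda>t. inverse (sqrt t) / 2)"
      unfolding divide_inverse by (intro Ck_on_bilinear[OF bounded_bilinear_mult]) auto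
    then show ?case
      by (rule Ck_on_Suc_realI[OF open_greaterThan, rotated]) (simp add: DERIV_real_sqrt)
  qed
  then have "smooth_on ({0<..}) (sqrt :: real \<Rightarrow> real)" by (simp add: smooth_on_def)
  moreover have "f ` S \<subseteq> {0<..}" using assms(3) by auto
  ultimately show ?thesis using smooth_on_compose[OF assms(1) open_greaterThan _ assms(2)] by blast
qed

lemma smooth_on_ln:
  fixes f :: "'x::real_normed_vector \<Rightarrow> real"
  assumes "open S" "smooth_on S f" "\<And>x. x \<in> S \<Longrightarrow> f x > 0"
  shows "smooth_on S (\<lambda>x. ln (f x))"
proof -
  have "Ck_on n {0<..} (ln :: real \<Rightarrow> real)" for n
  proof (cases n)
    case 0
    then show ?thesis by (auto intro!: continuous_intros)
  next
    case (Suc m)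
    have "Ck_on m {0<..} (\<lambda>t::real. inverse t)"
      by (intro smooth_on_Ck smooth_on_inverse) auto
    then show ?thesis unfolding Suc
      by (rule Ck_on_Suc_realI[OF open_greaterThan, rotated]) (simp add: DERIV_ln)
  qed
  then have "smooth_on ({0<..}) (ln :: real \<Rightarrow> real)" by (simp add: smooth_on_def)
  moreover have "f ` S \<subseteq> {0<..}" using assms(3) by auto
  ultimately show ?thesis using smooth_on_compose[OF assms(1) open_greaterThan _ assms(2)] by blast
qed

lemma has_real_derivative_along_line:
  assumes "(G has_derivative G') (at (y + s *\<^sub>R z))"
  shows "((\<lambda>s. G (y + s *\<^sub>R z)) has_real_derivative G' z) (at s)"
proof -
  have "((\<lambda>s. y + s *\<^sub>R z) has_derivative (\<lambda>s. s *\<^sub>R z)) (at s)"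
    by (auto intro!: derivative_eq_intros)
  then have "((\<lambda>s. G (y + s *\<^sub>R z)) has_derivative (\<lambda>s. G' (s *\<^sub>R z))) (at s)"
    by (rule has_derivative_compose) (use assms in simp)
  moreover have "G' (s *\<^sub>R z) = G' z * s" for s
    using linear_cmul[OF has_derivative_linear[OF assms]] by simp
  ultimately show ?thesis by (simp add: has_field_derivative_def)
qed

text \<open>
  Schwarz's theorem: the second difference of \<open>f\<close> over the parallelogram spanned by \<open>h v\<close> and
  \<open>h w\<close> is, by the mean value theorem applied twice, \<open>h\<^sup>2\<close> times either mixed derivative at
  some point near \<open>x\<close>.
\<close>

lemma parallelogram_in_ball:
  fixes x :: "'x::real_normed_vector"
  assumes "h * (norm v + norm w) < r" "0 \<le> a" "a \<le> h" "0 \<le> b" "b \<le> h"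
  shows "x + a *\<^sub>R v + b *\<^sub>R w \<in> ball x r"
proof -
  have "norm (a *\<^sub>R v + b *\<^sub>R w) \<le> a * norm v + b * norm w"
    using norm_triangle_ineq[of "a *\<^sub>R v" "b *\<^sub>R w"] assms by simp
  also have "\<dots> \<le> h * norm v + h * norm w"
    using assms by (intro add_mono mult_right_mono) auto
  finally have "norm (a *\<^sub>R v + b *\<^sub>R w) < r" using assms(1) by (simp add: algebra_simps)
  moreover have "dist x (x + a *\<^sub>R v + b *\<^sub>R w) = norm (a *\<^sub>R v + b *\<^sub>R w)"
    by (metis add.assoc add_diff_cancel_left' dist_commute dist_norm)
  ultimately show ?thesis by simp
qed

lemma second_difference_mean_value:
  fixes f :: "'x::real_normed_vector \<Rightarrow> real"
  assumes f: "\<And>y. y \<in> ball x r \<Longrightarrow> (f has_derivative F y) (at y)"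
    and F: "\<And>y. y \<in> ball x r \<Longrightarrow> ((\<lambda>y. F y v) has_derivative F2 y) (at y)"
    and h: "0 < h" "h * (norm v + norm w) < r"
  shows "\<exists>a b. 0 < a \<and> a < h \<and> 0 < b \<and> b < h \<and>
    f (x + h *\<^sub>R v + h *\<^sub>R w) - f (x + h *\<^sub>R v) - f (x + h *\<^sub>R w) + f x =
      h * (h * F2 (x + a *\<^sub>R v + b *\<^sub>R w) w)"
proof -
  note in_ball = parallelogram_in_ball[OF h(2)]
  define p where "p = (\<lambda>s. f ((x + h *\<^sub>R w) + s *\<^sub>R v) - f (x + s *\<^sub>R v))"
  have dp: "(p has_real_derivative (F ((x + h *\<^sub>R w) + s *\<^sub>R v) v - F (x + s *\<^sub>R v) v)) (at s)"
    if "0 \<le> s" "s \<le> h" for s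
    unfolding p_def
    using in_ball[of s h] in_ball[of s 0] that h
    by (intro DERIV_diff has_real_derivative_along_line f) (auto simp: algebra_simps)
  obtain a where a: "0 < a" "a < h" "p h - p 0 = h * (F ((x + h *\<^sub>R w) + a *\<^sub>R v) v - F (x + a *\<^sub>R v) v)"
    using MVT2[OF h(1) dp] by auto
  define q where "q = (\<lambda>t. F ((x + a *\<^sub>R v) + t *\<^sub>R w) v)"
  have dq: "(q has_real_derivative F2 ((x + a *\<^sub>R v) + t *\<^sub>R w) w) (at t)" if "0 \<le> t" "t \<le> h" for t
    unfolding q_def using in_ball[of a t] that a
    by (intro has_real_derivative_along_line[where G = "\<lambda>y. F y v"] F) auto
  obtain b where b: "0 < b" "b < h" "q h - q 0 = h * F2 ((x + a *\<^sub>R v) + b *\<^sub>R w) w"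
    using MVT2[OF h(1) dq] by auto
  have "f (x + h *\<^sub>R v + h *\<^sub>R w) - f (x + h *\<^sub>R v) - f (x + h *\<^sub>R w) + f x = p h - p 0"
    unfolding p_def by (simp add: algebra_simps)
  also have "\<dots> = h * (q h - q 0)" using a by (simp add: q_def algebra_simps)
  finally show ?thesis using a b by auto
qed

lemma Schwarz_symmetry_real:
  fixes f :: "'x::euclidean_space \<Rightarrow> real"
  assumes "open S" "x \<in> S" "smooth_on S f"
  shows "frechet_derivative (\<lambda>y. frechet_derivative f (at y) v) (at x) w =
    frechet_derivative (\<lambda>y. frechet_derivative f (at y) w) (at x) v"
proof (rule ccontr)
  let ?F = "\<lambda>y. frechet_derivative f (at y)"
  define P where "P = (\<lambda>y. frechet_derivative (\<lambda>y. ?F y v) (at y) w)"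
  define Q where "Q = (\<lambda>y. frechet_derivative (\<lambda>y. ?F y w) (at y) v)"
  assume "\<not> ?thesis"
  then have ne: "P x \<noteq> Q x" by (simp add: P_def Q_def)
  have sF: "smooth_on S (\<lambda>y. ?F y z)" for z
    by (rule smooth_on_frechet_derivative) (use assms in auto)
  have "continuous_on S P" "continuous_on S Q"
    unfolding P_def Q_def
    by (auto intro!: smooth_on_continuous smooth_on_frechet_derivative assms sF)
  then have cont: "isCont P x" "isCont Q x"
    using assms continuous_on_eq_continuous_at by blast+
  define \<epsilon> where "\<epsilon> = dist (P x) (Q x) / 2"
  have e: "\<epsilon> > 0" using ne by (simp add: \<epsilon>_def)
  obtain d1 where d1: "d1 > 0" "\<And>y. dist y x < d1 \<Longrightarrow> dist (P y) (P x) < \<epsilon>"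
    using cont(1) e unfolding continuous_at_eps_delta by blast
  obtain d2 where d2: "d2 > 0" "\<And>y. dist y x < d2 \<Longrightarrow> dist (Q y) (Q x) < \<epsilon>"
    using cont(2) e unfolding continuous_at_eps_delta by blast
  obtain d3 where d3: "d3 > 0" "ball x d3 \<subseteq> S"
    using assms open_contains_ball by blast
  define r where "r = min d1 (min d2 d3)"
  have r: "r > 0" using d1 d2 d3 by (simp add: r_def)
  \<comment> \<open>Small enough that the parallelogram at \<open>x\<close> spanned by \<open>h v\<close> and \<open>h w\<close> lies in the ball of radius \<open>r\<close>.\<close>
  define h where "h = r / (norm v + norm w + 1) / 2"
  have pos: "norm v + norm w + 1 > 0" by (simp add: add_nonneg_pos)
  have h: "h > 0" using r pos by (simp add: h_def)
  have "h * (norm v + norm w) < h * (2 * (norm v + norm w + 1))"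
    using h by (intro mult_strict_left_mono) (auto simp: add_nonneg_pos)
  also have "\<dots> = r" unfolding h_def using pos by (simp add: field_simps)
  finally have hr: "h * (norm v + norm w) < r" .
  have f: "(f has_derivative ?F y) (at y)" if "y \<in> ball x r" for y
    using that d3 assms(3) by (intro smooth_on_has_derivative[of S]) (auto simp: r_def)
  have F: "((\<lambda>y. ?F y z) has_derivative frechet_derivative (\<lambda>y. ?F y z) (at y)) (at y)"
    if "y \<in> ball x r" for y z
    using that d3 sF by (intro smooth_on_has_derivative[of S]) (auto simp: r_def)
  have in_ball: "dist (x + a *\<^sub>R v + b *\<^sub>R w) x < r" if "0 < a" "a < h" "0 < b" "b < h" for a b
    using parallelogram_in_ball[OF hr, of a b x] that by (simp add: dist_commute)
  obtain a b where ab: "0 < a" "a < h" "0 < b" "b < h"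
    "f (x + h *\<^sub>R v + h *\<^sub>R w) - f (x + h *\<^sub>R v) - f (x + h *\<^sub>R w) + f x = h * (h * P (x + a *\<^sub>R v + b *\<^sub>R w))"
    using second_difference_mean_value[OF f F h hr] unfolding P_def by blast
  obtain c d where cd: "0 < c" "c < h" "0 < d" "d < h"
    "f (x + h *\<^sub>R w + h *\<^sub>R v) - f (x + h *\<^sub>R w) - f (x + h *\<^sub>R v) + f x = h * (h * Q (x + c *\<^sub>R w + d *\<^sub>R v))"
    using second_difference_mean_value[where v = w and w = v, OF f F h hr[unfolded add.commute[of "norm v"]]]
    unfolding Q_def by blast
  have "h * (h * P (x + a *\<^sub>R v + b *\<^sub>R w)) = h * (h * Q (x + d *\<^sub>R v + c *\<^sub>R w))"
  proof -
    have eqs: "x + h *\<^sub>R w + h *\<^sub>R v = x + h *\<^sub>R v + h *\<^sub>R w"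
      "x + c *\<^sub>R w + d *\<^sub>R v = x + d *\<^sub>R v + c *\<^sub>R w"
      by (auto simp: algebra_simps)
    show ?thesis using ab(5) cd(5)[unfolded eqs] by linarith
  qed
  then have "P (x + a *\<^sub>R v + b *\<^sub>R w) = Q (x + d *\<^sub>R v + c *\<^sub>R w)" using h by simp
  moreover have "dist (P (x + a *\<^sub>R v + b *\<^sub>R w)) (P x) < \<epsilon>"
    using d1(2) in_ball[OF ab(1-4)] by (simp add: r_def)
  moreover have "dist (Q (x + d *\<^sub>R v + c *\<^sub>R w)) (Q x) < \<epsilon>"
    using d2(2) in_ball[OF cd(3,4,1,2)] by (simp add: r_def)
  ultimately have "dist (P x) (Q x) < \<epsilon> + \<epsilon>"
    by (metis add_strict_mono dist_commute dist_triangle le_less_trans)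
  then show False by (simp add: \<epsilon>_def)
qed

lemma Schwarz_symmetry:
  fixes f :: "'x::euclidean_space \<Rightarrow> 'y::euclidean_space"
  assumes "open S" "x \<in> S" "smooth_on S f"
  shows "frechet_derivative (\<lambda>y. frechet_derivative f (at y) v) (at x) w =
    frechet_derivative (\<lambda>y. frechet_derivative f (at y) w) (at x) v"
proof (rule euclidean_eqI)
  fix b :: 'y
  have comp: "frechet_derivative (\<lambda>y. h y \<bullet> b) (at y) z = frechet_derivative h (at y) z \<bullet> b"
    if "smooth_on S h" "y \<in> S" for h :: "'x \<Rightarrow> 'y" and y z
    by (rule fun_cong[OF frechet_derivative_eq])
      (intro has_derivative_inner_left smooth_on_has_derivative[OF that])
  have sb: "smooth_on S (\<lambda>y. f y \<bullet> b)" using assms by (intro smooth_on_inner) auto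
  have sF: "smooth_on S (\<lambda>y. frechet_derivative f (at y) z)" for z
    by (rule smooth_on_frechet_derivative) (use assms in auto)
  have "frechet_derivative (\<lambda>y. frechet_derivative f (at y) v) (at x) w \<bullet> b =
      frechet_derivative (\<lambda>y. frechet_derivative (\<lambda>y. f y \<bullet> b) (at y) v) (at x) w" for v w
  proof -
    have "frechet_derivative (\<lambda>y. frechet_derivative f (at y) v) (at x) w \<bullet> b =
       frechet_derivative (\<lambda>y. frechet_derivative f (at y) v \<bullet> b) (at x) w"
      using comp[OF sF assms(2)] by simp
    also have "\<dots> = frechet_derivative (\<lambda>y. frechet_derivative (\<lambda>y. f y \<bullet> b) (at y) v) (at x) w"
      by (rule fun_cong[OF frechet_derivative_cong_open[OF assms(1,2)]]) (use comp[OF assms(3)] in simp)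
    finally show ?thesis .
  qed
  then show "frechet_derivative (\<lambda>y. frechet_derivative f (at y) v) (at x) w \<bullet> b =
      frechet_derivative (\<lambda>y. frechet_derivative f (at y) w) (at x) v \<bullet> b"
    using Schwarz_symmetry_real[OF assms(1,2) sb] by metis
qed


section \<open>Bump functions\<close>

definition flat :: "nat \<Rightarrow> real \<Rightarrow> real" where
  "flat m t = (if t > 0 then exp (- inverse t) * inverse t ^ m else 0)"

lemma flat_tendsto_0: "(flat m \<longlongrightarrow> 0) (at 0)"
proof -
  have "((\<lambda>t. inverse t ^ m / exp (inverse t)) \<longlongrightarrow> (0::real)) (at_right 0)"
    by (rule filterlim_compose[OF tendsto_power_div_exp_0 filterlim_inverse_at_top_right])
  moreover have "eventually (\<lambda>t. inverse t ^ m / exp (inverse t) = flat m t) (at_right 0)"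
    unfolding eventually_at_right_field
    by (intro exI[of _ 1]) (auto simp: flat_def exp_minus divide_inverse mult.commute)
  ultimately have "(flat m \<longlongrightarrow> 0) (at_right 0)"
    by (rule Lim_transform_eventually)
  moreover have "(flat m \<longlongrightarrow> 0) (at_left 0)"
    by (rule tendsto_eventually)
      (auto simp: eventually_at_left_field flat_def intro!: exI[of _ "-1"])
  ultimately show ?thesis by (simp add: filterlim_split_at)
qed

text \<open>
  The functions \<open>flat m\<close> are closed under differentiation up to linear combinations, also at \<open>0\<close>,
  where the difference quotient of \<open>flat m\<close> is \<open>flat (m + 1)\<close>; this gives smoothness of all of them.
\<close>

lemma flat_has_derivative:
  "(flat m has_real_derivative (flat (m + 2) t + (- real m) * flat (m + 1) t)) (at t)"
proof -
  consider "t > 0" | "t < 0" | "t = 0" by linarith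
  then show ?thesis
  proof cases
    case 1
    have "((\<lambda>t. exp (- inverse t) * inverse t ^ m) has_real_derivative
        (flat (m + 2) t + (- real m) * flat (m + 1) t)) (at t)"
    proof (rule DERIV_cong)
      show "((\<lambda>t. exp (- inverse t) * inverse t ^ m) has_real_derivative
          exp (- inverse t) * (real m * inverse t ^ (m - Suc 0) * - (inverse t)\<^sup>2) +
          exp (- inverse t) * (inverse t)\<^sup>2 * inverse t ^ m) (at t)"
        using 1 by (auto intro!: derivative_eq_intros simp: power2_eq_square)
      have "real m * inverse t ^ (m - Suc 0) * (inverse t)\<^sup>2 = real m * (inverse t ^ m * inverse t)"
        by (cases m) (auto simp: power2_eq_square)
      then show "exp (- inverse t) * (real m * inverse t ^ (m - Suc 0) * - (inverse t)\<^sup>2) +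
          exp (- inverse t) * (inverse t)\<^sup>2 * inverse t ^ m =
          flat (m + 2) t + (- real m) * flat (m + 1) t"
        using 1 by (simp add: flat_def power_add power2_eq_square mult_ac)
    qed
    then show ?thesis
      by (rule has_field_derivative_transform_within_open[of _ _ _ "{0<..}"]) (use 1 in \<open>auto simp: flat_def\<close>)
  next
    case 2
    have "((\<lambda>t. 0) has_real_derivative (flat (m + 2) t + (- real m) * flat (m + 1) t)) (at t)"
      using 2 by (auto simp: flat_def)
    then show ?thesis
      by (rule has_field_derivative_transform_within_open[of _ _ _ "{..<0}"]) (use 2 in \<open>auto simp: flat_def\<close>)
  next
    case 3
    have "(\<lambda>h. (flat m (0 + h) - flat m 0) / h) = flat (m + 1)"
      by (auto simp: flat_def fun_eq_iff divide_inverse)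
    then show ?thesis
      using flat_tendsto_0[of "m + 1"] 3 by (simp add: DERIV_def flat_def)
  qed
qed

lemma smooth_on_flat: "smooth_on UNIV (flat m)"
proof -
  have "Ck_on n UNIV (flat m)" for n
  proof (induction n arbitrary: m)
    case 0
    show ?case
      by (auto intro!: continuous_at_imp_continuous_on DERIV_isCont flat_has_derivative)
  next
    case (Suc n)
    have "Ck_on n UNIV (\<lambda>t. flat (m + 2) t + (- real m) * flat (m + 1) t)"
      by (intro Ck_on_add Ck_on_bilinear[OF bounded_bilinear_mult] Suc Ck_on_const open_UNIV)
    then show ?case
      by (rule Ck_on_Suc_realI[OF open_UNIV flat_has_derivative])
  qed
  then show ?thesis by (simp add: smooth_on_def)
qed

lemma smooth_bump_exists:
  fixes y0 :: "'x::euclidean_space"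
  assumes "r > 0"
  shows "\<exists>b. smooth_on UNIV b \<and> (\<forall>y. b y \<ge> (0::real)) \<and> (\<forall>y. b y > 0 \<longleftrightarrow> y \<in> ball y0 r)"
proof (intro exI conjI allI)
  let ?b = "\<lambda>y. flat 0 (r\<^sup>2 - (y - y0) \<bullet> (y - y0))"
  show "smooth_on UNIV ?b"
    by (rule smooth_on_compose[OF _ _ smooth_on_flat])
      (auto intro!: smooth_on_diff smooth_on_inner)
  show "?b y \<ge> 0" for y by (simp add: flat_def)
  have "(y - y0) \<bullet> (y - y0) < r\<^sup>2 \<longleftrightarrow> norm (y - y0) < r" for y
    using assms by (auto simp: dot_square_norm power_mono_iff intro: power_strict_mono power_less_imp_less_base)
  then show "?b y > 0 \<longleftrightarrow> y \<in> ball y0 r" for y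
    by (simp add: flat_def dist_norm norm_minus_commute)
qed


section \<open>Integrals of derivatives\<close>

lemma continuous_compact_support_integrable:
  fixes F :: "'x::euclidean_space \<Rightarrow> real"
  assumes "continuous_on UNIV F" "compact K" "\<And>y. y \<notin> K \<Longrightarrow> F y = 0"
  shows "integrable lborel F"
proof -
  have "integrable lborel (\<lambda>x. indicator K x *\<^sub>R F x)"
    by (rule borel_integrable_compact) (use assms in \<open>auto intro: continuous_on_subset\<close>)
  moreover have "(\<lambda>x. indicator K x *\<^sub>R F x) = F"
    using assms(3) by (auto simp: fun_eq_iff indicator_def)
  ultimately show ?thesis by simp
qed

text \<open>
  The integral of \<open>F (y + t v)\<close> over the whole space does not depend on \<open>t\<close>; its
  difference quotients converge dominatedly to the integral of the derivative.
\<close>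

lemma integral_directional_derivative:
  fixes F :: "'x::euclidean_space \<Rightarrow> real"
  assumes F: "smooth_on UNIV F" and K: "compact K" "\<And>y. y \<notin> K \<Longrightarrow> F y = 0"
  shows "has_bochner_integral lborel (\<lambda>y. frechet_derivative F (at y) v) 0"
proof -
  let ?D = "\<lambda>y. frechet_derivative F (at y) v"
  have contF: "continuous_on UNIV F" using F smooth_on_continuous by blast
  have contD: "continuous_on UNIV ?D"
    using smooth_on_frechet_derivative[OF open_UNIV F] smooth_on_continuous smooth_on_const by blast
  have D0: "?D y = 0" if "y \<notin> K" for y
    using frechet_derivative_cong_open[of "- K" y F "\<lambda>_. 0"] K that compact_imp_closed[OF K(1)]
    by (auto simp: open_Compl)
  have intF: "integrable lborel F" and intD: "integrable lborel ?D"
    using continuous_compact_support_integrable K contF contD D0 by blast+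
  obtain B where B: "\<And>y. \<bar>?D y\<bar> \<le> B" "B \<ge> 0"
  proof -
    have "compact (?D ` K)"
      using contD K by (auto intro: compact_continuous_image continuous_on_subset)
    then have "bounded (?D ` K)" by (rule compact_imp_bounded)
    then obtain B where "\<And>y. y \<in> K \<Longrightarrow> \<bar>?D y\<bar> \<le> B"
      by (auto simp: bounded_iff)
    then have "\<bar>?D y\<bar> \<le> max B 0" for y using D0[of y] by (cases "y \<in> K") (auto simp: le_max_iff_disj)
    then show thesis using that[of "max B 0"] by auto
  qed
  obtain R where R: "\<And>y. y \<in> K \<Longrightarrow> norm y \<le> R"
    using compact_imp_bounded[OF K(1)] unfolding bounded_iff by blast
  define t where "t m = inverse (real (Suc m))" for m
  have t: "t m > 0" "t m \<le> 1" for m by (auto simp: t_def field_simps)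
  define g where "g m y = (F (y + t m *\<^sub>R v) - F y) / t m" for m y
  have meas: "F \<in> borel_measurable borel" "?D \<in> borel_measurable borel"
    using borel_measurable_continuous_onI contF contD by blast+
  have shift: "has_bochner_integral lborel (\<lambda>y. F (y + c)) (integral\<^sup>L lborel F)" for c
  proof -
    have mp: "(+) c \<in> measurable lborel borel" by simp
    have "integrable lborel (\<lambda>y. F (c + y))"
      using integrable_distr_eq[OF mp meas(1)] intF by (simp add: lborel_distr_plus)
    moreover have "integral\<^sup>L lborel (\<lambda>y. F (c + y)) = integral\<^sup>L lborel F"
      using integral_distr[OF mp meas(1)] by (simp add: lborel_distr_plus)
    ultimately show ?thesis by (simp add: has_bochner_integral_iff add.commute)
  qed
  have int0: "integral\<^sup>L lborel (g m) = 0" for m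
  proof -
    have "has_bochner_integral lborel (g m) ((integral\<^sup>L lborel F - integral\<^sup>L lborel F) / t m)"
      unfolding g_def
      by (intro has_bochner_integral_divide_zero has_bochner_integral_diff shift
          has_bochner_integral_integrable intF)
    then show ?thesis by (simp add: has_bochner_integral_integral_eq)
  qed
  have der: "((\<lambda>s. F (y + s *\<^sub>R v)) has_real_derivative ?D (y + s *\<^sub>R v)) (at s)" for y s
    using has_real_derivative_along_line smooth_on_has_derivative F UNIV_I by metis
  have lim: "(\<lambda>m. g m y) \<longlonglongrightarrow> ?D y" for y
  proof -
    have "((\<lambda>h. (F (y + h *\<^sub>R v) - F y) / h) \<longlongrightarrow> ?D y) (at 0)"
      using der[of y 0] by (simp add: DERIV_def)
    moreover have "filterlim t (at 0) sequentially"
      unfolding filterlim_at t_def using LIMSEQ_inverse_real_of_nat by (auto simp: field_simps)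
    ultimately show ?thesis unfolding g_def by (rule filterlim_compose)
  qed
  have bound: "norm (g m y) \<le> B * indicator (cball 0 (R + norm v)) y" for m y
  proof (cases "y \<in> cball 0 (R + norm v)")
    case True
    obtain s where "F (y + t m *\<^sub>R v) - F (y + 0 *\<^sub>R v) = (t m - 0) * ?D (y + s *\<^sub>R v)"
      using MVT2[OF t(1) der] by blast
    then have "g m y = ?D (y + s *\<^sub>R v)" using t(1)[of m] by (simp add: g_def)
    then show ?thesis using B True by simp
  next
    case False
    have *: "norm y > R + norm v" using False by auto
    then have "norm y > R" using norm_ge_zero[of v] by linarith
    then have "y \<notin> K" using R by force
    moreover have "norm (y + t m *\<^sub>R v) \<ge> norm y - norm (t m *\<^sub>R v)" by (rule norm_diff_ineq)
    moreover have "norm (t m *\<^sub>R v) \<le> norm v"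
      using t[of m] by (simp add: mult_left_le_one_le)
    ultimately have "norm (y + t m *\<^sub>R v) > R" using * by linarith
    then have "y + t m *\<^sub>R v \<notin> K" using R by force
    then show ?thesis using \<open>y \<notin> K\<close> K B(2) by (simp add: g_def)
  qed
  have "(\<lambda>m. integral\<^sup>L lborel (g m)) \<longlonglongrightarrow> integral\<^sup>L lborel ?D"
  proof (rule integral_dominated_convergence[where w = "\<lambda>y. B * indicator (cball 0 (R + norm v)) y"])
    show "integrable lborel (\<lambda>y. B * indicator (cball 0 (R + norm v)) y)"
      by (intro integrable_mult_right integrable_real_indicator)
        (use emeasure_bounded_finite[OF bounded_cball] in auto)
    show "g m \<in> borel_measurable lborel" for m
      unfolding g_def by (intro borel_measurable_divide borel_measurable_diff)
        (use meas in auto)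
  qed (use meas lim bound in auto)
  then have "integral\<^sup>L lborel ?D = 0" using int0 by (simp add: LIMSEQ_const_iff)
  then show ?thesis using intD by (metis has_bochner_integral_integrable)
qed

lemma integral_divergence:
  fixes Z :: "real ^ 'n \<Rightarrow> real ^ 'n"
  assumes Z: "smooth_on UNIV Z" and K: "compact K" "\<And>y. y \<notin> K \<Longrightarrow> Z y = 0"
  shows "has_bochner_integral lborel (\<lambda>y. \<Sum>i\<in>UNIV. frechet_derivative Z (at y) (axis i 1) $ i) 0"
proof -
  have "has_bochner_integral lborel (\<lambda>y. frechet_derivative (\<lambda>y. Z y $ i) (at y) (axis i 1)) 0" for i
    using Z K by (intro integral_directional_derivative[of _ K] smooth_on_vec_nth) auto
  moreover have "frechet_derivative (\<lambda>y. Z y $ i) (at y) w = frechet_derivative Z (at y) w $ i" for i y w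
    by (rule fun_cong[OF frechet_derivative_eq])
      (intro bounded_linear.has_derivative[OF bounded_linear_vec_nth] smooth_on_has_derivative[OF Z] UNIV_I)
  ultimately have "has_bochner_integral lborel (\<lambda>y. \<Sum>i\<in>UNIV. frechet_derivative Z (at y) (axis i 1) $ i)
      (\<Sum>i\<in>(UNIV::'n set). 0)"
    by (intro has_bochner_integral_sum) simp
  then show ?thesis by simp
qed


section \<open>Determinants and orthonormal bases\<close>

text \<open>
  Jacobi's formula at the identity: a permutation other than the identity moves at least two
  indices, so its term vanishes to second order.
\<close>

lemma has_derivative_det_at_one:
  fixes M :: "'x::real_normed_vector \<Rightarrow> real ^ 'n ^ 'n"
  assumes M: "\<And>i j. ((\<lambda>y. M y $ i $ j) has_derivative M' i j) (at y0)" and one: "M y0 = mat 1"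
  shows "((\<lambda>y. det (M y)) has_derivative (\<lambda>v. \<Sum>i\<in>UNIV. M' i i v)) (at y0)"
proof -
  let ?P = "{p. p permutes (UNIV :: 'n set)}"
  let ?d = "\<lambda>p v. \<Sum>i\<in>UNIV. M' i (p i) v * (\<Prod>j\<in>UNIV - {i}. M y0 $ j $ p j)"
  have "((\<lambda>y. \<Sum>p\<in>?P. of_int (sign p) * (\<Prod>i\<in>UNIV. M y $ i $ p i)) has_derivative
      (\<lambda>v. \<Sum>p\<in>?P. of_int (sign p) * ?d p v)) (at y0)"
    by (intro has_derivative_sum has_derivative_mult_right has_derivative_prod M)
  moreover have "(\<Sum>p\<in>?P. of_int (sign p) * ?d p v) = (\<Sum>i\<in>UNIV. M' i i v)" for v
  proof -
    have "?d p v = 0" if p: "p \<noteq> id" "p \<in> ?P" for p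
    proof -
      obtain j where j: "p j \<noteq> j" using p(1) by (metis eq_id_iff)
      have pj: "p (p j) \<noteq> p j" using j p(2) by (metis mem_Collect_eq permutes_inv_eq)
      have "(\<Prod>j\<in>UNIV - {i}. M y0 $ j $ p j) = 0" for i
      proof (rule prod_zero)
        show "\<exists>j\<in>UNIV - {i}. M y0 $ j $ p j = 0"
        proof (cases "i = j")
          case True
          then show ?thesis using j pj one by (intro bexI[of _ "p j"]) (auto simp: mat_def)
        next
          case False
          then show ?thesis using j one by (intro bexI[of _ j]) (auto simp: mat_def)
        qed
      qed simp
      then show ?thesis by (simp only: mult_zero_right sum.neutral_const)
    qed
    then have "(\<Sum>p\<in>?P. of_int (sign p) * ?d p v) = (\<Sum>p\<in>{id}. of_int (sign p) * ?d p v)"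
      by (intro sum.mono_neutral_right) (auto simp: permutes_id)
    also have "\<dots> = (\<Sum>i\<in>UNIV. M' i i v)"
      by (simp add: sign_id one mat_def)
    finally show ?thesis .
  qed
  ultimately show ?thesis unfolding det_def by simp
qed

lemma sandwich_component:
  fixes G P Q :: "real ^ 'n ^ 'n"
  shows "(transpose P ** G ** Q) $ a $ b = (\<Sum>i\<in>UNIV. \<Sum>j\<in>UNIV. G $ i $ j * P $ i $ a * Q $ j $ b)"
  by (simp add: matrix_matrix_mult_def transpose_def sum_distrib_right, subst sum.swap)
    (simp add: mult_ac)

text \<open>
  The basis \<open>e\<close> is orthonormal for the matrix \<open>G y0\<close>; in the coordinates of this basis, \<open>G\<close> is
  the identity at \<open>y0\<close>, and Jacobi's formula at the identity applies.
\<close>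

lemma has_derivative_det_orthonormal:
  fixes G :: "'x::real_normed_vector \<Rightarrow> real ^ 'n ^ 'n" and e :: "'n \<Rightarrow> real ^ 'n"
  assumes G: "\<And>i j. ((\<lambda>y. G y $ i $ j) has_derivative G' i j) (at y0)"
    and e: "\<And>a b. (\<Sum>i\<in>UNIV. \<Sum>j\<in>UNIV. G y0 $ i $ j * e a $ i * e b $ j) = (if a = b then 1 else 0)"
  shows "((\<lambda>y. det (G y)) has_derivative
      (\<lambda>v. det (G y0) * (\<Sum>a\<in>UNIV. \<Sum>i\<in>UNIV. \<Sum>j\<in>UNIV. G' i j v * e a $ i * e a $ j))) (at y0)"
    and "det (G y0) > 0"
proof -
  define P :: "real ^ 'n ^ 'n" where "P = (\<chi> i a. e a $ i)"
  define M where "M y = transpose P ** G y ** P" for y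
  have comp: "M y $ a $ b = (\<Sum>i\<in>UNIV. \<Sum>j\<in>UNIV. G y $ i $ j * e a $ i * e b $ j)" for y a b
    unfolding M_def sandwich_component by (simp add: P_def)
  have one: "M y0 = mat 1" by (simp add: vec_eq_iff comp e mat_def)
  have detM: "det (M y) = (det P)\<^sup>2 * det (G y)" for y
    by (simp add: M_def det_mul power2_eq_square)
  have 1: "(det P)\<^sup>2 * det (G y0) = 1" using detM[of y0] one by simp
  then have P: "(det P)\<^sup>2 > 0" by (metis mult_zero_left zero_less_power2 zero_neq_one power_zero_numeral)
  show "det (G y0) > 0" using 1 P by (metis zero_less_mult_pos zero_less_one)
  have "((\<lambda>y. det (M y)) has_derivative (\<lambda>v. \<Sum>a\<in>UNIV. \<Sum>i\<in>UNIV. \<Sum>j\<in>UNIV. G' i j v * e a $ i * e a $ j)) (at y0)"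
  proof (rule has_derivative_det_at_one[of M "\<lambda>a b v. \<Sum>i\<in>UNIV. \<Sum>j\<in>UNIV. G' i j v * e a $ i * e b $ j"])
    show "((\<lambda>y. M y $ a $ b) has_derivative
        (\<lambda>v. \<Sum>i\<in>UNIV. \<Sum>j\<in>UNIV. G' i j v * e a $ i * e b $ j)) (at y0)" for a b
      unfolding comp by (intro has_derivative_sum has_derivative_mult_left G)
  qed (rule one)
  then have "((\<lambda>y. det (G y0) * det (M y)) has_derivative
      (\<lambda>v. det (G y0) * (\<Sum>a\<in>UNIV. \<Sum>i\<in>UNIV. \<Sum>j\<in>UNIV. G' i j v * e a $ i * e a $ j))) (at y0)"
    by (rule has_derivative_mult_right)
  moreover have "(\<lambda>y. det (G y0) * det (M y)) = (\<lambda>y. det (G y))"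
  proof
    fix y
    have "det (G y0) * det (M y) = (det P)\<^sup>2 * det (G y0) * det (G y)"
      by (simp only: detM mult_ac)
    then show "det (G y0) * det (M y) = det (G y)" using 1 by simp
  qed
  ultimately show "((\<lambda>y. det (G y)) has_derivative
      (\<lambda>v. det (G y0) * (\<Sum>a\<in>UNIV. \<Sum>i\<in>UNIV. \<Sum>j\<in>UNIV. G' i j v * e a $ i * e a $ j))) (at y0)"
    by simp
qed

lemma trace_orthonormal:
  fixes G :: "real ^ 'n ^ 'n" and e :: "'n \<Rightarrow> real ^ 'n"
  assumes e: "\<And>a b. (\<Sum>i\<in>UNIV. \<Sum>j\<in>UNIV. G $ i $ j * e a $ i * e b $ j) = (if a = b then 1 else 0)"
    and L: "linear L"
  shows "(\<Sum>a\<in>UNIV. \<Sum>i\<in>UNIV. \<Sum>j\<in>UNIV. G $ i $ j * e a $ i * L (e a) $ j) =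
    (\<Sum>i\<in>UNIV. L (axis i 1) $ i)"
proof -
  define P :: "real ^ 'n ^ 'n" where "P = (\<chi> i a. e a $ i)"
  have "transpose P ** G ** P = mat 1"
    by (simp add: vec_eq_iff sandwich_component mat_def P_def e)
  then have inv: "P ** (transpose P ** G) = mat 1"
    using matrix_left_right_inverse by blast
  have "(matrix L ** P) $ j $ a = L (e a) $ j" for j a
  proof -
    have "L (e a) = matrix L *v e a" using L by (simp add: matrix_works)
    then show ?thesis by (simp add: matrix_matrix_mult_def matrix_vector_mult_def P_def)
  qed
  then have "(\<Sum>a\<in>UNIV. \<Sum>i\<in>UNIV. \<Sum>j\<in>UNIV. G $ i $ j * e a $ i * L (e a) $ j) =
      trace (transpose P ** G ** (matrix L ** P))"
    by (simp add: trace_def sandwich_component P_def)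
  also have "\<dots> = trace ((matrix L ** P) ** (transpose P ** G))"
    by (rule trace_mul_sym)
  also have "\<dots> = trace (matrix L)"
    by (metis inv matrix_mul_assoc matrix_mul_rid)
  finally show ?thesis by (simp add: trace_def matrix_def)
qed


section \<open>Functions and vector fields on a manifold\<close>

locale smooth_manifold =
  fixes A :: "('a::{t2_space,second_countable_topology}, 'n::finite) atlas"
  assumes atlas: "smooth_atlas A"
begin

abbreviation crange :: "('a, 'n) chart \<Rightarrow> (real ^ 'n) set" where
  "crange c \<equiv> cmap c ` cdom c"

text \<open>The components of the vector field \<open>X\<close> in the chart \<open>c\<close>.\<close>

definition rep :: "('a, 'n) chart \<Rightarrow> ('a \<Rightarrow> real ^ 'n) \<Rightarrow> real ^ 'n \<Rightarrow> real ^ 'n" where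
  "rep c X y = tdiff A (cmap c) (cinv c y) (X (cinv c y))"

lemma chart_homeomorphism: "c \<in> A \<Longrightarrow> homeomorphism (cdom c) (crange c) (cmap c) (cinv c)"
  and open_cdom [simp]: "c \<in> A \<Longrightarrow> open (cdom c)"
  and open_crange [simp]: "c \<in> A \<Longrightarrow> open (crange c)"
  using atlas by (auto simp: smooth_atlas_def is_chart_def)

lemma cinv_cmap [simp]: "c \<in> A \<Longrightarrow> p \<in> cdom c \<Longrightarrow> cinv c (cmap c p) = p"
  and cinv_in_cdom: "c \<in> A \<Longrightarrow> y \<in> crange c \<Longrightarrow> cinv c y \<in> cdom c"
  and cmap_cinv: "c \<in> A \<Longrightarrow> y \<in> crange c \<Longrightarrow> cmap c (cinv c y) = y"
  and continuous_on_cmap: "c \<in> A \<Longrightarrow> continuous_on (cdom c) (cmap c)"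
  and continuous_on_cinv: "c \<in> A \<Longrightarrow> continuous_on (crange c) (cinv c)"
  using chart_homeomorphism[of c] by (auto simp: homeomorphism_def)

lemma open_cmap_image:
  assumes "c \<in> A" "open W"
  shows "open (cmap c ` (cdom c \<inter> W))"
proof -
  have "cmap c ` (cdom c \<inter> W) = crange c \<inter> cinv c -` W"
  proof (intro equalityI subsetI)
    fix y assume "y \<in> crange c \<inter> cinv c -` W"
    then show "y \<in> cmap c ` (cdom c \<inter> W)"
      using assms(1) cinv_in_cdom cmap_cinv by (auto intro!: image_eqI[of y _ "cinv c y"])
  qed (use assms(1) in auto)
  then show ?thesis
    using continuous_open_preimage[OF continuous_on_cinv open_crange assms(2)] assms(1) by simp
qed

lemma chart_at_in [simp]: "chart_at A p \<in> A" and in_chart_at [simp]: "p \<in> cdom (chart_at A p)"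
proof -
  have "\<exists>c. c \<in> A \<and> p \<in> cdom c" using atlas unfolding smooth_atlas_def by blast
  then have "chart_at A p \<in> A \<and> p \<in> cdom (chart_at A p)"
    unfolding chart_at_def by (rule someI_ex)
  then show "chart_at A p \<in> A" "p \<in> cdom (chart_at A p)" by auto
qed

lemma smooth_transition:
  "c \<in> A \<Longrightarrow> d \<in> A \<Longrightarrow> smooth_on (cmap c ` (cdom c \<inter> cdom d)) (\<lambda>y. cmap d (cinv c y))"
  using atlas unfolding smooth_atlas_def compatible_def o_def by blast

lemma smooth_fun_on_chart:
  "smooth_fun_on A W f \<Longrightarrow> c \<in> A \<Longrightarrow> smooth_on (cmap c ` (cdom c \<inter> W)) (\<lambda>y. f (cinv c y))"
  by (simp add: smooth_fun_on_def o_def)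

lemma smooth_fun_on_subset: "smooth_fun_on A W f \<Longrightarrow> V \<subseteq> W \<Longrightarrow> smooth_fun_on A V f"
  unfolding smooth_fun_on_def by (meson Int_mono image_mono order_refl smooth_on_subset)

text \<open>Compatibility of charts: smoothness near a point may be tested in one chart.\<close>

lemma smooth_fun_on_locally:
  fixes f :: "'a \<Rightarrow> 'y::real_normed_vector"
  assumes "open W" and *: "\<And>p. p \<in> W \<Longrightarrow>
    \<exists>c T. c \<in> A \<and> open T \<and> p \<in> T \<and> T \<subseteq> cdom c \<and> smooth_on (cmap c ` T) (\<lambda>y. f (cinv c y))"
  shows "smooth_fun_on A W f"
  unfolding smooth_fun_on_def o_def
proof (intro ballI smooth_on_locally)
  fix d y assume d: "d \<in> A" and "y \<in> cmap d ` (cdom d \<inter> W)"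
  then obtain p where p: "p \<in> cdom d" "p \<in> W" "y = cmap d p" by auto
  obtain c T where c: "c \<in> A" "open T" "p \<in> T" "T \<subseteq> cdom c"
    "smooth_on (cmap c ` T) (\<lambda>y. f (cinv c y))" using *[OF p(2)] by blast
  let ?U = "cmap d ` (cdom d \<inter> T)"
  have U: "open ?U" using d c open_cmap_image by simp
  have "smooth_on ?U (\<lambda>y. cmap c (cinv d y))"
    by (rule smooth_on_subset[OF smooth_transition[OF d c(1)]]) (use c(4) in blast)
  moreover have "(\<lambda>y. cmap c (cinv d y)) ` ?U \<subseteq> cmap c ` T" using d by auto
  moreover have "open (cmap c ` T)" using open_cmap_image[OF c(1,2)] c(4) by (simp add: inf_absorb2)
  ultimately have "smooth_on ?U (\<lambda>y. f (cinv c (cmap c (cinv d y))))"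
    using smooth_on_compose[OF U _ c(5)] by blast
  moreover have "f (cinv c (cmap c (cinv d y))) = f (cinv d y)" if "y \<in> ?U" for y
  proof -
    have "cinv d y \<in> T" using that d by auto
    then have "cinv d y \<in> cdom c" using c(4) by blast
    then show ?thesis using c(1) by simp
  qed
  ultimately have "smooth_on ?U (\<lambda>y. f (cinv d y))"
    by (rule iffD1[OF smooth_on_cong[OF U], rotated])
  then show "\<exists>U. open U \<and> y \<in> U \<and> smooth_on U (\<lambda>y. f (cinv d y))" using U p c by blast
qed

lemma smooth_fun_on_cover:
  assumes "open W" "\<And>p. p \<in> W \<Longrightarrow> \<exists>T. open T \<and> p \<in> T \<and> smooth_fun_on A T f"
  shows "smooth_fun_on A W f"
proof (rule smooth_fun_on_locally[OF assms(1)])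
  fix p assume "p \<in> W"
  then obtain T where T: "open T" "p \<in> T" "smooth_fun_on A T f" using assms(2) by blast
  then show "\<exists>c T. c \<in> A \<and> open T \<and> p \<in> T \<and> T \<subseteq> cdom c \<and> smooth_on (cmap c ` T) (\<lambda>y. f (cinv c y))"
    using smooth_fun_on_chart[OF T(3), of "chart_at A p"]
    by (intro exI[of _ "chart_at A p"] exI[of _ "cdom (chart_at A p) \<inter> T"]) auto
qed

lemma smooth_fun_on_cong:
  assumes "open W" "\<And>p. p \<in> W \<Longrightarrow> f p = g p" "smooth_fun_on A W f"
  shows "smooth_fun_on A W g"
  unfolding smooth_fun_on_def o_def
proof
  fix c assume c: "c \<in> A"
  show "smooth_on (cmap c ` (cdom c \<inter> W)) (\<lambda>y. g (cinv c y))"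
    by (rule iffD1[OF smooth_on_cong smooth_fun_on_chart[OF assms(3) c]])
      (use assms c open_cmap_image in auto)
qed

lemma smooth_fun_on_continuous:
  assumes "open W" "smooth_fun_on A W f"
  shows "continuous_on W f"
proof (rule continuous_at_imp_continuous_on, rule ballI)
  fix p assume p: "p \<in> W"
  let ?c = "chart_at A p"
  let ?T = "cdom ?c \<inter> W"
  have "continuous_on (cmap ?c ` ?T) (\<lambda>y. f (cinv ?c y))"
    by (rule smooth_on_continuous[OF smooth_fun_on_chart[OF assms(2) chart_at_in]])
  then have "continuous_on ?T (\<lambda>q. f (cinv ?c (cmap ?c q)))"
    by (rule continuous_on_compose2[OF _ continuous_on_subset[OF continuous_on_cmap[OF chart_at_in]]]) auto
  then have "continuous_on ?T f" by (rule continuous_on_eq) simp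
  then show "isCont f p"
    using p assms(1) by (metis IntI continuous_on_eq_continuous_at in_chart_at open_Int open_cdom chart_at_in)
qed

lemma smooth_fun_on_const [simp]: "smooth_fun_on A W (\<lambda>p. k)"
  by (simp add: smooth_fun_on_def o_def)

lemma smooth_fun_on_add:
  "open W \<Longrightarrow> smooth_fun_on A W f \<Longrightarrow> smooth_fun_on A W g \<Longrightarrow> smooth_fun_on A W (\<lambda>p. f p + g p)"
  by (simp add: smooth_fun_on_def o_def smooth_on_add open_cmap_image)

lemma smooth_fun_on_mult:
  fixes f g :: "'a \<Rightarrow> real"
  shows "open W \<Longrightarrow> smooth_fun_on A W f \<Longrightarrow> smooth_fun_on A W g \<Longrightarrow> smooth_fun_on A W (\<lambda>p. f p * g p)"
  by (simp add: smooth_fun_on_def o_def smooth_on_mult open_cmap_image)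

lemma smooth_fun_on_diff:
  fixes f g :: "'a \<Rightarrow> real"
  shows "open W \<Longrightarrow> smooth_fun_on A W f \<Longrightarrow> smooth_fun_on A W g \<Longrightarrow> smooth_fun_on A W (\<lambda>p. f p - g p)"
  by (simp add: smooth_fun_on_def o_def smooth_on_diff open_cmap_image)

lemma smooth_fun_on_sum:
  "open W \<Longrightarrow> (\<And>i. i \<in> I \<Longrightarrow> smooth_fun_on A W (f i)) \<Longrightarrow> smooth_fun_on A W (\<lambda>p. \<Sum>i\<in>I. f i p)"
  by (simp add: smooth_fun_on_def o_def smooth_on_sum open_cmap_image)

lemma smooth_fun_on_inverse:
  fixes f :: "'a \<Rightarrow> real"
  shows "open W \<Longrightarrow> smooth_fun_on A W f \<Longrightarrow> (\<And>p. p \<in> W \<Longrightarrow> f p \<noteq> 0) \<Longrightarrow>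
    smooth_fun_on A W (\<lambda>p. inverse (f p))"
  unfolding smooth_fun_on_def o_def by (intro ballI smooth_on_inverse) (auto simp: open_cmap_image)

lemma smooth_fun_on_sqrt:
  "open W \<Longrightarrow> smooth_fun_on A W f \<Longrightarrow> (\<And>p. p \<in> W \<Longrightarrow> f p > 0) \<Longrightarrow> smooth_fun_on A W (\<lambda>p. sqrt (f p))"
  unfolding smooth_fun_on_def o_def by (intro ballI smooth_on_sqrt) (auto simp: open_cmap_image)

lemma smooth_fun_on_ln:
  fixes f :: "'a \<Rightarrow> real"
  shows "open W \<Longrightarrow> smooth_fun_on A W f \<Longrightarrow> (\<And>p. p \<in> W \<Longrightarrow> f p > 0) \<Longrightarrow> smooth_fun_on A W (\<lambda>p. ln (f p))"
  unfolding smooth_fun_on_def o_def by (intro ballI smooth_on_ln) (auto simp: open_cmap_image)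

lemma smooth_fun_on_cmap: "c \<in> A \<Longrightarrow> smooth_fun_on A (cdom c) (cmap c)"
  unfolding smooth_fun_on_def o_def using smooth_transition by blast


subsection \<open>The derivative of a function along a tangent vector\<close>

lemma tdiff_eqI:
  assumes "((\<lambda>y. f (cinv (chart_at A p) y)) has_derivative F) (at (cmap (chart_at A p) p))"
  shows "tdiff A f p = F"
  using frechet_derivative_eq[OF assms] by (auto simp: tdiff_def o_def)

lemma tdiff_has_derivative:
  assumes "open W" "p \<in> W" "smooth_fun_on A W f"
  shows "((\<lambda>y. f (cinv (chart_at A p) y)) has_derivative tdiff A f p) (at (cmap (chart_at A p) p))"
proof -
  have "cmap (chart_at A p) p \<in> cmap (chart_at A p) ` (cdom (chart_at A p) \<inter> W)" using assms by auto
  then show ?thesis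
    using smooth_on_has_derivative[OF smooth_fun_on_chart[OF assms(3) chart_at_in]]
    unfolding tdiff_def[abs_def] o_def by blast
qed

lemma linear_tdiff: "open W \<Longrightarrow> p \<in> W \<Longrightarrow> smooth_fun_on A W f \<Longrightarrow> linear (tdiff A f p)"
  using tdiff_has_derivative has_derivative_linear by blast

lemma tdiff_cong:
  assumes "open W" "p \<in> W" "\<And>q. q \<in> W \<Longrightarrow> f q = g q"
  shows "tdiff A f p = tdiff A g p"
proof -
  let ?c = "chart_at A p"
  have "frechet_derivative (\<lambda>y. f (cinv ?c y)) (at (cmap ?c p)) = frechet_derivative (\<lambda>y. g (cinv ?c y)) (at (cmap ?c p))"
    by (rule frechet_derivative_cong_open[of "cmap ?c ` (cdom ?c \<inter> W)"])
      (use assms in \<open>auto intro: open_cmap_image\<close>)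
  then show ?thesis by (auto simp: tdiff_def o_def)
qed

lemma tdiff_const [simp]: "tdiff A (\<lambda>q. k) p v = 0"
  by (simp add: tdiff_def o_def)

lemma tdiff_mult:
  fixes f g :: "'a \<Rightarrow> real"
  assumes "open W" "p \<in> W" "smooth_fun_on A W f" "smooth_fun_on A W g"
  shows "tdiff A (\<lambda>q. f q * g q) p v = f p * tdiff A g p v + tdiff A f p v * g p"
  using fun_cong[OF tdiff_eqI[OF has_derivative_mult[OF tdiff_has_derivative[OF assms(1-3)]
      tdiff_has_derivative[OF assms(1,2,4)]]]] by simp

lemma tdiff_ln:
  fixes f :: "'a \<Rightarrow> real"
  assumes "open W" "p \<in> W" "smooth_fun_on A W f" "f p > 0"
  shows "tdiff A (\<lambda>q. ln (f q)) p v = tdiff A f p v / f p"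
proof -
  have "((\<lambda>y. ln (f (cinv (chart_at A p) y))) has_derivative (\<lambda>v. tdiff A f p v * inverse (f p)))
      (at (cmap (chart_at A p) p))"
    using has_derivative_ln[of "\<lambda>y. f (cinv (chart_at A p) y)", OF _ tdiff_has_derivative[OF assms(1-3)]]
      assms(4) by simp
  from fun_cong[OF tdiff_eqI[OF this], of v] show ?thesis by (simp add: divide_inverse)
qed

text \<open>The chain rule: derivatives may be computed in any chart.\<close>

lemma tdiff_chart:
  fixes f :: "'a \<Rightarrow> 'y::real_normed_vector"
  assumes "c \<in> A" "p \<in> cdom c" "open W" "p \<in> W" "smooth_fun_on A W f"
  shows "tdiff A f p v = frechet_derivative (\<lambda>y. f (cinv c y)) (at (cmap c p)) (tdiff A (cmap c) p v)"
proof -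
  let ?d = "chart_at A p"
  have p: "cinv ?d (cmap ?d p) = p" by simp
  have "cmap c p \<in> cmap c ` (cdom c \<inter> W)" using assms by auto
  then have "((\<lambda>y. f (cinv c y)) has_derivative frechet_derivative (\<lambda>y. f (cinv c y)) (at (cmap c p))) (at (cmap c p))"
    using smooth_on_has_derivative[OF smooth_fun_on_chart[OF assms(5,1)]] by blast
  then have "((\<lambda>y. f (cinv c y)) has_derivative frechet_derivative (\<lambda>y. f (cinv c y)) (at (cmap c p)))
      (at (cmap c (cinv ?d (cmap ?d p))))" by (simp only: p)
  from has_derivative_compose[OF tdiff_has_derivative[OF open_cdom[OF assms(1)] assms(2) smooth_fun_on_cmap[OF assms(1)]] this]
  have "((\<lambda>y. f (cinv c (cmap c (cinv ?d y)))) has_derivative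
      (\<lambda>v. frechet_derivative (\<lambda>y. f (cinv c y)) (at (cmap c p)) (tdiff A (cmap c) p v))) (at (cmap ?d p))" .
  then have "((\<lambda>y. f (cinv ?d y)) has_derivative
      (\<lambda>v. frechet_derivative (\<lambda>y. f (cinv c y)) (at (cmap c p)) (tdiff A (cmap c) p v))) (at (cmap ?d p))"
    by (rule iffD1[OF has_derivative_cong_open[of "cmap ?d ` (cdom ?d \<inter> cdom c)"], rotated 3])
      (use assms in \<open>auto intro: open_cmap_image\<close>)
  from tdiff_eqI[OF this] show ?thesis by simp
qed

lemma tdiff_cmap_chart_at [simp]: "tdiff A (cmap (chart_at A p)) p v = v"
proof -
  let ?d = "chart_at A p"
  have "((\<lambda>y. cmap ?d (cinv ?d y)) has_derivative (\<lambda>v. v)) (at (cmap ?d p))"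
    by (rule iffD1[OF has_derivative_cong_open[of "crange ?d" _ "\<lambda>y. y"]])
      (auto intro!: derivative_eq_intros simp: cmap_cinv)
  from tdiff_eqI[OF this] show ?thesis by simp
qed

lemma tvec_tdiff [simp]:
  assumes "c \<in> A" "p \<in> cdom c"
  shows "tvec A c p (tdiff A (cmap c) p v) = v"
  using tdiff_chart[OF assms open_cdom[OF chart_at_in] in_chart_at smooth_fun_on_cmap[OF chart_at_in], of v]
  by (simp add: tvec_def o_def)

lemma linear_tdiff_cmap: "c \<in> A \<Longrightarrow> p \<in> cdom c \<Longrightarrow> linear (tdiff A (cmap c) p)"
  using linear_tdiff[OF open_cdom _ smooth_fun_on_cmap] by blast

lemma linear_tvec:
  assumes "c \<in> A" "p \<in> cdom c"
  shows "linear (tvec A c p)"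
proof -
  have "cmap c p \<in> cmap c ` (cdom c \<inter> cdom (chart_at A p))" using assms by auto
  then show ?thesis
    using smooth_on_differentiable[OF smooth_transition[OF assms(1) chart_at_in]]
      linear_frechet_derivative unfolding tvec_def[abs_def] o_def by blast
qed

lemma tdiff_tvec [simp]:
  assumes "c \<in> A" "p \<in> cdom c"
  shows "tdiff A (cmap c) p (tvec A c p w) = w"
proof -
  have "inj (tdiff A (cmap c) p)" using tvec_tdiff[OF assms] by (metis injI)
  then have "surj (tdiff A (cmap c) p)" using linear_injective_imp_surjective linear_tdiff_cmap[OF assms] by blast
  then obtain v where "w = tdiff A (cmap c) p v" by (metis surjD)
  then show ?thesis using tvec_tdiff[OF assms] by simp
qed

lemma tdiff_rep:
  assumes "c \<in> A" "y \<in> crange c" "open W" "cinv c y \<in> W" "smooth_fun_on A W f"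
  shows "tdiff A f (cinv c y) (X (cinv c y)) = frechet_derivative (\<lambda>y. f (cinv c y)) (at y) (rep c X y)"
  using tdiff_chart[OF assms(1) cinv_in_cdom[OF assms(1,2)] assms(3-5)] cmap_cinv[OF assms(1,2)]
  by (simp add: rep_def)


subsection \<open>Smooth vector fields\<close>

lemma smooth_vf_on_chart:
  "smooth_vf_on A W X \<Longrightarrow> c \<in> A \<Longrightarrow> smooth_on (cmap c ` (cdom c \<inter> W)) (rep c X)"
  unfolding smooth_vf_on_def o_def rep_def[abs_def] by blast

lemma smooth_vf_onI:
  "(\<And>c. c \<in> A \<Longrightarrow> smooth_on (cmap c ` (cdom c \<inter> W)) (rep c X)) \<Longrightarrow> smooth_vf_on A W X"
  unfolding smooth_vf_on_def o_def rep_def[abs_def] by blast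

lemma smooth_vf_on_subset: "smooth_vf_on A W X \<Longrightarrow> V \<subseteq> W \<Longrightarrow> smooth_vf_on A V X"
  unfolding smooth_vf_on_def by (meson Int_mono image_mono order_refl smooth_on_subset)

lemma rep_transition:
  assumes "c \<in> A" "d \<in> A" "y \<in> cmap d ` (cdom c \<inter> cdom d)"
  shows "rep d X y = frechet_derivative (\<lambda>z. cmap d (cinv c z)) (at (cmap c (cinv d y))) (rep c X (cmap c (cinv d y)))"
proof -
  have "cinv d y \<in> cdom c" "cinv d y \<in> cdom d" using assms by auto
  then show ?thesis
    using tdiff_chart[OF assms(1) _ open_cdom[OF assms(2)] _ smooth_fun_on_cmap[OF assms(2)]] assms(1)
    by (simp add: rep_def)
qed

lemma smooth_vf_on_locally:
  assumes "open W" and *: "\<And>p. p \<in> W \<Longrightarrow>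
    \<exists>c T. c \<in> A \<and> open T \<and> p \<in> T \<and> T \<subseteq> cdom c \<and> smooth_on (cmap c ` T) (rep c X)"
  shows "smooth_vf_on A W X"
proof (intro smooth_vf_onI smooth_on_locally)
  fix d y assume d: "d \<in> A" and "y \<in> cmap d ` (cdom d \<inter> W)"
  then obtain p where p: "p \<in> cdom d" "p \<in> W" "y = cmap d p" by auto
  obtain c T where c: "c \<in> A" "open T" "p \<in> T" "T \<subseteq> cdom c"
    "smooth_on (cmap c ` T) (rep c X)" using *[OF p(2)] by blast
  let ?U = "cmap d ` (cdom d \<inter> T)" and ?V = "cmap c ` (cdom c \<inter> (cdom d \<inter> T))"
  have U: "open ?U" "open ?V" using d c by (auto intro!: open_cmap_image)
  have "smooth_on ?V (\<lambda>z. cmap d (cinv c z))"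
    by (rule smooth_on_subset[OF smooth_transition[OF c(1) d]]) blast
  moreover have "smooth_on ?V (rep c X)" by (rule smooth_on_subset[OF c(5)]) blast
  ultimately have "smooth_on ?V (\<lambda>z. frechet_derivative (\<lambda>z. cmap d (cinv c z)) (at z) (rep c X z))"
    using smooth_on_frechet_derivative[OF U(2)] by blast
  moreover have "smooth_on ?U (\<lambda>y. cmap c (cinv d y))"
    by (rule smooth_on_subset[OF smooth_transition[OF d c(1)]]) (use c(4) in blast)
  moreover have "(\<lambda>y. cmap c (cinv d y)) ` ?U \<subseteq> ?V" using d c by auto
  ultimately have "smooth_on ?U (\<lambda>y. frechet_derivative (\<lambda>z. cmap d (cinv c z)) (at (cmap c (cinv d y)))
      (rep c X (cmap c (cinv d y))))"
    using smooth_on_compose[OF U] by blast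
  moreover have "rep d X y = frechet_derivative (\<lambda>z. cmap d (cinv c z)) (at (cmap c (cinv d y)))
      (rep c X (cmap c (cinv d y)))" if "y \<in> ?U" for y
    by (rule rep_transition[OF c(1) d]) (use that c(4) in blast)
  ultimately have "smooth_on ?U (rep d X)"
    by (rule iffD2[OF smooth_on_cong[OF U(1)], rotated])
  then show "\<exists>U. open U \<and> y \<in> U \<and> smooth_on U (rep d X)" using U p c by blast
qed

lemma smooth_vf_on_cover:
  assumes "open W" "\<And>p. p \<in> W \<Longrightarrow> \<exists>T. open T \<and> p \<in> T \<and> smooth_vf_on A T X"
  shows "smooth_vf_on A W X"
proof (rule smooth_vf_on_locally[OF assms(1)])
  fix p assume "p \<in> W"
  then obtain T where T: "open T" "p \<in> T" "smooth_vf_on A T X" using assms(2) by blast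
  then show "\<exists>c T. c \<in> A \<and> open T \<and> p \<in> T \<and> T \<subseteq> cdom c \<and> smooth_on (cmap c ` T) (rep c X)"
    using smooth_vf_on_chart[OF T(3), of "chart_at A p"]
    by (intro exI[of _ "chart_at A p"] exI[of _ "cdom (chart_at A p) \<inter> T"]) auto
qed

lemma smooth_vf_on_cong:
  assumes "open W" "\<And>p. p \<in> W \<Longrightarrow> X p = Y p" "smooth_vf_on A W X"
  shows "smooth_vf_on A W Y"
proof (rule smooth_vf_onI)
  fix c assume c: "c \<in> A"
  show "smooth_on (cmap c ` (cdom c \<inter> W)) (rep c Y)"
    by (rule iffD1[OF smooth_on_cong smooth_vf_on_chart[OF assms(3) c]])
      (use assms c open_cmap_image in \<open>auto simp: rep_def\<close>)
qed

lemma smooth_vf_on_zero [simp]: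
  assumes "open W"
  shows "smooth_vf_on A W (\<lambda>p. 0)"
proof (rule smooth_vf_onI)
  fix c assume c: "c \<in> A"
  show "smooth_on (cmap c ` (cdom c \<inter> W)) (rep c (\<lambda>p. 0))"
    by (rule iffD1[OF smooth_on_cong smooth_on_const[of _ 0]])
      (use assms c open_cmap_image in \<open>auto simp: rep_def linear_0[OF linear_tdiff_cmap]\<close>)
qed

lemma smooth_vf_on_add:
  assumes "open W" "smooth_vf_on A W X" "smooth_vf_on A W Y"
  shows "smooth_vf_on A W (\<lambda>p. X p + Y p)"
proof (rule smooth_vf_onI)
  fix c assume c: "c \<in> A"
  have "smooth_on (cmap c ` (cdom c \<inter> W)) (\<lambda>y. rep c X y + rep c Y y)"
    using assms c by (intro smooth_on_add smooth_vf_on_chart open_cmap_image)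
  then show "smooth_on (cmap c ` (cdom c \<inter> W)) (rep c (\<lambda>p. X p + Y p))"
    by (rule iffD1[OF smooth_on_cong, rotated 2])
      (use assms c open_cmap_image in \<open>auto simp: rep_def linear_add[OF linear_tdiff_cmap]\<close>)
qed

lemma smooth_vf_on_scaleR:
  assumes "open W" "smooth_fun_on A W f" "smooth_vf_on A W X"
  shows "smooth_vf_on A W (\<lambda>p. f p *\<^sub>R X p)"
proof (rule smooth_vf_onI)
  fix c assume c: "c \<in> A"
  have "smooth_on (cmap c ` (cdom c \<inter> W)) (\<lambda>y. f (cinv c y) *\<^sub>R rep c X y)"
    using assms c by (intro smooth_on_scaleR smooth_vf_on_chart smooth_fun_on_chart open_cmap_image)
  then show "smooth_on (cmap c ` (cdom c \<inter> W)) (rep c (\<lambda>p. f p *\<^sub>R X p))"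
    by (rule iffD1[OF smooth_on_cong, rotated 2])
      (use assms c open_cmap_image in \<open>auto simp: rep_def linear_cmul[OF linear_tdiff_cmap]\<close>)
qed

lemma smooth_vf_on_sum:
  assumes "open W" "\<And>i. i \<in> I \<Longrightarrow> smooth_vf_on A W (X i)"
  shows "smooth_vf_on A W (\<lambda>p. \<Sum>i\<in>I. X i p)"
  using assms(2)
  by (induction I rule: infinite_finite_induct)
    (auto intro: smooth_vf_on_add smooth_vf_on_zero assms(1))

lemma smooth_fun_on_tdiff:
  fixes f :: "'a \<Rightarrow> 'y::real_normed_vector"
  assumes "open W" "smooth_fun_on A W f" "smooth_vf_on A W X"
  shows "smooth_fun_on A W (\<lambda>p. tdiff A f p (X p))"
  unfolding smooth_fun_on_def o_def
proof
  fix c assume c: "c \<in> A"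
  have "smooth_on (cmap c ` (cdom c \<inter> W)) (\<lambda>y. frechet_derivative (\<lambda>y. f (cinv c y)) (at y) (rep c X y))"
    using assms c by (intro smooth_on_frechet_derivative smooth_vf_on_chart smooth_fun_on_chart open_cmap_image)
  moreover have "tdiff A f (cinv c y) (X (cinv c y)) =
      frechet_derivative (\<lambda>y. f (cinv c y)) (at y) (rep c X y)" if "y \<in> cmap c ` (cdom c \<inter> W)" for y
    by (rule tdiff_rep[OF c _ assms(1) _ assms(2)]) (use that c in auto)
  ultimately show "smooth_on (cmap c ` (cdom c \<inter> W)) (\<lambda>y. tdiff A f (cinv c y) (X (cinv c y)))"
    by (rule iffD2[OF smooth_on_cong[OF open_cmap_image[OF c assms(1)]], rotated])
qed

lemma rep_coordinate_field:
  "c \<in> A \<Longrightarrow> y \<in> crange c \<Longrightarrow> rep c (\<lambda>q. tvec A c q w) y = w"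
  by (simp add: rep_def cinv_in_cdom)

lemma smooth_coordinate_field:
  assumes "c \<in> A"
  shows "smooth_vf_on A (cdom c) (\<lambda>q. tvec A c q w)"
proof (rule smooth_vf_on_locally)
  fix p assume p: "p \<in> cdom c"
  have "smooth_on (crange c) (rep c (\<lambda>q. tvec A c q w))"
    using iffD1[OF smooth_on_cong[OF open_crange[OF assms]] smooth_on_const[of _ w]]
      rep_coordinate_field[OF assms] by metis
  then show "\<exists>c' T. c' \<in> A \<and> open T \<and> p \<in> T \<and> T \<subseteq> cdom c' \<and> smooth_on (cmap c' ` T) (rep c' (\<lambda>q. tvec A c q w))"
    using assms p open_cdom[OF assms] by blast
qed (use assms in simp)

text \<open>
  The coordinate expression of the Lie bracket holds in every chart: the terms with second
  derivatives of the transition map cancel by Schwarz's theorem.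
\<close>

lemma tdiff_lie_bracket:
  assumes c: "c \<in> A" "p \<in> cdom c" and W: "open W" "p \<in> W" "smooth_vf_on A W X" "smooth_vf_on A W Y"
  shows "tdiff A (cmap c) p (lie_bracket A X Y p) =
    frechet_derivative (rep c Y) (at (cmap c p)) (rep c X (cmap c p)) -
    frechet_derivative (rep c X) (at (cmap c p)) (rep c Y (cmap c p))"
proof -
  define d where "d = chart_at A p"
  have d: "d \<in> A" "p \<in> cdom d" by (auto simp: d_def)
  let ?\<phi> = "\<lambda>z. cmap c (cinv d z)"
  define \<Phi> where "\<Phi> = (\<lambda>z. frechet_derivative ?\<phi> (at z))"
  let ?T = "cmap d ` (cdom d \<inter> (cdom c \<inter> W))"
  define y where "y = cmap d p"
  have T: "open ?T" "y \<in> ?T" using c d W by (auto simp: y_def intro!: open_cmap_image)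
  have y: "?\<phi> y = cmap c p" using d by (simp add: y_def)
  have s\<phi>: "smooth_on ?T ?\<phi>" by (rule smooth_on_subset[OF smooth_transition[OF d(1) c(1)]]) blast
  have s\<Phi>: "smooth_on ?T (\<lambda>z. \<Phi> z w)" for w
    unfolding \<Phi>_def by (rule smooth_on_frechet_derivative[OF T(1) s\<phi> smooth_on_const])
  have lin: "linear (\<Phi> z)" if "z \<in> ?T" for z
    unfolding \<Phi>_def by (rule linear_frechet_derivative[OF smooth_on_differentiable[OF s\<phi> that]])
  have "rep d Z y = Z p" for Z by (simp add: rep_def y_def d_def)
  moreover have "tdiff A (cmap c) p v = \<Phi> y v" for v
    by (simp add: tdiff_def o_def y_def d_def \<Phi>_def)
  ultimately have at_p: "rep d Z y = Z p" "tdiff A (cmap c) p v = \<Phi> y v" for Z v by blast+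
  have key: "frechet_derivative (rep c Z) (at (cmap c p)) (\<Phi> y w) =
      frechet_derivative (\<lambda>z. \<Phi> z (Z p)) (at y) w + \<Phi> y (frechet_derivative (rep d Z) (at y) w)"
    if Z: "smooth_vf_on A W Z" for Z w
  proof -
    have sZ: "smooth_on ?T (rep d Z)" by (rule smooth_on_subset[OF smooth_vf_on_chart[OF Z d(1)]]) blast
    have sZc: "smooth_on (cmap c ` (cdom c \<inter> W)) (rep c Z)" using smooth_vf_on_chart[OF Z c(1)] .
    have "((\<lambda>z. rep c Z (?\<phi> z)) has_derivative
        (\<lambda>w. frechet_derivative (rep c Z) (at (?\<phi> y)) (\<Phi> y w))) (at y)"
      unfolding \<Phi>_def
      by (rule has_derivative_compose[OF smooth_on_has_derivative[OF s\<phi> T(2)]])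
        (rule smooth_on_has_derivative[OF sZc], use y c W in simp)
    moreover have "rep c Z (?\<phi> z) = (\<Sum>b\<in>Basis. (rep d Z z \<bullet> b) *\<^sub>R \<Phi> z b)" if "z \<in> ?T" for z
    proof -
      have "cinv d z \<in> cdom c" "cinv d z \<in> cdom d" "cmap d (cinv d z) = z" using that d by auto
      then have "?\<phi> z \<in> cmap c ` (cdom d \<inter> cdom c)" "cmap d (cinv c (?\<phi> z)) = z"
        using c(1) by simp_all
      then have "rep c Z (?\<phi> z) = \<Phi> z (rep d Z z)"
        unfolding \<Phi>_def using rep_transition[OF d(1) c(1), of "?\<phi> z" Z] by (simp only:)
      then show ?thesis by (rule trans) (rule linear_euclidean_expand[OF lin[OF that]])
    qed
    ultimately have 1: "((\<lambda>z. \<Sum>b\<in>Basis. (rep d Z z \<bullet> b) *\<^sub>R \<Phi> z b) has_derivative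
        (\<lambda>w. frechet_derivative (rep c Z) (at (?\<phi> y)) (\<Phi> y w))) (at y)"
      by (rule iffD1[OF has_derivative_cong_open[OF T], rotated])
    have 2: "((\<lambda>z. \<Sum>b\<in>Basis. (rep d Z z \<bullet> b) *\<^sub>R \<Phi> z b) has_derivative
        (\<lambda>w. \<Sum>b\<in>Basis. (rep d Z y \<bullet> b) *\<^sub>R frechet_derivative (\<lambda>z. \<Phi> z b) (at y) w +
          (frechet_derivative (rep d Z) (at y) w \<bullet> b) *\<^sub>R \<Phi> y b)) (at y)"
      by (intro has_derivative_sum has_derivative_scaleR has_derivative_inner_left
          smooth_on_has_derivative[OF sZ T(2)] smooth_on_has_derivative[OF s\<Phi> T(2)])
    have "((\<lambda>z. \<Sum>b\<in>Basis. (Z p \<bullet> b) *\<^sub>R \<Phi> z b) has_derivative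
        (\<lambda>w. \<Sum>b\<in>Basis. (Z p \<bullet> b) *\<^sub>R frechet_derivative (\<lambda>z. \<Phi> z b) (at y) w)) (at y)"
      by (intro has_derivative_sum has_derivative_scaleR_right smooth_on_has_derivative[OF s\<Phi> T(2)])
    moreover have "(\<Sum>b\<in>Basis. (Z p \<bullet> b) *\<^sub>R \<Phi> z b) = \<Phi> z (Z p)" if "z \<in> ?T" for z
      by (rule linear_euclidean_expand[OF lin[OF that], symmetric])
    ultimately have 3: "((\<lambda>z. \<Phi> z (Z p)) has_derivative
        (\<lambda>w. \<Sum>b\<in>Basis. (Z p \<bullet> b) *\<^sub>R frechet_derivative (\<lambda>z. \<Phi> z b) (at y) w)) (at y)"
      by (rule iffD1[OF has_derivative_cong_open[OF T], rotated])
    have "frechet_derivative (rep c Z) (at (?\<phi> y)) (\<Phi> y w) =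
        (\<Sum>b\<in>Basis. (rep d Z y \<bullet> b) *\<^sub>R frechet_derivative (\<lambda>z. \<Phi> z b) (at y) w +
          (frechet_derivative (rep d Z) (at y) w \<bullet> b) *\<^sub>R \<Phi> y b)"
      using has_derivative_unique[OF 1 2] by metis
    also have "\<dots> = frechet_derivative (\<lambda>z. \<Phi> z (Z p)) (at y) w + \<Phi> y (frechet_derivative (rep d Z) (at y) w)"
      unfolding sum.distrib at_p(1) fun_cong[OF frechet_derivative_eq[OF 3]]
      by (rule arg_cong[of _ _ "(+) _"], rule linear_euclidean_expand[OF lin[OF T(2)], symmetric])
    finally show ?thesis by (simp only: y)
  qed
  have lb: "lie_bracket A X Y p = frechet_derivative (rep d Y) (at y) (X p) - frechet_derivative (rep d X) (at y) (Y p)"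
    unfolding lie_bracket_def tdiff_def[of A _ p] d_def[symmetric] y_def[symmetric] o_def rep_def[abs_def] ..
  have repc: "rep c Z (cmap c p) = \<Phi> y (Z p)" for Z
    using c at_p(2) by (simp add: rep_def)
  have "frechet_derivative (\<lambda>z. \<Phi> z (Y p)) (at y) (X p) = frechet_derivative (\<lambda>z. \<Phi> z (X p)) (at y) (Y p)"
    unfolding \<Phi>_def by (rule Schwarz_symmetry[OF T s\<phi>])
  then show ?thesis
    unfolding at_p(2) lb repc key[OF W(3)] key[OF W(4)] linear_diff[OF lin[OF T(2)]] by simp
qed

end


section \<open>Metrics on distributions and orthonormal frames\<close>

context smooth_manifold
begin

lemma sections_tangent: "X \<in> sections A E W \<Longrightarrow> X \<in> sections A tangent_bundle W"
  by (simp add: sections_def)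

lemma sections_subset: "X \<in> sections A E W \<Longrightarrow> V \<subseteq> W \<Longrightarrow> X \<in> sections A E V"
  using smooth_vf_on_subset by (auto simp: sections_def)

lemma sections_smooth: "X \<in> sections A E W \<Longrightarrow> smooth_vf_on A W X"
  and sections_in: "X \<in> sections A E W \<Longrightarrow> p \<in> W \<Longrightarrow> X p \<in> E p"
  by (auto simp: sections_def)

end

locale metric_bundle = smooth_manifold A
  for A :: "('a::{t2_space,second_countable_topology}, 'n::finite) atlas" +
  fixes E :: "('a, 'n) distribution" and g :: "('a, 'n) fibre_form"
  assumes fibre_subspace: "subspace (E p)" and metric: "fibre_metric A E g"
begin

lemma metric_linear:
  assumes "x \<in> E p" "y \<in> E p" "z \<in> E p"
  shows "g p (a *\<^sub>R x + b *\<^sub>R y) z = a * g p x z + b * g p y z"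
  using metric assms by (simp add: fibre_metric_def)

lemma metric_sym: "x \<in> E p \<Longrightarrow> y \<in> E p \<Longrightarrow> g p x y = g p y x"
  using metric by (simp add: fibre_metric_def)

lemma metric_pos: "x \<in> E p \<Longrightarrow> x \<noteq> 0 \<Longrightarrow> g p x x > 0"
  using metric by (simp add: fibre_metric_def)

lemma metric_smooth:
  "open W \<Longrightarrow> X \<in> sections A E W \<Longrightarrow> Y \<in> sections A E W \<Longrightarrow> smooth_fun_on A W (\<lambda>p. g p (X p) (Y p))"
  using metric by (simp add: fibre_metric_def)

lemma metric_zero_left [simp]: "z \<in> E p \<Longrightarrow> g p 0 z = 0"
  using metric_linear[of 0 p 0 z 0 0] subspace_0[OF fibre_subspace] by simp

lemma metric_add_left: "x \<in> E p \<Longrightarrow> y \<in> E p \<Longrightarrow> z \<in> E p \<Longrightarrow> g p (x + y) z = g p x z + g p y z"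
  using metric_linear[of x p y z 1 1] by simp

lemma metric_scale_left: "x \<in> E p \<Longrightarrow> z \<in> E p \<Longrightarrow> g p (a *\<^sub>R x) z = a * g p x z"
  using metric_linear[of x p x z a 0] by simp

lemma metric_diff_left: "x \<in> E p \<Longrightarrow> y \<in> E p \<Longrightarrow> z \<in> E p \<Longrightarrow> g p (x - y) z = g p x z - g p y z"
  using metric_linear[of x p y z 1 "-1"] by simp

lemma metric_sum_left:
  assumes "\<And>i. i \<in> I \<Longrightarrow> x i \<in> E p" "z \<in> E p"
  shows "g p (\<Sum>i\<in>I. a i *\<^sub>R x i) z = (\<Sum>i\<in>I. a i * g p (x i) z)"
  using assms(1)
proof (induction I rule: infinite_finite_induct)
  case (insert i I)
  have "(\<Sum>i\<in>I. a i *\<^sub>R x i) \<in> E p"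
    using insert.prems by (intro subspace_sum[OF fibre_subspace] subspace_scale[OF fibre_subspace]) auto
  then show ?case
    using insert assms(2) by (simp add: metric_add_left metric_scale_left subspace_scale[OF fibre_subspace])
qed (use assms in auto)

lemma metric_sum_right:
  assumes "\<And>i. i \<in> I \<Longrightarrow> x i \<in> E p" "z \<in> E p"
  shows "g p z (\<Sum>i\<in>I. a i *\<^sub>R x i) = (\<Sum>i\<in>I. a i * g p z (x i))"
proof -
  have "(\<Sum>i\<in>I. a i *\<^sub>R x i) \<in> E p"
    using assms by (intro subspace_sum[OF fibre_subspace] subspace_scale[OF fibre_subspace]) auto
  then have "g p z (\<Sum>i\<in>I. a i *\<^sub>R x i) = g p (\<Sum>i\<in>I. a i *\<^sub>R x i) z"
    using metric_sym assms(2) by blast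
  also have "\<dots> = (\<Sum>i\<in>I. a i * g p (x i) z)" using assms by (rule metric_sum_left)
  also have "\<dots> = (\<Sum>i\<in>I. a i * g p z (x i))"
    using assms by (intro sum.cong refl) (metis metric_sym)
  finally show ?thesis .
qed

lemma metric_eqI:
  assumes "x \<in> E p" "y \<in> E p" "\<And>v. v \<in> E p \<Longrightarrow> g p x v = g p y v"
  shows "x = y"
proof (rule ccontr)
  assume "x \<noteq> y"
  moreover have xy: "x - y \<in> E p" using assms(1,2) subspace_diff[OF fibre_subspace] by blast
  ultimately have "g p (x - y) (x - y) > 0" by (simp add: metric_pos)
  then show False using assms(3)[OF xy] metric_diff_left[OF assms(1,2) xy] by simp
qed

lemma sections_zero: "open W \<Longrightarrow> (\<lambda>p. 0) \<in> sections A E W"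
  by (simp add: sections_def subspace_0[OF fibre_subspace] smooth_vf_on_zero)

lemma sections_add:
  "open W \<Longrightarrow> X \<in> sections A E W \<Longrightarrow> Y \<in> sections A E W \<Longrightarrow> (\<lambda>p. X p + Y p) \<in> sections A E W"
  by (simp add: sections_def smooth_vf_on_add subspace_add[OF fibre_subspace])

lemma sections_scaleR:
  "open W \<Longrightarrow> smooth_fun_on A W f \<Longrightarrow> X \<in> sections A E W \<Longrightarrow> (\<lambda>p. f p *\<^sub>R X p) \<in> sections A E W"
  by (simp add: sections_def smooth_vf_on_scaleR subspace_scale[OF fibre_subspace])

lemma sections_sum:
  "open W \<Longrightarrow> (\<And>i. i \<in> I \<Longrightarrow> X i \<in> sections A E W) \<Longrightarrow> (\<lambda>p. \<Sum>i\<in>I. X i p) \<in> sections A E W"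
  by (simp add: sections_def smooth_vf_on_sum subspace_sum[OF fibre_subspace])

lemma sections_diff:
  assumes "open W" "X \<in> sections A E W" "Y \<in> sections A E W"
  shows "(\<lambda>p. X p - Y p) \<in> sections A E W"
  using sections_add[OF assms(1,2) sections_scaleR[OF assms(1) smooth_fun_on_const[of W "-1"] assms(3)]]
  by simp

lemma orthonormal_expansion:
  fixes r :: nat
  assumes "\<And>i. i < r \<Longrightarrow> e i \<in> E p" "span (e ` {..<r}) = E p"
    and "\<And>i j. i < r \<Longrightarrow> j < r \<Longrightarrow> g p (e i) (e j) = (if i = j then 1 else 0)"
    and "v \<in> E p"
  shows "v = (\<Sum>i<r. g p v (e i) *\<^sub>R e i)"
proof -
  define w where "w = (\<Sum>i<r. g p v (e i) *\<^sub>R e i)"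
  have w: "w \<in> E p"
    unfolding w_def using assms(1) by (intro subspace_sum[OF fibre_subspace] subspace_scale[OF fibre_subspace]) auto
  have e: "g p w (e j) = g p v (e j)" if "j < r" for j
  proof -
    have "g p w (e j) = (\<Sum>i<r. g p v (e i) * g p (e i) (e j))"
      unfolding w_def using assms(1) that by (intro metric_sum_left) auto
    also have "\<dots> = (\<Sum>i<r. if i = j then g p v (e i) else 0)"
      using assms(3) that by (intro sum.cong) auto
    finally show ?thesis using that by simp
  qed
  have "g p w x = g p v x" if "x \<in> span (e ` {..<r})" for x
  proof -
    have "x \<in> E p \<and> g p w x = g p v x"
      using that
    proof (induction rule: span_induct_alt)
      case base
      then show ?case
        using subspace_0[OF fibre_subspace] metric_sym[of 0 p] metric_zero_left w assms(4) by metis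
    next
      case (step c x y)
      then have x: "x \<in> E p" "g p w x = g p v x" using e assms(1) by auto
      have cxy: "c *\<^sub>R x + y \<in> E p"
        using x step subspace_add[OF fibre_subspace] subspace_scale[OF fibre_subspace] by blast
      have "g p z (c *\<^sub>R x + y) = c * g p z x + g p z y" if "z \<in> E p" for z
      proof -
        have y: "y \<in> E p" using step by blast
        have "g p z (c *\<^sub>R x + y) = g p (c *\<^sub>R x + y) z" by (rule metric_sym[OF that cxy])
        also have "\<dots> = c * g p x z + g p y z" using metric_linear[OF x(1) y that, of c 1] by simp
        finally show ?thesis using metric_sym[OF that x(1)] metric_sym[OF that y] by simp
      qed
      then show ?case using cxy x step w assms(4) by simp
    qed
    then show ?thesis by blast
  qed
  then have "w = v" using metric_eqI[OF w assms(4)] assms(2) by blast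
  then show ?thesis by (simp add: w_def)
qed

text \<open>
  Gram-Schmidt, performed simultaneously at all points of \<open>W\<close>. The induction keeps the first
  \<open>m\<close> of the original sections in the span of the \<open>m\<close> new ones; by dimension, the next original
  section is then nowhere in this span, so its orthogonal part can be normalised.
\<close>

lemma gram_schmidt:
  assumes W: "open W" and X: "\<And>i. i < r \<Longrightarrow> X i \<in> sections A E W"
    and sp: "\<And>q. q \<in> W \<Longrightarrow> span ((\<lambda>i. X i q) ` {..<r}) = E q" and dim: "\<And>q. dim (E q) = r"
    and "m \<le> r"
  shows "\<exists>Y. (\<forall>i<m. Y i \<in> sections A E W) \<and> (\<forall>q\<in>W. (\<forall>i<m. X i q \<in> span ((\<lambda>i. Y i q) ` {..<m})) \<and>
    (\<forall>i<m. \<forall>j<m. g q (Y i q) (Y j q) = (if i = j then 1 else 0)))"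
  using assms(5)
proof (induction m)
  case 0
  then show ?case by auto
next
  case (Suc m)
  then obtain Y where "(\<forall>i<m. Y i \<in> sections A E W) \<and> (\<forall>q\<in>W. (\<forall>i<m. X i q \<in> span ((\<lambda>i. Y i q) ` {..<m})) \<and>
    (\<forall>i<m. \<forall>j<m. g q (Y i q) (Y j q) = (if i = j then 1 else 0)))"
    using Suc_leD by blast
  then have Y: "\<And>i. i < m \<Longrightarrow> Y i \<in> sections A E W"
    "\<And>q i. q \<in> W \<Longrightarrow> i < m \<Longrightarrow> X i q \<in> span ((\<lambda>i. Y i q) ` {..<m})"
    "\<And>q i j. q \<in> W \<Longrightarrow> i < m \<Longrightarrow> j < m \<Longrightarrow> g q (Y i q) (Y j q) = (if i = j then 1 else 0)"
    by auto
  have m: "m < r" using Suc.prems by simp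
  define P where "P = (\<lambda>q. \<Sum>i<m. g q (X m q) (Y i q) *\<^sub>R Y i q)"
  define Z where "Z = (\<lambda>q. X m q - P q)"
  have P: "P \<in> sections A E W"
    unfolding P_def using Y(1) X[OF m] by (intro sections_sum sections_scaleR metric_smooth W) auto
  have Z: "Z \<in> sections A E W" unfolding Z_def by (rule sections_diff[OF W X[OF m] P])
  have P_span: "P q \<in> span ((\<lambda>i. Y i q) ` {..<m})" for q
    unfolding P_def by (intro span_sum span_scale span_base) auto
  have Z_orth: "g q (Z q) (Y j q) = 0" if "q \<in> W" "j < m" for q j
  proof -
    have in_E: "X m q \<in> E q" "P q \<in> E q" "\<And>i. i < m \<Longrightarrow> Y i q \<in> E q"
      using X[OF m] P Y(1) that sections_in by blast+
    have "g q (P q) (Y j q) = (\<Sum>i<m. g q (X m q) (Y i q) * g q (Y i q) (Y j q))"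
      unfolding P_def using in_E that by (intro metric_sum_left) auto
    also have "\<dots> = (\<Sum>i<m. if i = j then g q (X m q) (Y i q) else 0)"
      using Y(3) that by (intro sum.cong) auto
    finally show ?thesis using that in_E by (simp add: Z_def metric_diff_left)
  qed
  have Z_nonzero: "Z q \<noteq> 0" if q: "q \<in> W" for q
  proof
    assume "Z q = 0"
    then have Xm: "X m q \<in> span ((\<lambda>i. Y i q) ` {..<m})" using P_span[of q] by (simp add: Z_def)
    let ?S = "(\<lambda>i. Y i q) ` {..<m} \<union> (\<lambda>i. X i q) ` {m<..<r}"
    have "X i q \<in> span ?S" if "i < r" for i
    proof (cases "i \<le> m")
      case True
      then have "X i q \<in> span ((\<lambda>i. Y i q) ` {..<m})"
        using Y(2)[OF q] Xm by (cases "i = m") auto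
      then show ?thesis by (meson span_mono subsetD sup_ge1)
    next
      case False
      then show ?thesis using that by (intro span_base) auto
    qed
    then have "span ((\<lambda>i. X i q) ` {..<r}) \<subseteq> span ?S"
      by (intro span_minimal) auto
    then have "E q \<subseteq> span ?S" using sp[OF q] by simp
    then have "dim (E q) \<le> card ?S" by (rule dim_le_card) simp
    also have "\<dots> \<le> card ((\<lambda>i. Y i q) ` {..<m}) + card ((\<lambda>i. X i q) ` {m<..<r})"
      by (rule card_Un_le)
    also have "\<dots> \<le> m + (r - Suc m)"
      using card_image_le[of "{..<m}" "\<lambda>i. Y i q"] card_image_le[of "{m<..<r}" "\<lambda>i. X i q"] by simp
    finally show False using dim[of q] m by simp
  qed
  define N where "N = (\<lambda>q. sqrt (g q (Z q) (Z q)))"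
  have Zpos: "g q (Z q) (Z q) > 0" if "q \<in> W" for q
    using that Z_nonzero sections_in[OF Z] metric_pos by blast
  have N: "smooth_fun_on A W N" "\<And>q. q \<in> W \<Longrightarrow> N q > 0"
    unfolding N_def using Zpos by (auto intro!: smooth_fun_on_sqrt W metric_smooth Z)
  define Ym where "Ym = (\<lambda>q. inverse (N q) *\<^sub>R Z q)"
  have Ym: "Ym \<in> sections A E W"
    unfolding Ym_def using N by (intro sections_scaleR smooth_fun_on_inverse W Z) (auto simp: less_imp_neq[THEN not_sym])
  let ?Y = "Y(m := Ym)"
  show ?case
  proof (intro exI[of _ ?Y] conjI allI impI ballI)
    show "?Y i \<in> sections A E W" if "i < Suc m" for i
      using that Y(1) Ym by (auto simp: less_Suc_eq)
  next
    fix q i assume q: "q \<in> W" and i: "i < Suc m"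
    have sub: "span ((\<lambda>i. Y i q) ` {..<m}) \<subseteq> span ((\<lambda>i. ?Y i q) ` {..<Suc m})"
      by (intro span_mono) (auto simp: image_iff less_Suc_eq)
    show "X i q \<in> span ((\<lambda>i. ?Y i q) ` {..<Suc m})"
    proof (cases "i = m")
      case True
      have "Ym q \<in> span ((\<lambda>i. ?Y i q) ` {..<Suc m})" by (intro span_base) (auto simp: image_iff)
      then have "N q *\<^sub>R Ym q + P q \<in> span ((\<lambda>i. ?Y i q) ` {..<Suc m})"
        using P_span[of q] sub by (intro span_add span_scale) auto
      moreover have "N q *\<^sub>R Ym q + P q = X m q" using N(2)[OF q] by (simp add: Ym_def Z_def)
      ultimately show ?thesis using True by simp
    next
      case False
      then show ?thesis using Y(2)[OF q, of i] i sub by auto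
    qed
  next
    fix q i j assume q: "q \<in> W" and ij: "i < Suc m" "j < Suc m"
    have in_E: "Z q \<in> E q" "Ym q \<in> E q" "\<And>i. i < m \<Longrightarrow> Y i q \<in> E q"
      using Z Ym Y(1) q sections_in by blast+
    have 1: "g q (Ym q) (Y j q) = 0" if "j < m" for j
      using Z_orth[OF q that] in_E that by (simp add: Ym_def metric_scale_left)
    have 2: "g q (Y j q) (Ym q) = 0" if "j < m" for j
      using 1[OF that] metric_sym[of "Y j q" q "Ym q"] in_E that by simp
    have "g q (Ym q) (Ym q) = inverse (N q) * (inverse (N q) * g q (Z q) (Z q))"
      using in_E unfolding Ym_def
      by (metis Ym_def in_E(2) metric_scale_left metric_sym)
    also have "g q (Z q) (Z q) = N q * N q" using Zpos[OF q] by (simp add: N_def)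
    finally have 3: "g q (Ym q) (Ym q) = 1" using N(2)[OF q] by (simp add: field_simps)
    show "g q (?Y i q) (?Y j q) = (if i = j then 1 else 0)"
      using ij 1 2 3 Y(3)[OF q] by (auto simp: less_Suc_eq)
  qed
qed

lemma orthonormal_frame_exists:
  assumes "smooth_distribution A r E"
  shows "\<exists>W X. p \<in> W \<and> orthonormal_frame A E g r W X"
proof -
  obtain W X where W: "open W" "p \<in> W" and X: "\<And>i. i < r \<Longrightarrow> X i \<in> sections A E W"
    and sp: "\<And>q. q \<in> W \<Longrightarrow> span ((\<lambda>i. X i q) ` {..<r}) = E q"
    using assms unfolding smooth_distribution_def by metis
  have dim: "\<And>q. dim (E q) = r" using assms unfolding smooth_distribution_def by blast
  obtain Y where "(\<forall>i<r. Y i \<in> sections A E W) \<and> (\<forall>q\<in>W. (\<forall>i<r. X i q \<in> span ((\<lambda>i. Y i q) ` {..<r})) \<and>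
    (\<forall>i<r. \<forall>j<r. g q (Y i q) (Y j q) = (if i = j then 1 else 0)))"
    using gram_schmidt[OF W(1) X sp dim order_refl] by blast
  then have Y: "\<And>i. i < r \<Longrightarrow> Y i \<in> sections A E W"
    "\<And>q i. q \<in> W \<Longrightarrow> i < r \<Longrightarrow> X i q \<in> span ((\<lambda>i. Y i q) ` {..<r})"
    "\<And>q i j. q \<in> W \<Longrightarrow> i < r \<Longrightarrow> j < r \<Longrightarrow> g q (Y i q) (Y j q) = (if i = j then 1 else 0)"
    by auto
  have "span ((\<lambda>i. Y i q) ` {..<r}) = E q" if q: "q \<in> W" for q
  proof
    show "span ((\<lambda>i. Y i q) ` {..<r}) \<subseteq> E q"
      using Y(1) q sections_in by (intro span_minimal fibre_subspace) blast
    have "span ((\<lambda>i. X i q) ` {..<r}) \<subseteq> span ((\<lambda>i. Y i q) ` {..<r})"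
      using Y(2)[OF q] by (intro span_minimal subspace_span) auto
    then show "E q \<subseteq> span ((\<lambda>i. Y i q) ` {..<r})" using sp[OF q] by simp
  qed
  then have "orthonormal_frame A E g r W Y"
    unfolding orthonormal_frame_def using W Y by auto
  then show ?thesis using W by blast
qed

lemma frame_at_orthonormal:
  assumes "smooth_distribution A r E"
  obtains W where "p \<in> W" "orthonormal_frame A E g r W (frame_at A E g r p)"
proof -
  have "\<exists>X W. p \<in> W \<and> orthonormal_frame A E g r W X"
    using orthonormal_frame_exists[OF assms] by blast
  then have "\<exists>W. p \<in> W \<and> orthonormal_frame A E g r W (frame_at A E g r p)"
    unfolding frame_at_def by (rule someI_ex)
  then show thesis using that by blast
qed

lemma orthonormal_frameD:
  assumes "orthonormal_frame A E g r W F"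
  shows "open W" "\<And>i. i < r \<Longrightarrow> F i \<in> sections A E W"
    and "\<And>i p. i < r \<Longrightarrow> p \<in> W \<Longrightarrow> F i p \<in> E p"
    and "\<And>i j p. i < r \<Longrightarrow> j < r \<Longrightarrow> p \<in> W \<Longrightarrow> g p (F i p) (F j p) = (if i = j then 1 else 0)"
  using assms unfolding orthonormal_frame_def sections_def by auto

lemma frame_expansion:
  assumes "orthonormal_frame A E g r W F" "p \<in> W" "v \<in> E p"
  shows "v = (\<Sum>i<r. g p v (F i p) *\<^sub>R F i p)"
  using assms orthonormal_frameD[OF assms(1)]
  by (intro orthonormal_expansion) (auto simp: orthonormal_frame_def)

text \<open>In a frame \<open>F\<close> the gradient is the sum of the \<open>(F i f) F i\<close>, which makes it smooth.\<close>

lemma gradient_exists: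
  assumes E: "smooth_distribution A r E" and f: "smooth_fun_on A UNIV (f :: 'a \<Rightarrow> real)"
  shows "\<exists>G \<in> sections A E UNIV. \<forall>p. \<forall>v\<in>E p. g p (G p) v = tdiff A f p v"
proof -
  define G where "G = (\<lambda>p. \<Sum>i<r. tdiff A f p (frame_at A E g r p i p) *\<^sub>R frame_at A E g r p i p)"
  have local: "(\<Sum>i<r. tdiff A f p (F i p) *\<^sub>R F i p) \<in> E p \<and>
      (\<forall>v\<in>E p. g p (\<Sum>i<r. tdiff A f p (F i p) *\<^sub>R F i p) v = tdiff A f p v)"
    if F: "orthonormal_frame A E g r W F" and p: "p \<in> W" for W F p
  proof (intro conjI ballI)
    note F' = orthonormal_frameD[OF F]
    show "(\<Sum>i<r. tdiff A f p (F i p) *\<^sub>R F i p) \<in> E p"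
      using F' p by (intro subspace_sum[OF fibre_subspace] subspace_scale[OF fibre_subspace]) auto
    fix v assume v: "v \<in> E p"
    have lin: "linear (tdiff A f p)" using linear_tdiff[OF open_UNIV UNIV_I f] .
    have "g p (\<Sum>i<r. tdiff A f p (F i p) *\<^sub>R F i p) v = (\<Sum>i<r. tdiff A f p (F i p) * g p (F i p) v)"
      using F' p v by (intro metric_sum_left) auto
    also have "\<dots> = (\<Sum>i<r. g p v (F i p) * tdiff A f p (F i p))"
      using F' p v by (intro sum.cong refl) (simp add: metric_sym[of _ p v])
    also have "\<dots> = tdiff A f p (\<Sum>i<r. g p v (F i p) *\<^sub>R F i p)"
      by (simp add: linear_sum[OF lin] linear_cmul[OF lin])
    finally show "g p (\<Sum>i<r. tdiff A f p (F i p) *\<^sub>R F i p) v = tdiff A f p v"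
      using frame_expansion[OF F p v] by simp
  qed
  have G: "G p \<in> E p" "\<And>v. v \<in> E p \<Longrightarrow> g p (G p) v = tdiff A f p v" for p
  proof -
    obtain W where "p \<in> W" "orthonormal_frame A E g r W (frame_at A E g r p)"
      using frame_at_orthonormal[OF E] by blast
    from local[OF this(2,1)] show "G p \<in> E p" "\<And>v. v \<in> E p \<Longrightarrow> g p (G p) v = tdiff A f p v"
      by (auto simp: G_def)
  qed
  have "smooth_vf_on A UNIV G"
  proof (rule smooth_vf_on_cover[OF open_UNIV])
    fix p
    obtain W F where p: "p \<in> W" and F: "orthonormal_frame A E g r W F"
      using orthonormal_frame_exists[OF E] by blast
    note F' = orthonormal_frameD[OF F]
    have "smooth_vf_on A W (\<lambda>q. \<Sum>i<r. tdiff A f q (F i q) *\<^sub>R F i q)"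
      using F' smooth_fun_on_subset[OF f]
      by (intro smooth_vf_on_sum smooth_vf_on_scaleR smooth_fun_on_tdiff sections_smooth[of _ E]) auto
    moreover have "(\<Sum>i<r. tdiff A f q (F i q) *\<^sub>R F i q) = G q" if "q \<in> W" for q
      using local[OF F that] G by (intro metric_eqI[of _ q]) auto
    ultimately have "smooth_vf_on A W G" by (rule smooth_vf_on_cong[OF F'(1), rotated])
    then show "\<exists>T. open T \<and> p \<in> T \<and> smooth_vf_on A T G" using p F'(1) by blast
  qed
  then have "G \<in> sections A E UNIV" using G by (simp add: sections_def)
  then show ?thesis using G by blast
qed

text \<open>
  The gradient is unique even when tested only against global sections, because the difference of
  two candidates is itself such a section.
\<close>

lemma hgrad_characterization:
  assumes E: "smooth_distribution A r E" and f: "smooth_fun_on A UNIV (f :: 'a \<Rightarrow> real)"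
  shows "hgrad A E g f \<in> sections A E UNIV"
    and "\<And>p v. v \<in> E p \<Longrightarrow> g p (hgrad A E g f p) v = tdiff A f p v"
proof -
  obtain G where G: "G \<in> sections A E UNIV" "\<And>p v. v \<in> E p \<Longrightarrow> g p (G p) v = tdiff A f p v"
    using gradient_exists[OF assms] by blast
  have "hgrad A E g f = G"
    unfolding hgrad_def
  proof (rule the_equality)
    show "G \<in> sections A E UNIV \<and> (\<forall>X\<in>sections A E UNIV. \<forall>p. g p (G p) (X p) = tdiff A f p (X p))"
      using G sections_in by blast
    fix G' assume G': "G' \<in> sections A E UNIV \<and> (\<forall>X\<in>sections A E UNIV. \<forall>p. g p (G' p) (X p) = tdiff A f p (X p))"
    show "G' = G"
    proof
      fix p
      let ?Z = "\<lambda>p. G' p - G p"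
      have Z: "?Z \<in> sections A E UNIV" using G G' sections_diff[OF open_UNIV] by blast
      then have "g p (G' p) (?Z p) = tdiff A f p (?Z p)" using bspec[OF conjunct2[OF G'] Z] by simp
      moreover have in_E: "G p \<in> E p" "G' p \<in> E p" "?Z p \<in> E p" using G G' Z sections_in by blast+
      ultimately have "g p (?Z p) (?Z p) = 0" using G by (simp add: metric_diff_left)
      then show "G' p = G p" using metric_pos[OF in_E(3)] by fastforce
    qed
  qed
  then show "hgrad A E g f \<in> sections A E UNIV"
    "\<And>p v. v \<in> E p \<Longrightarrow> g p (hgrad A E g f p) v = tdiff A f p v"
    using G by auto
qed


subsection \<open>Connections and the divergence of a section\<close>

context
  fixes D :: "('a, 'n) conn"
  assumes D: "connection A E D"
begin

lemma connection_section:
  "open W \<Longrightarrow> X \<in> sections A E W \<Longrightarrow> Y \<in> sections A E W \<Longrightarrow> D X Y \<in> sections A E W"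
  using D unfolding connection_def by blast

lemma connection_in:
  "open W \<Longrightarrow> X \<in> sections A E W \<Longrightarrow> Y \<in> sections A E W \<Longrightarrow> p \<in> W \<Longrightarrow> D X Y p \<in> E p"
  using connection_section sections_in by blast

lemma connection_add_left:
  "open W \<Longrightarrow> X \<in> sections A E W \<Longrightarrow> Z \<in> sections A E W \<Longrightarrow> Y \<in> sections A E W \<Longrightarrow> p \<in> W \<Longrightarrow>
    D (\<lambda>q. X q + Z q) Y p = D X Y p + D Z Y p"
  using D unfolding connection_def by blast

lemma connection_scaleR_left:
  "open W \<Longrightarrow> X \<in> sections A E W \<Longrightarrow> Y \<in> sections A E W \<Longrightarrow> smooth_fun_on A W f \<Longrightarrow> p \<in> W \<Longrightarrow>
    D (\<lambda>q. f q *\<^sub>R X q) Y p = f p *\<^sub>R D X Y p"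
  using D unfolding connection_def by blast

text \<open>
  A field \<open>Z\<close> vanishing on \<open>W\<close> is left unchanged by multiplication with the function that is
  \<open>0\<close> on \<open>W\<close> and \<open>1\<close> elsewhere, so \<open>D Z Y\<close> vanishes on \<open>W\<close>.
\<close>

lemma connection_cong_left:
  assumes W: "open W" "p \<in> W" and X: "X \<in> sections A E W" "X' \<in> sections A E W" "Y \<in> sections A E W"
    and eq: "\<And>q. q \<in> W \<Longrightarrow> X q = X' q"
  shows "D X Y p = D X' Y p"
proof -
  define Z where "Z = (\<lambda>q. X' q - X q)"
  define f :: "'a \<Rightarrow> real" where "f = (\<lambda>q. if q \<in> W then 0 else 1)"
  have Z: "Z \<in> sections A E W" unfolding Z_def by (rule sections_diff[OF W(1) X(2,1)])
  have f: "smooth_fun_on A W f"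
    by (rule smooth_fun_on_cong[OF W(1) _ smooth_fun_on_const[of W 0]]) (simp add: f_def)
  have "(\<lambda>q. f q *\<^sub>R Z q) = Z" using eq by (auto simp: f_def Z_def)
  then have "D Z Y p = 0" using connection_scaleR_left[OF W(1) Z X(3) f W(2)] W(2) by (simp add: f_def)
  moreover have "D X' Y p = D X Y p + D Z Y p"
    using connection_add_left[OF W(1) X(1) Z X(3) W(2)] by (simp add: Z_def)
  ultimately show ?thesis by simp
qed

lemma connection_sum_left:
  assumes W: "open W" "p \<in> W" and "Y \<in> sections A E W"
    and "\<And>i. i \<in> I \<Longrightarrow> smooth_fun_on A W (a i)" "\<And>i. i \<in> I \<Longrightarrow> X i \<in> sections A E W"
  shows "D (\<lambda>q. \<Sum>i\<in>I. a i q *\<^sub>R X i q) Y p = (\<Sum>i\<in>I. a i p *\<^sub>R D (X i) Y p)"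
proof -
  have zero: "D (\<lambda>q. 0) Y p = 0"
    using connection_scaleR_left[OF W(1) sections_zero[OF W(1)] assms(3) smooth_fun_on_const[of W 0] W(2)]
    by simp
  show ?thesis
    using assms(4,5)
  proof (induction I rule: infinite_finite_induct)
    case (insert i I)
    have "D (\<lambda>q. a i q *\<^sub>R X i q + (\<Sum>i\<in>I. a i q *\<^sub>R X i q)) Y p =
        D (\<lambda>q. a i q *\<^sub>R X i q) Y p + D (\<lambda>q. \<Sum>i\<in>I. a i q *\<^sub>R X i q) Y p"
      using insert.prems W assms(3)
      by (intro connection_add_left[of W]) (auto intro!: sections_sum sections_scaleR)
    moreover have "D (\<lambda>q. a i q *\<^sub>R X i q) Y p = a i p *\<^sub>R D (X i) Y p"
      using insert.prems W assms(3) by (intro connection_scaleR_left[of W]) auto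
    ultimately show ?case using insert by simp
  qed (use zero in auto)
qed

text \<open>
  The divergence at a point is defined through a frame chosen for that point alone; independence of
  the frame lets a single frame compute it on a neighbourhood, which yields \<open>smooth_hdiv\<close>. It
  follows by expanding one frame in the other, as \<open>D\<close> is linear over functions in its first argument.
\<close>

lemma divergence_frame_independent:
  assumes F: "orthonormal_frame A E g r W F" "p \<in> W" and F': "orthonormal_frame A E g r W' F'" "p \<in> W'"
    and Y: "Y \<in> sections A E UNIV"
  shows "(\<Sum>i<r. g p (D (F i) Y p) (F i p)) = (\<Sum>i<r. g p (D (F' i) Y p) (F' i p))"
proof -
  let ?U = "W \<inter> W'"
  note FD = orthonormal_frameD[OF F(1)] and FD' = orthonormal_frameD[OF F'(1)]
  have U: "open ?U" "p \<in> ?U" using FD(1) FD'(1) F F' by auto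
  have FU: "F i \<in> sections A E ?U" "F' i \<in> sections A E ?U" if "i < r" for i
    using sections_subset[OF FD(2)[OF that]] sections_subset[OF FD'(2)[OF that]] by auto
  have YU: "Y \<in> sections A E ?U" using sections_subset[OF Y] by blast
  define a where "a i j q = g q (F' i q) (F j q)" for i j q
  have a: "smooth_fun_on A ?U (a i j)" if "i < r" "j < r" for i j
    unfolding a_def using FU that by (intro metric_smooth[OF U(1)]) auto
  have Dp: "D (F j) Y p \<in> E p" if "j < r" for j using connection_in[OF U(1) FU(1)[OF that] YU U(2)] .
  have in_E: "F j p \<in> E p" "F' j p \<in> E p" if "j < r" for j using FD FD' F F' that by auto
  have DF': "D (F' i) Y p = (\<Sum>j<r. a i j p *\<^sub>R D (F j) Y p)" if i: "i < r" for i
  proof -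
    have "D (F' i) Y p = D (\<lambda>q. \<Sum>j<r. a i j q *\<^sub>R F j q) Y p"
    proof (rule connection_cong_left[OF U])
      show "(\<lambda>q. \<Sum>j<r. a i j q *\<^sub>R F j q) \<in> sections A E ?U"
        using a i FU by (intro sections_sum sections_scaleR U) auto
      show "F' i q = (\<Sum>j<r. a i j q *\<^sub>R F j q)" if "q \<in> ?U" for q
        unfolding a_def using that FD' i by (intro frame_expansion[OF F(1)]) auto
    qed (use FU YU i in auto)
    also have "\<dots> = (\<Sum>j<r. a i j p *\<^sub>R D (F j) Y p)"
      using a i FU by (intro connection_sum_left[OF U YU]) auto
    finally show ?thesis .
  qed
  have "(\<Sum>i<r. g p (D (F' i) Y p) (F' i p)) = (\<Sum>i<r. \<Sum>j<r. a i j p * g p (D (F j) Y p) (F' i p))"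
  proof (intro sum.cong refl)
    fix i assume "i \<in> {..<r}"
    then show "g p (D (F' i) Y p) (F' i p) = (\<Sum>j<r. a i j p * g p (D (F j) Y p) (F' i p))"
      using DF'[of i] metric_sum_left[of "{..<r}" "\<lambda>j. D (F j) Y p" p "F' i p" "\<lambda>j. a i j p"] Dp in_E
      by simp
  qed
  also have "\<dots> = (\<Sum>j<r. \<Sum>i<r. a i j p * g p (D (F j) Y p) (F' i p))" by (rule sum.swap)
  also have "\<dots> = (\<Sum>j<r. g p (D (F j) Y p) (F j p))"
  proof (intro sum.cong refl)
    fix j assume "j \<in> {..<r}"
    then have j: "j < r" by simp
    have "(\<Sum>i<r. a i j p * g p (D (F j) Y p) (F' i p)) = g p (D (F j) Y p) (\<Sum>i<r. a i j p *\<^sub>R F' i p)"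
      using in_E Dp j by (intro metric_sum_right[symmetric]) auto
    also have "(\<Sum>i<r. a i j p *\<^sub>R F' i p) = (\<Sum>i<r. g p (F j p) (F' i p) *\<^sub>R F' i p)"
      unfolding a_def using in_E j by (intro sum.cong refl) (simp add: metric_sym[of _ p "F j p"])
    also have "\<dots> = F j p" using frame_expansion[OF F' in_E(1)[OF j]] by simp
    finally show "(\<Sum>i<r. a i j p * g p (D (F j) Y p) (F' i p)) = g p (D (F j) Y p) (F j p)" .
  qed
  finally show ?thesis by simp
qed

lemma smooth_hdiv:
  assumes E: "smooth_distribution A r E" and Y: "Y \<in> sections A E UNIV"
  shows "smooth_fun_on A UNIV (hdiv A r E g D Y)"
proof (rule smooth_fun_on_cover[OF open_UNIV])
  fix p
  obtain W F where p: "p \<in> W" and F: "orthonormal_frame A E g r W F"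
    using orthonormal_frame_exists[OF E] by blast
  note F' = orthonormal_frameD[OF F]
  have YW: "Y \<in> sections A E W" using sections_subset[OF Y] by blast
  have "smooth_fun_on A W (\<lambda>q. \<Sum>i<r. g q (D (F i) Y q) (F i q))"
    using F' YW by (intro smooth_fun_on_sum metric_smooth connection_section) auto
  moreover have "(\<Sum>i<r. g q (D (F i) Y q) (F i q)) = hdiv A r E g D Y q" if q: "q \<in> W" for q
  proof -
    obtain W' where "q \<in> W'" "orthonormal_frame A E g r W' (frame_at A E g r q)"
      using frame_at_orthonormal[OF E] by blast
    then show ?thesis unfolding hdiv_def Let_def by (intro divergence_frame_independent[OF F q _ _ Y])
  qed
  ultimately have "smooth_fun_on A W (hdiv A r E g D Y)" by (rule smooth_fun_on_cong[OF F'(1), rotated])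
  then show "\<exists>T. open T \<and> p \<in> T \<and> smooth_fun_on A T (hdiv A r E g D Y)" using p F'(1) by blast
qed

end

lemma metric_connection_frame:
  assumes D: "metric_connection A E g D" and F: "orthonormal_frame A E g r W F" "p \<in> W" "i < r"
    and X: "X \<in> sections A E W"
  shows "g p (D X (F i) p) (F i p) = 0"
proof -
  note F' = orthonormal_frameD[OF F(1)]
  have conn: "connection A E D" using D unfolding metric_connection_def by blast
  have "tdiff A (\<lambda>q. g q (F i q) (F i q)) p (X p) = g p (D X (F i) p) (F i p) + g p (F i p) (D X (F i) p)"
    using D F'(1) F'(2)[OF F(3)] X F(2) unfolding metric_connection_def by blast
  also have "tdiff A (\<lambda>q. g q (F i q) (F i q)) p = tdiff A (\<lambda>q. 1) p"
    by (rule tdiff_cong[OF F'(1) F(2)]) (simp add: F'(4) F(3))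
  also have "g p (F i p) (D X (F i) p) = g p (D X (F i) p) (F i p)"
    using connection_in[OF conn F'(1) X F'(2)[OF F(3)] F(2)] F' F by (intro metric_sym) auto
  finally show ?thesis by simp
qed

end


section \<open>The divergence of a vector field in a chart\<close>

locale riemannian_manifold = metric_bundle A tangent_bundle g
  for A :: "('a::{t2_space,second_countable_topology}, 'n::finite) atlas" and g :: "('a, 'n) fibre_form"
begin

lemma vector_field_section: "X \<in> sections A tangent_bundle W \<longleftrightarrow> smooth_vf_on A W X"
  by (simp add: sections_def)

lemma metric_in_chart:
  assumes c: "c \<in> A" "p \<in> cdom c"
  shows "g p u v = (\<Sum>i\<in>UNIV. \<Sum>j\<in>UNIV. gram A g c p $ i $ j * tdiff A (cmap c) p u $ i * tdiff A (cmap c) p v $ j)"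
proof -
  let ?e = "\<lambda>i. tvec A c p (axis i 1)"
  have exp: "v = (\<Sum>i\<in>UNIV. (tdiff A (cmap c) p v $ i) *\<^sub>R ?e i)" for v
  proof -
    have "tdiff A (cmap c) p v = (\<Sum>i\<in>UNIV. (tdiff A (cmap c) p v $ i) *\<^sub>R axis i 1)"
      using basis_expansion[of "tdiff A (cmap c) p v"] by (simp add: scalar_mult_eq_scaleR)
    then have "tvec A c p (tdiff A (cmap c) p v) = tvec A c p (\<Sum>i\<in>UNIV. (tdiff A (cmap c) p v $ i) *\<^sub>R axis i 1)"
      by (rule arg_cong)
    then show ?thesis
      using c by (simp add: linear_sum[OF linear_tvec] linear_cmul[OF linear_tvec])
  qed
  have "g p u v = g p (\<Sum>i\<in>UNIV. (tdiff A (cmap c) p u $ i) *\<^sub>R ?e i) (\<Sum>j\<in>UNIV. (tdiff A (cmap c) p v $ j) *\<^sub>R ?e j)"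
    using exp[of u] exp[of v] by (rule arg_cong2)
  also have "\<dots> = (\<Sum>i\<in>UNIV. tdiff A (cmap c) p u $ i * (\<Sum>j\<in>UNIV. tdiff A (cmap c) p v $ j * g p (?e i) (?e j)))"
    by (subst metric_sum_left, simp, simp, subst metric_sum_right) simp_all
  finally show ?thesis by (simp add: gram_def sum_distrib_left mult_ac)
qed

lemma gram_sym: "gram A g c p $ i $ j = gram A g c p $ j $ i"
  by (simp add: gram_def) (rule metric_sym, auto)

lemma smooth_on_gram:
  assumes "c \<in> A"
  shows "smooth_on (crange c) (\<lambda>y. gram A g c (cinv c y) $ i $ j)"
proof -
  have "smooth_fun_on A (cdom c) (\<lambda>q. g q (tvec A c q (axis i 1)) (tvec A c q (axis j 1)))"
    using assms by (intro metric_smooth) (auto simp: vector_field_section smooth_coordinate_field)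
  from smooth_fun_on_chart[OF this assms] show ?thesis by (simp add: gram_def)
qed

lemma smooth_on_det_gram:
  assumes "c \<in> A"
  shows "smooth_on (crange c) (\<lambda>y. det (gram A g c (cinv c y)))"
  unfolding det_def using assms
  by (intro smooth_on_sum smooth_on_mult smooth_on_const smooth_on_prod smooth_on_gram open_crange)

text \<open>
  In coordinates \<open>[F a, X]\<close> is \<open>dX (F a) - dF a (X)\<close>, and the products of \<open>dX (F a)\<close> with \<open>F a\<close> sum
  up to the trace of \<open>dX\<close>. Differentiating \<open>g (F a, F a) = 1\<close> along \<open>X\<close> trades the second part for
  the derivative of the Gram matrix, whose trace in the frame is the logarithmic derivative of
  the Gram determinant.
\<close>

lemma frame_divergence_in_chart:
  assumes c: "c \<in> A" "p \<in> cdom c"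
    and F: "orthonormal_frame A tangent_bundle g CARD('n) W F" "p \<in> W"
    and X: "smooth_vf_on A W X"
  shows "det (gram A g c p) > 0"
    and "2 * det (gram A g c p) * (\<Sum>a<CARD('n). g p (lie_bracket A (F a) X p) (F a p)) =
      2 * det (gram A g c p) * (\<Sum>i\<in>UNIV. frechet_derivative (rep c X) (at (cmap c p)) (axis i 1) $ i) +
      frechet_derivative (\<lambda>y. det (gram A g c (cinv c y))) (at (cmap c p)) (rep c X (cmap c p))"
proof -
  note FD = orthonormal_frameD[OF F(1)]
  have smF: "smooth_vf_on A W (F a)" if "a < CARD('n)" for a using FD(2)[OF that] vector_field_section by blast
  \<comment> \<open>The frame is renumbered by \<open>'n\<close>, so that its components form a square matrix.\<close>
  obtain \<sigma> :: "nat \<Rightarrow> 'n" where \<sigma>: "bij_betw \<sigma> {..<CARD('n)} UNIV"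
    using ex_bij_betw_nat_finite[of "UNIV :: 'n set"] by (auto simp: atLeast0LessThan)
  define \<tau> where "\<tau> = inv_into {..<CARD('n)} \<sigma>"
  have \<tau>: "bij_betw \<tau> UNIV {..<CARD('n)}" unfolding \<tau>_def using \<sigma> by (rule bij_betw_inv_into)
  have \<tau>_less: "\<tau> a < CARD('n)" and \<tau>_inj: "\<tau> a = \<tau> b \<longleftrightarrow> a = b" for a b
    using \<tau> by (auto simp: bij_betw_def inj_on_def)
  define y where "y = cmap c p"
  let ?U = "cmap c ` (cdom c \<inter> W)"
  have U: "open ?U" "y \<in> ?U" using c F FD(1) by (auto simp: y_def intro!: open_cmap_image)
  have y: "y \<in> crange c" "cinv c y = p" using c by (auto simp: y_def)
  define G where "G = (\<lambda>y. gram A g c (cinv c y))"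
  define G' where "G' = (\<lambda>i j. frechet_derivative (\<lambda>y. G y $ i $ j) (at y))"
  define e where "e = (\<lambda>a. rep c (F (\<tau> a)))"
  define e' where "e' = (\<lambda>a. frechet_derivative (e a) (at y))"
  define x where "x = rep c X y"
  define x' where "x' = frechet_derivative (rep c X) (at y)"
  have Gd: "((\<lambda>y. G y $ i $ j) has_derivative G' i j) (at y)" for i j
    unfolding G'_def G_def by (rule smooth_on_has_derivative[OF smooth_on_gram[OF c(1)] y(1)])
  have ed: "(e a has_derivative e' a) (at y)" for a
    unfolding e_def e'_def by (rule smooth_on_has_derivative[OF smooth_vf_on_chart[OF smF[OF \<tau>_less] c(1)] U(2)])
  have xd: "(rep c X has_derivative x') (at y)"
    unfolding x'_def by (rule smooth_on_has_derivative[OF smooth_vf_on_chart[OF X c(1)] U(2)])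
  have metric_rep: "g (cinv c z) (Y (cinv c z)) (Z (cinv c z)) = (\<Sum>i\<in>UNIV. \<Sum>j\<in>UNIV. G z $ i $ j * rep c Y z $ i * rep c Z z $ j)"
    if "z \<in> ?U" for z Y Z
    unfolding G_def rep_def using that c by (intro metric_in_chart) auto
  have on: "(\<Sum>i\<in>UNIV. \<Sum>j\<in>UNIV. G z $ i $ j * e a z $ i * e b z $ j) = (if a = b then 1 else 0)"
    if "z \<in> ?U" for z a b
  proof -
    have "cinv c z \<in> W" using that c by auto
    then show ?thesis
      unfolding e_def metric_rep[OF that, symmetric] using FD(4) \<tau>_less \<tau>_inj by simp
  qed
  note det = has_derivative_det_orthonormal[of G G' y "\<lambda>a. e a y", OF Gd on[OF U(2)]]
  show "det (gram A g c p) > 0" using det(2) y by (simp add: G_def)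
  have G_sym: "G y $ i $ j = G y $ j $ i" for i j unfolding G_def by (rule gram_sym)
  have diff1: "(\<Sum>i\<in>UNIV. \<Sum>j\<in>UNIV. G' i j x * e a y $ i * e a y $ j) =
      - 2 * (\<Sum>i\<in>UNIV. \<Sum>j\<in>UNIV. G y $ i $ j * e a y $ i * e' a x $ j)" for a
  proof -
    have 1: "((\<lambda>z. \<Sum>i\<in>UNIV. \<Sum>j\<in>UNIV. G z $ i $ j * e a z $ i * e a z $ j) has_derivative
        (\<lambda>v. \<Sum>i\<in>UNIV. \<Sum>j\<in>UNIV. (G y $ i $ j * e a y $ i) * e' a v $ j +
          (G y $ i $ j * e' a v $ i + G' i j v * e a y $ i) * e a y $ j)) (at y)"
      by (intro has_derivative_sum has_derivative_mult Gd bounded_linear.has_derivative[OF bounded_linear_vec_nth ed])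
    have 2: "((\<lambda>z. \<Sum>i\<in>UNIV. \<Sum>j\<in>UNIV. G z $ i $ j * e a z $ i * e a z $ j) has_derivative (\<lambda>v. 0)) (at y)"
      by (rule iffD2[OF has_derivative_cong_open[OF U]]) (use on in auto)
    have "(\<Sum>i\<in>UNIV. \<Sum>j\<in>UNIV. (G y $ i $ j * e a y $ i) * e' a x $ j +
          (G y $ i $ j * e' a x $ i + G' i j x * e a y $ i) * e a y $ j) = 0"
      by (rule fun_cong[OF has_derivative_unique[OF 1 2]])
    then have "(\<Sum>i\<in>UNIV. \<Sum>j\<in>UNIV. G y $ i $ j * e a y $ i * e' a x $ j) +
        (\<Sum>i\<in>UNIV. \<Sum>j\<in>UNIV. G y $ i $ j * e' a x $ i * e a y $ j) +
        (\<Sum>i\<in>UNIV. \<Sum>j\<in>UNIV. G' i j x * e a y $ i * e a y $ j) = 0"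
      by (simp add: sum.distrib algebra_simps)
    moreover have "(\<Sum>i\<in>UNIV. \<Sum>j\<in>UNIV. G y $ i $ j * e' a x $ i * e a y $ j) =
        (\<Sum>i\<in>UNIV. \<Sum>j\<in>UNIV. G y $ i $ j * e a y $ i * e' a x $ j)"
      by (subst sum.swap) (intro sum.cong refl, simp add: G_sym mult_ac)
    ultimately show ?thesis by linarith
  qed
  have bracket: "g p (lie_bracket A (F (\<tau> a)) X p) (F (\<tau> a) p) =
      (\<Sum>i\<in>UNIV. \<Sum>j\<in>UNIV. G y $ i $ j * e a y $ i * x' (e a y) $ j) -
      (\<Sum>i\<in>UNIV. \<Sum>j\<in>UNIV. G y $ i $ j * e a y $ i * e' a x $ j)" for a
  proof -
    have "tdiff A (cmap c) p (lie_bracket A (F (\<tau> a)) X p) = x' (e a y) - e' a x"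
      unfolding x'_def e'_def x_def e_def y_def
      by (rule tdiff_lie_bracket[OF c FD(1) F(2) smF[OF \<tau>_less] X])
    moreover have "tdiff A (cmap c) p (F (\<tau> a) p) = e a y" using y by (simp add: e_def rep_def)
    moreover have "g p (lie_bracket A (F (\<tau> a)) X p) (F (\<tau> a) p) = g p (F (\<tau> a) p) (lie_bracket A (F (\<tau> a)) X p)"
      by (rule metric_sym) auto
    ultimately have "g p (lie_bracket A (F (\<tau> a)) X p) (F (\<tau> a) p) =
        (\<Sum>i\<in>UNIV. \<Sum>j\<in>UNIV. G y $ i $ j * e a y $ i * (x' (e a y) - e' a x) $ j)"
      using metric_in_chart[OF c, of "F (\<tau> a) p" "lie_bracket A (F (\<tau> a)) X p"] y by (simp add: G_def)
    then show ?thesis by (simp add: sum_subtractf algebra_simps)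
  qed
  have "(\<Sum>a<CARD('n). g p (lie_bracket A (F a) X p) (F a p)) =
      (\<Sum>a\<in>UNIV. g p (lie_bracket A (F (\<tau> a)) X p) (F (\<tau> a) p))"
    by (rule sum.reindex_bij_betw[OF \<tau>, symmetric])
  also have "\<dots> = (\<Sum>i\<in>UNIV. x' (axis i 1) $ i) +
      (\<Sum>a\<in>UNIV. \<Sum>i\<in>UNIV. \<Sum>j\<in>UNIV. G' i j x * e a y $ i * e a y $ j) / 2"
    unfolding bracket sum_subtractf diff1
    using trace_orthonormal[of "G y" "\<lambda>a. e a y" x', OF on[OF U(2)] has_derivative_linear[OF xd]]
    by (simp add: sum_distrib_left[symmetric] sum_negf)
  finally have "(\<Sum>a<CARD('n). g p (lie_bracket A (F a) X p) (F a p)) = (\<Sum>i\<in>UNIV. x' (axis i 1) $ i) +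
      (\<Sum>a\<in>UNIV. \<Sum>i\<in>UNIV. \<Sum>j\<in>UNIV. G' i j x * e a y $ i * e a y $ j) / 2" .
  moreover have "frechet_derivative (\<lambda>y. det (G y)) (at y) x =
      det (G y) * (\<Sum>a\<in>UNIV. \<Sum>i\<in>UNIV. \<Sum>j\<in>UNIV. G' i j x * e a y $ i * e a y $ j)"
    by (rule fun_cong[OF frechet_derivative_eq[OF det(1)]])
  ultimately show "2 * det (gram A g c p) * (\<Sum>a<CARD('n). g p (lie_bracket A (F a) X p) (F a p)) =
      2 * det (gram A g c p) * (\<Sum>i\<in>UNIV. frechet_derivative (rep c X) (at (cmap c p)) (axis i 1) $ i) +
      frechet_derivative (\<lambda>y. det (gram A g c (cinv c y))) (at (cmap c p)) (rep c X (cmap c p))"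
    unfolding x'_def x_def G_def y(2) y_def[symmetric] by (simp add: algebra_simps)
qed

definition vol_density :: "('a, 'n) chart \<Rightarrow> real ^ 'n \<Rightarrow> real" where
  "vol_density c y = sqrt (det (gram A g c (cinv c y)))"

end


section \<open>Horizontal divergence and mean curvature\<close>

locale sub_riemannian_splitting =
  fixes A :: "('a::{t2_space,second_countable_topology}, 'n::finite) atlas"
    and k :: nat
    and H V :: "('a, 'n) distribution"
    and gc g :: "('a, 'n) fibre_form"
    and D nabla :: "('a, 'n) conn"
  assumes sub_riemannian: "sub_riemannian A k H gc"
    and splitting: "splitting A k H V"
    and extension: "orthogonal_extension A H V gc g"
    and horizontal: "horizontal_connection A H V gc D"
    and levi_civita: "levi_civita A g nabla"
begin

sublocale smooth_manifold A
  by unfold_locales (use sub_riemannian in \<open>simp add: sub_riemannian_def\<close>)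

lemma horizontal_distribution: "smooth_distribution A k H"
  and vertical_distribution: "smooth_distribution A (CARD('n) - k) V"
  and k_less: "k < CARD('n)"
  using sub_riemannian splitting by (auto simp: sub_riemannian_def splitting_def)

sublocale hor: metric_bundle A H gc
  by unfold_locales
    (use horizontal_distribution sub_riemannian in \<open>auto simp: smooth_distribution_def sub_riemannian_def\<close>)

sublocale tan: riemannian_manifold A g
  by unfold_locales (use extension in \<open>auto simp: orthogonal_extension_def\<close>)

lemma vertical_metric: "fibre_metric A V g"
proof -
  have "g p y z = g p z y" for p y z by (rule tan.metric_sym) auto
  then show ?thesis
    unfolding fibre_metric_def
    using tan.metric_linear tan.metric_pos tan.metric_smooth[OF _ sections_tangent sections_tangent]
    by (intro conjI allI ballI impI) auto
qed

sublocale ver: metric_bundle A V g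
  by unfold_locales (use vertical_distribution vertical_metric in \<open>auto simp: smooth_distribution_def\<close>)

abbreviation div_H :: "('a \<Rightarrow> real ^ 'n) \<Rightarrow> 'a \<Rightarrow> real" where
  "div_H \<equiv> hdiv A k H gc D"

abbreviation H_perp :: "'a \<Rightarrow> real ^ 'n" where
  "H_perp \<equiv> mean_curvature A k H V g nabla"

lemma g_horizontal: "x \<in> H p \<Longrightarrow> y \<in> H p \<Longrightarrow> g p x y = gc p x y"
  and g_orthogonal: "x \<in> H p \<Longrightarrow> y \<in> V p \<Longrightarrow> g p x y = 0"
  using extension unfolding orthogonal_extension_def by blast+

lemma proj: "proj H V p v \<in> H p" "v - proj H V p v \<in> V p"
proof -
  have sp: "H p \<inter> V p = {0}" "{x + y |x y. x \<in> H p \<and> y \<in> V p} = UNIV"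
    using splitting unfolding splitting_def by blast+
  have "v \<in> {x + y |x y. x \<in> H p \<and> y \<in> V p}" unfolding sp(2) by simp
  then obtain h w where hw: "v = h + w" "h \<in> H p" "w \<in> V p" by blast
  have "proj H V p v = h"
    unfolding proj_def
  proof (rule the_equality)
    show "h \<in> H p \<and> v - h \<in> V p" using hw by simp
    fix h' assume h': "h' \<in> H p \<and> v - h' \<in> V p"
    have "h' - h \<in> H p" using h' hw subspace_diff[OF hor.fibre_subspace] by blast
    moreover have "(v - h) - (v - h') \<in> V p"
      by (rule subspace_diff[OF ver.fibre_subspace]) (use h' hw in auto)
    ultimately have "h' - h \<in> H p \<inter> V p" by simp
    then show "h' = h" using sp(1) by simp
  qed
  then show "proj H V p v \<in> H p" "v - proj H V p v \<in> V p" using hw by auto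
qed

lemma gc_proj:
  assumes "x \<in> H p"
  shows "gc p x (proj H V p v) = g p x v" "gc p (proj H V p v) x = g p v x"
proof -
  have "g p v x = g p (proj H V p v + (v - proj H V p v)) x" by simp
  also have "\<dots> = g p (proj H V p v) x + g p (v - proj H V p v) x" by (rule tan.metric_add_left) auto
  also have "g p (v - proj H V p v) x = g p x (v - proj H V p v)" by (rule tan.metric_sym) auto
  also have "\<dots> = 0" using g_orthogonal[OF assms proj(2)] .
  finally show *: "gc p (proj H V p v) x = g p v x" using g_horizontal proj(1) assms by simp
  have "gc p x (proj H V p v) = gc p (proj H V p v) x" by (rule hor.metric_sym[OF assms proj(1)])
  moreover have "g p v x = g p x v" by (rule tan.metric_sym) auto
  ultimately show "gc p x (proj H V p v) = g p x v" using * by simp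
qed

lemma mean_curvature_horizontal: "H_perp p \<in> H p"
  unfolding mean_curvature_def Let_def
  by (intro subspace_sum[OF hor.fibre_subspace] proj)

text \<open>
  Both connections are torsion-free in the appropriate sense, so that \<open>D (F i) X\<close> and
  \<open>nabla (T b) X\<close> may be replaced by brackets: the other term \<open>D X (F i)\<close> (or \<open>nabla X (T b)\<close>) is
  orthogonal to the unit field \<open>F i\<close> (or \<open>T b\<close>).
\<close>

lemma div_H_bracket:
  assumes F: "orthonormal_frame A H gc k W (frame_at A H gc k p)" "p \<in> W" and X: "X \<in> sections A H UNIV"
  shows "div_H X p = (\<Sum>i<k. g p (lie_bracket A (frame_at A H gc k p i) X p) (frame_at A H gc k p i p))"
proof -
  let ?F = "frame_at A H gc k p"
  note FD = hor.orthonormal_frameD[OF F(1)]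
  have XW: "X \<in> sections A H W" using sections_subset[OF X] by blast
  have mc: "metric_connection A H gc D" using horizontal by (simp add: horizontal_connection_def)
  then have conn: "connection A H D" by (simp add: metric_connection_def)
  have "gc p (D (?F i) X p) (?F i p) = g p (lie_bracket A (?F i) X p) (?F i p)" if i: "i < k" for i
  proof -
    have "D (?F i) X p - D X (?F i) p = proj H V p (lie_bracket A (?F i) X p)"
      using horizontal FD(1) FD(2)[OF i] XW F(2) unfolding horizontal_connection_def by blast
    moreover have "D (?F i) X p \<in> H p" "D X (?F i) p \<in> H p" "?F i p \<in> H p"
      using hor.connection_in[OF conn FD(1)] FD(2)[OF i] XW F(2) sections_in by blast+
    ultimately have "gc p (D (?F i) X p) (?F i p) - gc p (D X (?F i) p) (?F i p) =
        gc p (proj H V p (lie_bracket A (?F i) X p)) (?F i p)"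
      by (metis hor.metric_diff_left)
    then show ?thesis
      using hor.metric_connection_frame[OF mc F i XW] gc_proj(2) FD(3)[OF i F(2)] by simp
  qed
  then show ?thesis by (simp add: hdiv_def Let_def)
qed

lemma mean_curvature_bracket:
  assumes T: "orthonormal_frame A V g (CARD('n) - k) W (frame_at A V g (CARD('n) - k) p)" "p \<in> W"
    and X: "X \<in> sections A H UNIV"
  shows "gc p (X p) (H_perp p) = - (\<Sum>b<CARD('n) - k.
    g p (lie_bracket A (frame_at A V g (CARD('n) - k) p b) X p) (frame_at A V g (CARD('n) - k) p b p))"
proof -
  let ?T = "frame_at A V g (CARD('n) - k) p"
  note TD = ver.orthonormal_frameD[OF T(1)]
  have XW: "X \<in> sections A tangent_bundle W" using sections_subset[OF sections_tangent[OF X]] by blast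
  have XH: "X q \<in> H q" for q using sections_in[OF X] by simp
  have mc: "metric_connection A tangent_bundle g nabla" using levi_civita by (simp add: levi_civita_def)
  have "g p (X p) (nabla (?T b) (?T b) p) = - g p (lie_bracket A (?T b) X p) (?T b p)"
    if b: "b < CARD('n) - k" for b
  proof -
    have Tb: "?T b \<in> sections A tangent_bundle W" using sections_tangent[OF TD(2)[OF b]] .
    have "tdiff A (\<lambda>q. g q (X q) (?T b q)) p (?T b p) =
        g p (nabla (?T b) X p) (?T b p) + g p (X p) (nabla (?T b) (?T b) p)"
      using mc TD(1) Tb XW T(2) unfolding metric_connection_def by blast
    moreover have "tdiff A (\<lambda>q. g q (X q) (?T b q)) p = tdiff A (\<lambda>q. 0) p"
      by (rule tdiff_cong[OF TD(1) T(2)]) (use g_orthogonal XH TD(3)[OF b] in simp)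
    ultimately have 1: "g p (X p) (nabla (?T b) (?T b) p) = - g p (nabla (?T b) X p) (?T b p)" by simp
    have "nabla (?T b) X p - nabla X (?T b) p = lie_bracket A (?T b) X p"
      using levi_civita TD(1) Tb XW T(2) unfolding levi_civita_def by blast
    then have "g p (nabla (?T b) X p) (?T b p) - g p (nabla X (?T b) p) (?T b p) = g p (lie_bracket A (?T b) X p) (?T b p)"
      by (metis tan.metric_diff_left UNIV_I)
    moreover have "g p (nabla X (?T b) p) (?T b p) = 0"
    proof -
      have conn: "connection A tangent_bundle nabla" using mc by (simp add: metric_connection_def)
      have "tdiff A (\<lambda>q. g q (?T b q) (?T b q)) p (X p) =
          g p (nabla X (?T b) p) (?T b p) + g p (?T b p) (nabla X (?T b) p)"
        using mc TD(1) Tb XW T(2) unfolding metric_connection_def by blast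
      moreover have "tdiff A (\<lambda>q. g q (?T b q) (?T b q)) p = tdiff A (\<lambda>q. 1) p"
        by (rule tdiff_cong[OF TD(1) T(2)]) (simp add: TD(4) b)
      moreover have "g p (?T b p) (nabla X (?T b) p) = g p (nabla X (?T b) p) (?T b p)"
        by (rule tan.metric_sym) auto
      ultimately show ?thesis by simp
    qed
    ultimately show ?thesis using 1 by simp
  qed
  moreover have "gc p (X p) (H_perp p) = (\<Sum>b<CARD('n) - k. g p (X p) (nabla (?T b) (?T b) p))"
  proof -
    have "gc p (X p) (\<Sum>b<CARD('n) - k. 1 *\<^sub>R proj H V p (nabla (?T b) (?T b) p)) =
        (\<Sum>b<CARD('n) - k. 1 * gc p (X p) (proj H V p (nabla (?T b) (?T b) p)))"
      by (rule hor.metric_sum_right) (use proj XH in auto)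
    then show ?thesis by (simp add: mean_curvature_def Let_def gc_proj[OF XH])
  qed
  ultimately show ?thesis by (simp add: sum_negf)
qed

text \<open>
  A horizontal and a vertical orthonormal frame together form an orthonormal frame for \<open>g\<close>; so
  the difference below is the trace of the bracket, that is, the Riemannian divergence of \<open>X\<close>.
\<close>

lemma adapted_frame:
  obtains W F where "p \<in> W" "orthonormal_frame A tangent_bundle g CARD('n) W F"
    and "\<And>X. X \<in> sections A H UNIV \<Longrightarrow>
      div_H X p - gc p (X p) (H_perp p) = (\<Sum>a<CARD('n). g p (lie_bracket A (F a) X p) (F a p))"
proof -
  let ?n = "CARD('n)"
  let ?F = "frame_at A H gc k p" and ?T = "frame_at A V g (?n - k) p"
  obtain W1 where W1: "p \<in> W1" "orthonormal_frame A H gc k W1 ?F"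
    using hor.frame_at_orthonormal[OF horizontal_distribution] by blast
  obtain W2 where W2: "p \<in> W2" "orthonormal_frame A V g (?n - k) W2 ?T"
    using ver.frame_at_orthonormal[OF vertical_distribution] by blast
  note FD = hor.orthonormal_frameD[OF W1(2)] and TD = ver.orthonormal_frameD[OF W2(2)]
  define B where "B = (\<lambda>a. if a < k then ?F a else ?T (a - k))"
  let ?W = "W1 \<inter> W2"
  have on: "orthonormal_frame A tangent_bundle g ?n ?W B"
    unfolding orthonormal_frame_def
  proof (intro conjI ballI allI impI)
    show "open ?W" using FD(1) TD(1) by blast
    show "B a \<in> sections A tangent_bundle ?W" if "a < ?n" for a
    proof (cases "a < k")
      case True
      then show ?thesis
        unfolding B_def using sections_subset[OF sections_tangent[OF FD(2)[OF True]]] by simp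
    next
      case False
      then have "a - k < ?n - k" using that by simp
      from sections_subset[OF sections_tangent[OF TD(2)[OF this]]] show ?thesis
        using False by (simp add: B_def)
    qed
    fix q assume q: "q \<in> ?W"
    show orth: "g q (B a q) (B b q) = (if a = b then 1 else 0)" if "a < ?n" "b < ?n" for a b
    proof -
      have T_in: "?T (i - k) q \<in> V q" if "\<not> i < k" "i < ?n" for i using that q TD(3) by auto
      have F_in: "?F i q \<in> H q" if "i < k" for i using that q FD(3) by auto
      consider "a < k" "b < k" | "a < k" "\<not> b < k" | "\<not> a < k" "b < k" | "\<not> a < k" "\<not> b < k" by blast
      then show ?thesis
      proof cases
        case 1
        then show ?thesis using g_horizontal[OF F_in F_in] FD(4) q by (simp add: B_def)
      next
        case 2
        then show ?thesis using g_orthogonal[OF F_in T_in] that by (auto simp: B_def)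
      next
        case 3
        have "g q (?T (a - k) q) (?F b q) = g q (?F b q) (?T (a - k) q)" by (rule tan.metric_sym) auto
        then show ?thesis using g_orthogonal[OF F_in T_in, of b a] that 3 by (auto simp: B_def)
      next
        case 4
        then have "a - k < ?n - k" "b - k < ?n - k" "a - k = b - k \<longleftrightarrow> a = b" using that by auto
        then show ?thesis using TD(4) q 4 by (simp add: B_def)
      qed
    qed
    show "span ((\<lambda>a. B a q) ` {..<?n}) = UNIV"
    proof -
      have "H q \<subseteq> span ((\<lambda>a. B a q) ` {..<?n})"
      proof -
        have "H q = span ((\<lambda>a. ?F a q) ` {..<k})" using W1(2) q by (simp add: orthonormal_frame_def)
        also have "\<dots> \<subseteq> span ((\<lambda>a. B a q) ` {..<?n})"
        proof (intro span_mono subsetI)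
          fix z assume "z \<in> (\<lambda>a. ?F a q) ` {..<k}"
          then obtain a where "a < k" "z = B a q" by (auto simp: B_def)
          then show "z \<in> (\<lambda>a. B a q) ` {..<?n}" using k_less by auto
        qed
        finally show ?thesis .
      qed
      moreover have "V q \<subseteq> span ((\<lambda>a. B a q) ` {..<?n})"
      proof -
        have "V q = span ((\<lambda>a. ?T a q) ` {..<?n - k})" using W2(2) q by (simp add: orthonormal_frame_def)
        also have "\<dots> \<subseteq> span ((\<lambda>a. B a q) ` {..<?n})"
        proof (intro span_mono subsetI)
          fix z assume "z \<in> (\<lambda>a. ?T a q) ` {..<?n - k}"
          then obtain b where "b < ?n - k" "z = B (b + k) q" by (auto simp: B_def)
          then show "z \<in> (\<lambda>a. B a q) ` {..<?n}" by (intro image_eqI[of _ _ "b + k"]) auto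
        qed
        finally show ?thesis .
      qed
      moreover have "v = proj H V q v + (v - proj H V q v)" for v by simp
      ultimately show ?thesis using proj span_add by (metis UNIV_eq_I subsetD)
    qed
  qed
  show thesis
  proof (rule that[of ?W B])
    show "p \<in> ?W" using W1 W2 by blast
    fix X assume X: "X \<in> sections A H UNIV"
    let ?b = "\<lambda>Y. g p (lie_bracket A Y X p) (Y p)"
    have "(\<Sum>a<?n. ?b (B a)) = (\<Sum>a<k + (?n - k). ?b (B a))" using k_less by simp
    also have "\<dots> = (\<Sum>a<k. ?b (B a)) + (\<Sum>b<?n - k. ?b (B (k + b)))"
    proof -
      have "(\<Sum>a<k + m. f a) = (\<Sum>a<k. f a) + (\<Sum>b<m. f (k + b))" for f :: "nat \<Rightarrow> real" and m
        by (induction m) auto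
      then show ?thesis .
    qed
    also have "\<dots> = (\<Sum>a<k. ?b (?F a)) + (\<Sum>b<?n - k. ?b (?T b))" by (simp add: B_def)
    finally show "div_H X p - gc p (X p) (H_perp p) = (\<Sum>a<?n. ?b (B a))"
      using div_H_bracket[OF W1(2,1) X] mean_curvature_bracket[OF W2(2,1) X] by simp
  qed (rule on)
qed

lemma vol_density_pos:
  assumes "c \<in> A" "y \<in> crange c"
  shows "det (gram A g c (cinv c y)) > 0" "tan.vol_density c y > 0"
proof -
  obtain W F where "cinv c y \<in> W" "orthonormal_frame A tangent_bundle g CARD('n) W F"
    using adapted_frame by metis
  from tan.frame_divergence_in_chart(1)[OF assms(1) cinv_in_cdom[OF assms] this(2,1) smooth_vf_on_zero]
  show *: "det (gram A g c (cinv c y)) > 0" using tan.orthonormal_frameD(1)[OF \<open>orthonormal_frame A tangent_bundle g CARD('n) W F\<close>] by blast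
  then show "tan.vol_density c y > 0" by (simp add: tan.vol_density_def)
qed

lemma smooth_vol_density: "c \<in> A \<Longrightarrow> smooth_on (crange c) (tan.vol_density c)"
  unfolding tan.vol_density_def[abs_def]
  by (intro smooth_on_sqrt tan.smooth_on_det_gram vol_density_pos open_crange)

text \<open>
  This is the product rule: the derivative of the density along \<open>X\<close>, known from the previous
  computation in a frame, completes the trace of \<open>dX\<close> to \<open>div_H X - gc (X, H_perp)\<close>.
\<close>

lemma divergence_in_chart:
  assumes c: "c \<in> A" "y \<in> crange c" and X: "X \<in> sections A H UNIV" and w: "smooth_fun_on A UNIV (w :: 'a \<Rightarrow> real)"
  shows "(\<Sum>i\<in>UNIV. frechet_derivative (\<lambda>y. (w (cinv c y) * tan.vol_density c y) *\<^sub>R rep c X y) (at y) (axis i 1) $ i) =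
    tan.vol_density c y * (w (cinv c y) * (div_H X (cinv c y) - gc (cinv c y) (X (cinv c y)) (H_perp (cinv c y))) +
      tdiff A w (cinv c y) (X (cinv c y)))"
proof -
  define p where "p = cinv c y"
  have p: "p \<in> cdom c" "cmap c p = y" using c by (auto simp: p_def cinv_in_cdom cmap_cinv)
  define \<delta> where "\<delta> = div_H X p - gc p (X p) (H_perp p)"
  define x where "x = rep c X y"
  define x' where "x' = frechet_derivative (rep c X) (at y)"
  define tr where "tr = (\<Sum>i\<in>UNIV. x' (axis i 1) $ i)"
  define dG where "dG = frechet_derivative (\<lambda>y. det (gram A g c (cinv c y))) (at y)"
  define w' where "w' = frechet_derivative (\<lambda>y. w (cinv c y)) (at y)"
  have smX: "smooth_vf_on A UNIV X" using X by (simp add: sections_def)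
  obtain W F where W: "p \<in> W" and F: "orthonormal_frame A tangent_bundle g CARD('n) W F"
    and \<delta>: "\<delta> = (\<Sum>a<CARD('n). g p (lie_bracket A (F a) X p) (F a p))"
    using adapted_frame[of p thesis] X unfolding \<delta>_def by blast
  have det_pos: "det (gram A g c p) > 0" using vol_density_pos[OF c] by (simp add: p_def)
  have "2 * det (gram A g c p) * \<delta> = 2 * det (gram A g c p) * tr + dG x"
    using tan.frame_divergence_in_chart(2)[OF c(1) p(1) F W smooth_vf_on_subset[OF smX]] p(2)
    unfolding \<delta> tr_def x'_def dG_def x_def by simp
  then have dGx: "dG x = 2 * det (gram A g c p) * (\<delta> - tr)" by (simp add: algebra_simps)
  have d1: "(rep c X has_derivative x') (at y)"
    unfolding x'_def by (rule smooth_on_has_derivative[OF smooth_vf_on_chart[OF smX c(1)]]) (use c in simp)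
  have d2: "((\<lambda>y. w (cinv c y)) has_derivative w') (at y)"
    unfolding w'_def by (rule smooth_on_has_derivative[OF smooth_fun_on_chart[OF w c(1)]]) (use c in simp)
  have d3: "(tan.vol_density c has_derivative (\<lambda>v. dG v / (2 * sqrt (det (gram A g c p))))) (at y)"
  proof -
    have 1: "((\<lambda>y. det (gram A g c (cinv c y))) has_derivative dG) (at y)"
      unfolding dG_def by (rule smooth_on_has_derivative[OF tan.smooth_on_det_gram[OF c(1)] c(2)])
    have "DERIV sqrt (det (gram A g c (cinv c y))) :> inverse (sqrt (det (gram A g c p))) / 2"
      using DERIV_real_sqrt[OF det_pos] unfolding p_def .
    from DERIV_compose_FDERIV[where f = sqrt and g = "\<lambda>y. det (gram A g c (cinv c y))", OF this 1]
    have "(tan.vol_density c has_derivative (\<lambda>v. dG v * (inverse (sqrt (det (gram A g c p))) / 2))) (at y)"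
      unfolding tan.vol_density_def[abs_def] .
    moreover have "(\<lambda>v. dG v * (inverse (sqrt (det (gram A g c p))) / 2)) =
        (\<lambda>v. dG v / (2 * sqrt (det (gram A g c p))))"
      by (simp only: divide_inverse inverse_mult_distrib mult_ac)
    ultimately show ?thesis by (simp only:)
  qed
  let ?\<rho> = "tan.vol_density c y"
  have rho: "?\<rho> = sqrt (det (gram A g c p))" by (simp add: tan.vol_density_def p_def)
  define s where "s = (\<lambda>v. w (cinv c y) * (dG v / (2 * sqrt (det (gram A g c p)))) + w' v * ?\<rho>)"
  have s: "s v = w p * (dG v / (2 * ?\<rho>)) + w' v * ?\<rho>" for v by (simp only: s_def rho p_def)
  have d4: "((\<lambda>y. w (cinv c y) * tan.vol_density c y) has_derivative s) (at y)"
    unfolding s_def by (rule has_derivative_mult[OF d2 d3])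
  have lin: "linear s" using d4 has_derivative_linear by blast
  have "frechet_derivative (\<lambda>y. (w (cinv c y) * tan.vol_density c y) *\<^sub>R rep c X y) (at y) =
      (\<lambda>v. (w p * ?\<rho>) *\<^sub>R x' v + s v *\<^sub>R x)"
    using frechet_derivative_eq[OF has_derivative_scaleR[OF d4 d1]] by (simp add: p_def x_def)
  then have "(\<Sum>i\<in>UNIV. frechet_derivative (\<lambda>y. (w (cinv c y) * tan.vol_density c y) *\<^sub>R rep c X y) (at y) (axis i 1) $ i) =
      w p * ?\<rho> * tr + (\<Sum>i\<in>UNIV. x $ i * s (axis i 1))"
    by (simp add: sum.distrib tr_def sum_distrib_left mult_ac)
  also have "(\<Sum>i\<in>UNIV. x $ i * s (axis i 1)) = s x"
  proof -
    have "s x = s (\<Sum>i\<in>UNIV. (x $ i) *\<^sub>R axis i 1)"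
      using basis_expansion[of x] by (simp add: scalar_mult_eq_scaleR)
    then show ?thesis by (simp add: linear_sum[OF lin] linear_cmul[OF lin])
  qed
  also have "s x = w p * (?\<rho> * (\<delta> - tr)) + w' x * ?\<rho>"
  proof -
    have "det (gram A g c p) = ?\<rho> * ?\<rho>" using det_pos by (simp add: rho)
    then have "dG x = (2 * ?\<rho>) * (?\<rho> * (\<delta> - tr))" by (simp only: dGx mult_ac)
    then have "dG x / (2 * ?\<rho>) = ?\<rho> * (\<delta> - tr)" using vol_density_pos(2)[OF c] by simp
    then show ?thesis by (simp add: s)
  qed
  also have "w' x = tdiff A w p (X p)"
    unfolding w'_def x_def p_def by (rule tdiff_rep[OF c open_UNIV UNIV_I w, symmetric])
  finally show ?thesis unfolding \<delta>_def p_def by (simp add: algebra_simps)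
qed

end


section \<open>Bump functions and partitions on the manifold\<close>

context smooth_manifold
begin

lemma smooth_extension_by_zero:
  fixes F :: "real ^ 'n \<Rightarrow> real"
  assumes c: "c \<in> A" and F: "smooth_on UNIV F" and C: "compact C" "C \<subseteq> crange c" "\<And>y. y \<notin> C \<Longrightarrow> F y = 0"
  defines "f \<equiv> (\<lambda>q. if q \<in> cdom c then F (cmap c q) else 0)" and "K \<equiv> cinv c ` C"
  shows "smooth_fun_on A UNIV f" "compact K" "K \<subseteq> cdom c" "\<And>q. q \<notin> K \<Longrightarrow> f q = 0"
proof -
  show K: "compact K"
    unfolding K_def using C continuous_on_subset[OF continuous_on_cinv[OF c]] by (intro compact_continuous_image)
  show "K \<subseteq> cdom c" unfolding K_def using C(2) c cinv_in_cdom by blast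
  show zero: "f q = 0" if "q \<notin> K" for q
  proof (cases "q \<in> cdom c")
    case True
    then have "cmap c q \<notin> C" using that c unfolding K_def by (metis cinv_cmap imageI)
    then show ?thesis using C(3) by (simp add: f_def)
  qed (simp add: f_def)
  show "smooth_fun_on A UNIV f"
  proof (rule smooth_fun_on_cover[OF open_UNIV])
    fix p
    show "\<exists>T. open T \<and> p \<in> T \<and> smooth_fun_on A T f"
    proof (cases "p \<in> cdom c")
      case True
      have "smooth_fun_on A (cdom c) f"
      proof (rule smooth_fun_on_locally[OF open_cdom[OF c]])
        fix q assume "q \<in> cdom c"
        moreover have "smooth_on (crange c) (\<lambda>y. f (cinv c y))"
          by (rule iffD1[OF smooth_on_cong[OF open_crange[OF c]] smooth_on_subset[OF F]])
            (use c in \<open>auto simp: f_def\<close>)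
        ultimately show "\<exists>d T. d \<in> A \<and> open T \<and> q \<in> T \<and> T \<subseteq> cdom d \<and> smooth_on (cmap d ` T) (\<lambda>y. f (cinv d y))"
          using c open_cdom[OF c] by blast
      qed
      then show ?thesis using True c open_cdom by blast
    next
      case False
      then have "p \<in> - K" using \<open>K \<subseteq> cdom c\<close> by blast
      moreover have "open (- K)" using compact_imp_closed[OF K] by auto
      moreover from this have "smooth_fun_on A (- K) f"
        by (rule smooth_fun_on_cong[OF _ _ smooth_fun_on_const[of _ 0]]) (use zero in auto)
      ultimately show ?thesis by blast
    qed
  qed
qed

lemma compact_support_vanishing:
  fixes f :: "'a \<Rightarrow> real"
  assumes "compact K" "\<And>q. q \<notin> K \<Longrightarrow> f q = 0"
  shows "compact (closure {q. f q \<noteq> 0})"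
proof -
  have "{q. f q \<noteq> 0} \<subseteq> K" using assms(2) by blast
  then have "closure {q. f q \<noteq> 0} \<subseteq> K" using compact_imp_closed[OF assms(1)] by (rule closure_minimal)
  then show ?thesis using assms(1) by (metis closed_closure compact_Int_closed inf.absorb_iff2)
qed

lemma manifold_bump_exists:
  assumes "open U" "p \<in> U"
  obtains c K and b :: "'a \<Rightarrow> real" where "c \<in> A" "p \<in> cdom c" "compact K" "K \<subseteq> cdom c \<inter> U"
    "smooth_fun_on A UNIV b" "\<And>q. b q \<ge> 0" "b p > 0" "\<And>q. q \<notin> K \<Longrightarrow> b q = 0"
proof -
  define c where "c = chart_at A p"
  have c: "c \<in> A" "p \<in> cdom c" by (auto simp: c_def)
  have "open (cmap c ` (cdom c \<inter> U))" using open_cmap_image[OF c(1) assms(1)] .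
  moreover have "cmap c p \<in> cmap c ` (cdom c \<inter> U)" using c assms by blast
  ultimately obtain r where r: "r > 0" "cball (cmap c p) r \<subseteq> cmap c ` (cdom c \<inter> U)"
    using open_contains_cball by blast
  obtain B where B: "smooth_on UNIV B" "\<And>y. B y \<ge> (0::real)" "\<And>y. B y > 0 \<longleftrightarrow> y \<in> ball (cmap c p) r"
    using smooth_bump_exists[OF r(1)] by blast
  have C: "cball (cmap c p) r \<subseteq> crange c" using r by blast
  have B0: "B y = 0" if "y \<notin> cball (cmap c p) r" for y
    using B(2)[of y] B(3)[of y] that by auto
  note ext = smooth_extension_by_zero[OF c(1) B(1) compact_cball C B0]
  have "cinv c ` cball (cmap c p) r \<subseteq> cdom c \<inter> U"
    using r(2) c(1) by (force simp: subset_iff)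
  moreover have "B (cmap c p) > 0" using B(3) r(1) by simp
  ultimately show thesis
    using ext c B(2) by (intro that[of c "cinv c ` cball (cmap c p) r" "\<lambda>q. if q \<in> cdom c then B (cmap c q) else 0"]) auto
qed

lemma compact_bump_cover:
  assumes "compact L"
  obtains I and b :: "'a \<Rightarrow> 'a \<Rightarrow> real" and K :: "'a \<Rightarrow> 'a set" and c where "finite I"
    "\<And>i. i \<in> I \<Longrightarrow> c i \<in> A \<and> compact (K i) \<and> K i \<subseteq> cdom (c i) \<and> smooth_fun_on A UNIV (b i) \<and> (\<forall>q. q \<notin> K i \<longrightarrow> b i q = 0)"
    "\<And>q. q \<in> L \<Longrightarrow> (\<Sum>i\<in>I. b i q) > 0"
proof -
  let ?bump = "\<lambda>p c K b. c \<in> A \<and> compact K \<and> K \<subseteq> cdom c \<and> smooth_fun_on A UNIV b \<and>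
    (\<forall>q. q \<notin> K \<longrightarrow> b q = 0) \<and> (\<forall>q. b q \<ge> 0) \<and> b p > (0::real)"
  have "\<exists>c K b. ?bump p c K b" for p
    by (rule manifold_bump_exists[OF open_UNIV UNIV_I, of p]) auto
  then obtain c K b where cKb: "\<And>p. ?bump p (c p) (K p) (b p)"
    by metis
  have cont: "continuous_on UNIV (b p)" for p using smooth_fun_on_continuous[OF open_UNIV] cKb by blast
  have "open {q. b p q > 0}" for p by (rule open_Collect_less[OF continuous_on_const cont])
  moreover have "L \<subseteq> (\<Union>p\<in>UNIV. {q. b p q > 0})" using cKb by blast
  ultimately obtain I where I: "finite I" "L \<subseteq> (\<Union>p\<in>I. {q. b p q > 0})"
    using compactE_image[OF assms, of UNIV "\<lambda>p. {q. b p q > 0}"] by auto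
  have "(\<Sum>i\<in>I. b i q) > 0" if q: "q \<in> L" for q
  proof -
    obtain i where "i \<in> I" "b i q > 0" using I(2) q by blast
    then show ?thesis using cKb I(1) by (intro sum_pos2[of I i]) auto
  qed
  then show thesis using that[OF I(1), of c K b] cKb by blast
qed

text \<open>Dividing a bump cover of the support of \<open>f\<close> by its sum cuts \<open>f\<close> into pieces living in charts.\<close>

lemma compact_support_decomposition:
  assumes f: "smooth_fun_on A UNIV f" and L: "compact L" "\<And>q. q \<notin> L \<Longrightarrow> f q = (0::real)"
  obtains I :: "'a set" and h :: "'a \<Rightarrow> 'a \<Rightarrow> real" and K :: "'a \<Rightarrow> 'a set" and c where "finite I"
    "\<And>i. i \<in> I \<Longrightarrow> c i \<in> A \<and> compact (K i) \<and> K i \<subseteq> cdom (c i) \<and> smooth_fun_on A UNIV (h i) \<and> (\<forall>q. q \<notin> K i \<longrightarrow> h i q = 0)"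
    "\<And>q. f q = (\<Sum>i\<in>I. h i q)"
proof -
  obtain I :: "'a set" and b :: "'a \<Rightarrow> 'a \<Rightarrow> real" and K c where I: "finite I"
    "\<And>i. i \<in> I \<Longrightarrow> c i \<in> A \<and> compact (K i) \<and> K i \<subseteq> cdom (c i) \<and> smooth_fun_on A UNIV (b i) \<and> (\<forall>q. q \<notin> K i \<longrightarrow> b i q = 0)"
    "\<And>q. q \<in> L \<Longrightarrow> (\<Sum>i\<in>I. b i q) > 0"
    by (rule compact_bump_cover[OF L(1)], rule that)
  define \<Phi> where "\<Phi> = (\<lambda>q. \<Sum>i\<in>I. b i q)"
  have s\<Phi>: "smooth_fun_on A UNIV \<Phi>" unfolding \<Phi>_def using I by (intro smooth_fun_on_sum) auto
  define h where "h = (\<lambda>i q. f q * (b i q * inverse (\<Phi> q)))"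
  have op: "open {q. \<Phi> q > 0}"
    by (rule open_Collect_less[OF continuous_on_const smooth_fun_on_continuous[OF open_UNIV s\<Phi>]])
  have "smooth_fun_on A UNIV (h i)" if i: "i \<in> I" for i
  proof (rule smooth_fun_on_cover[OF open_UNIV])
    fix p
    show "\<exists>T. open T \<and> p \<in> T \<and> smooth_fun_on A T (h i)"
    proof (cases "p \<in> L")
      case True
      have "smooth_fun_on A {q. \<Phi> q > 0} (h i)"
        unfolding h_def using smooth_fun_on_subset[OF f] smooth_fun_on_subset[OF s\<Phi>] I(2)[OF i] smooth_fun_on_subset[of UNIV "b i"]
        by (intro smooth_fun_on_mult smooth_fun_on_inverse op) auto
      then show ?thesis using op I(3)[OF True] by (auto simp: \<Phi>_def)
    next
      case False
      have opL: "open (- L)" using compact_imp_closed[OF L(1)] by auto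
      then have "smooth_fun_on A (- L) (h i)"
        by (rule smooth_fun_on_cong[OF _ _ smooth_fun_on_const[of _ 0]]) (use L(2) in \<open>auto simp: h_def\<close>)
      then show ?thesis using opL False by blast
    qed
  qed
  then have "\<And>i. i \<in> I \<Longrightarrow> c i \<in> A \<and> compact (K i) \<and> K i \<subseteq> cdom (c i) \<and> smooth_fun_on A UNIV (h i) \<and> (\<forall>q. q \<notin> K i \<longrightarrow> h i q = 0)"
    using I(2) by (simp add: h_def)
  moreover have "f q = (\<Sum>i\<in>I. h i q)" for q
  proof (cases "q \<in> L")
    case True
    have "(\<Sum>i\<in>I. h i q) = f q * (\<Phi> q * inverse (\<Phi> q))"
      by (simp add: h_def \<Phi>_def sum_distrib_left sum_distrib_right)
    then show ?thesis using I(3)[OF True] by (simp add: \<Phi>_def)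
  qed (use L(2) in \<open>simp add: h_def\<close>)
  ultimately show thesis using that[OF I(1)] by blast
qed

lemma tdiff_sum:
  assumes "open W" "p \<in> W" "\<And>i. i \<in> I \<Longrightarrow> smooth_fun_on A W (f i)"
  shows "tdiff A (\<lambda>q. \<Sum>i\<in>I. f i q) p v = (\<Sum>i\<in>I. tdiff A (f i) p v)"
  by (rule fun_cong[OF tdiff_eqI]) (intro has_derivative_sum tdiff_has_derivative[OF assms(1,2)] assms(3))

end


section \<open>The Riemannian measure\<close>

locale sub_riemannian_volume = sub_riemannian_splitting A k H V gc g D nabla
  for A :: "('a::{t2_space,second_countable_topology}, 'n::finite) atlas"
    and k H V gc g D nabla +
  fixes vol :: "'a measure"
  assumes vol: "riemannian_measure A g vol"
begin

lemma sets_vol [measurable_cong]: "sets vol = sets borel"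
  using vol by (simp add: riemannian_measure_def)

lemma smooth_measurable:
  fixes f :: "'a \<Rightarrow> real"
  assumes "smooth_fun_on A UNIV f"
  shows "f \<in> borel_measurable vol"
proof -
  have "f \<in> borel_measurable borel"
    by (rule borel_measurable_continuous_onI[OF smooth_fun_on_continuous[OF open_UNIV assms]])
  then show ?thesis by simp
qed

text \<open>
  The measure \<open>vol\<close>, restricted to the domain of \<open>c\<close>, is the image under \<open>cinv c\<close> of the measure
  on \<open>real ^ 'n\<close> with density \<open>vol_density c\<close>: the defining formula of the Riemannian measure says
  that they agree on Borel sets.
\<close>

lemma has_integral_in_chart:
  fixes h :: "'a \<Rightarrow> real"
  assumes c: "c \<in> A" and h: "h \<in> borel_measurable borel" "\<And>p. p \<notin> cdom c \<Longrightarrow> h p = 0"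
    and I: "has_bochner_integral lborel (\<lambda>y. if y \<in> crange c then tan.vol_density c y * h (cinv c y) else 0) I"
  shows "has_bochner_integral vol h I"
proof -
  \<comment> \<open>Outside the range of the chart, \<open>cinv c\<close> is extended by a constant and the density by \<open>0\<close>.\<close>
  define \<psi> where "\<psi> = (\<lambda>y. if y \<in> crange c then cinv c y else undefined)"
  define \<rho> where "\<rho> = (\<lambda>y. indicator (crange c) y *\<^sub>R tan.vol_density c y)"
  have \<psi>: "\<psi> \<in> borel_measurable borel"
  proof (rule borel_measurableI)
    fix S :: "'a set" assume S: "open S"
    have "\<psi> -` S \<inter> space borel = (crange c \<inter> cinv c -` S) \<union> (if undefined \<in> S then - crange c else {})"
      by (auto simp: \<psi>_def split: if_splits)
    moreover have "open (crange c \<inter> cinv c -` S)"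
      by (rule continuous_open_preimage[OF continuous_on_cinv[OF c] open_crange[OF c] S])
    ultimately show "\<psi> -` S \<inter> space borel \<in> sets borel" using open_crange[OF c] by simp
  qed
  have \<rho>: "\<rho> \<in> borel_measurable borel" "\<And>y. \<rho> y \<ge> 0"
  proof -
    show "\<rho> \<in> borel_measurable borel"
      unfolding \<rho>_def
      by (rule borel_measurable_continuous_on_indicator[OF borel_open[OF open_crange[OF c]]
            smooth_on_continuous[OF smooth_vol_density[OF c]]])
    show "\<rho> y \<ge> 0" for y
      using vol_density_pos(2)[OF c] by (auto simp: \<rho>_def indicator_def less_imp_le)
  qed
  have cdom: "cdom c \<in> sets borel" using c by simp
  have "distr (density lborel (\<lambda>y. ennreal (\<rho> y))) borel \<psi> = density vol (\<lambda>p. ennreal (indicator (cdom c) p))"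
    (is "?N = ?Q")
  proof (rule measure_eqI)
    show "sets ?N = sets ?Q" by (simp add: sets_vol)
    fix B assume "B \<in> sets ?N"
    then have B: "B \<in> sets borel" by simp
    have "emeasure ?N B = (\<integral>\<^sup>+ y. ennreal (\<rho> y) * indicator (\<psi> -` B) y \<partial>lborel)"
      using B \<psi> \<rho> measurable_sets[OF \<psi> B]
      by (subst emeasure_distr) (auto simp: emeasure_density)
    also have "\<dots> = (\<integral>\<^sup>+ y. ennreal (sqrt (det (gram A g c (cinv c y)))) * indicator (cmap c ` (B \<inter> cdom c)) y \<partial>lborel)"
    proof (rule nn_integral_cong)
      fix y
      have "y \<in> cmap c ` (B \<inter> cdom c) \<longleftrightarrow> y \<in> crange c \<and> cinv c y \<in> B"
      proof
        assume "y \<in> crange c \<and> cinv c y \<in> B"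
        then show "y \<in> cmap c ` (B \<inter> cdom c)"
          using c by (intro image_eqI[of y _ "cinv c y"]) (auto simp: cinv_in_cdom cmap_cinv)
      qed (use c in auto)
      then show "ennreal (\<rho> y) * indicator (\<psi> -` B) y =
          ennreal (sqrt (det (gram A g c (cinv c y)))) * indicator (cmap c ` (B \<inter> cdom c)) y"
        by (auto simp: \<rho>_def \<psi>_def tan.vol_density_def indicator_def)
    qed
    also have "\<dots> = emeasure vol (B \<inter> cdom c)"
    proof -
      have "B \<inter> cdom c \<in> sets borel" using B cdom by blast
      then show ?thesis using vol c unfolding riemannian_measure_def by simp
    qed
    also have "\<dots> = emeasure ?Q B"
    proof -
      have "emeasure ?Q B = (\<integral>\<^sup>+ p. ennreal (indicator (cdom c) p) * indicator B p \<partial>vol)"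
        using B cdom by (intro emeasure_density) (auto simp: sets_vol)
      also have "\<dots> = (\<integral>\<^sup>+ p. indicator (B \<inter> cdom c) p \<partial>vol)"
        by (intro nn_integral_cong) (auto simp: indicator_def)
      finally show ?thesis using B cdom by (simp add: sets_vol)
    qed
    finally show "emeasure ?N B = emeasure ?Q B" .
  qed
  moreover have "has_bochner_integral ?N h I"
  proof (rule has_bochner_integral_distr)
    have "h \<circ> \<psi> \<in> borel_measurable borel" using \<psi> h(1) by (rule measurable_comp)
    then have m: "(\<lambda>y. h (\<psi> y)) \<in> borel_measurable lborel" by (simp add: o_def)
    have "(\<lambda>y. if y \<in> crange c then tan.vol_density c y * h (cinv c y) else 0) = (\<lambda>y. \<rho> y *\<^sub>R h (\<psi> y))"
      by (auto simp: fun_eq_iff \<rho>_def \<psi>_def)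
    then show "has_bochner_integral (density lborel (\<lambda>y. ennreal (\<rho> y))) (\<lambda>y. h (\<psi> y)) I"
      using I m \<rho> by (intro has_bochner_integral_density) auto
  qed (use \<psi> h in auto)
  ultimately have Q: "has_bochner_integral ?Q h I" by simp
  have hv: "h \<in> borel_measurable vol" using h(1) by simp
  have iv: "indicator (cdom c) \<in> borel_measurable vol" using cdom by (simp add: sets_vol)
  have "(\<lambda>p. indicator (cdom c) p *\<^sub>R h p) = h" using h(2) by (auto simp: fun_eq_iff indicator_def)
  then show ?thesis
    using Q integrable_density[OF hv iv] integral_density[OF hv iv] by (simp add: has_bochner_integral_iff)
qed

lemma chart_integrand_continuous:
  fixes h :: "'a \<Rightarrow> real"
  assumes c: "c \<in> A" and h: "continuous_on UNIV h" and K: "compact K" "K \<subseteq> cdom c" "\<And>p. p \<notin> K \<Longrightarrow> h p = 0"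
  defines "G \<equiv> (\<lambda>y. if y \<in> crange c then tan.vol_density c y * h (cinv c y) else 0)"
  shows "compact (cmap c ` K)" "\<And>y. y \<notin> cmap c ` K \<Longrightarrow> G y = 0" "continuous_on UNIV G" "integrable lborel G"
proof -
  show C: "compact (cmap c ` K)"
    by (rule compact_continuous_image[OF continuous_on_subset[OF continuous_on_cmap[OF c] K(2)] K(1)])
  show zero: "G y = 0" if "y \<notin> cmap c ` K" for y
  proof (cases "y \<in> crange c")
    case True
    then have "cinv c y \<notin> K" using that c by (metis cmap_cinv imageI)
    then show ?thesis using K(3) by (simp add: G_def)
  qed (simp add: G_def)
  have "continuous_on (crange c) (\<lambda>y. tan.vol_density c y * h (cinv c y))"
    using c by (intro continuous_on_mult smooth_on_continuous[OF smooth_vol_density]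
        continuous_on_compose2[OF h continuous_on_cinv]) auto
  then have 1: "continuous_on (crange c) G" by (rule continuous_on_eq) (simp add: G_def)
  have 2: "continuous_on (- (cmap c ` K)) G"
    by (rule continuous_on_eq[OF continuous_on_const[of _ 0]]) (use zero in auto)
  have "crange c \<union> - (cmap c ` K) = UNIV" using K(2) by blast
  then show cont: "continuous_on UNIV G"
    using continuous_on_open_Un[OF open_crange[OF c] _ 1 2] compact_imp_closed[OF C] by auto
  show "integrable lborel G" by (rule continuous_compact_support_integrable[OF cont C zero])
qed

lemma chart_supported_integrable:
  fixes h :: "'a \<Rightarrow> real"
  assumes "c \<in> A" "continuous_on UNIV h" "compact K" "K \<subseteq> cdom c" "\<And>p. p \<notin> K \<Longrightarrow> h p = 0"
  shows "integrable vol h"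
proof -
  have "has_bochner_integral vol h (integral\<^sup>L lborel (\<lambda>y. if y \<in> crange c then tan.vol_density c y * h (cinv c y) else 0))"
    by (rule has_integral_in_chart[OF assms(1) borel_measurable_continuous_onI[OF assms(2)] _
          has_bochner_integral_integrable[OF chart_integrand_continuous(4)[OF assms]]])
      (use assms in auto)
  then show ?thesis by (rule integrable.intros)
qed

text \<open>
  A bump cover of the support has a sum that dominates \<open>h\<close> up to a constant, and each bump is
  integrable because it lives in a chart.
\<close>

lemma compact_support_integrable:
  fixes h :: "'a \<Rightarrow> real"
  assumes h: "continuous_on UNIV h" and L: "compact L" "\<And>p. p \<notin> L \<Longrightarrow> h p = 0"
  shows "integrable vol h"
proof -
  obtain I :: "'a set" and b :: "'a \<Rightarrow> 'a \<Rightarrow> real" and K c where I: "finite I"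
    "\<And>i. i \<in> I \<Longrightarrow> c i \<in> A \<and> compact (K i) \<and> K i \<subseteq> cdom (c i) \<and> smooth_fun_on A UNIV (b i) \<and> (\<forall>q. q \<notin> K i \<longrightarrow> b i q = 0)"
    "\<And>q. q \<in> L \<Longrightarrow> (\<Sum>i\<in>I. b i q) > 0"
    by (rule compact_bump_cover[OF L(1)], rule that)
  define \<Phi> where "\<Phi> = (\<lambda>q. \<Sum>i\<in>I. b i q)"
  have cont: "continuous_on UNIV (b i)" if "i \<in> I" for i
    using smooth_fun_on_continuous[OF open_UNIV] I(2)[OF that] by blast
  have c\<Phi>: "continuous_on UNIV \<Phi>" unfolding \<Phi>_def using cont by (intro continuous_on_sum) auto
  have "integrable vol (b i)" if "i \<in> I" for i
    using I(2)[OF that] cont[OF that] by (intro chart_supported_integrable[of "c i" _ "K i"]) auto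
  then have int\<Phi>: "integrable vol \<Phi>" unfolding \<Phi>_def by (intro Bochner_Integration.integrable_sum)
  have "\<exists>B. \<forall>q\<in>L. \<bar>h q / \<Phi> q\<bar> \<le> B"
  proof -
    have "continuous_on L (\<lambda>q. h q / \<Phi> q)"
      using continuous_on_subset[OF h] continuous_on_subset[OF c\<Phi>] I(3)
      by (intro continuous_on_divide) (auto simp: \<Phi>_def less_imp_neq[THEN not_sym])
    then have "bounded ((\<lambda>q. h q / \<Phi> q) ` L)"
      using compact_continuous_image[OF _ L(1)] compact_imp_bounded by blast
    then show ?thesis by (auto simp: bounded_iff)
  qed
  then obtain B where B: "\<And>q. q \<in> L \<Longrightarrow> \<bar>h q / \<Phi> q\<bar> \<le> B" by blast
  show ?thesis
  proof (rule Bochner_Integration.integrable_bound)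
    show "integrable vol (\<lambda>q. B * \<Phi> q)" using int\<Phi> by (rule integrable_mult_right)
    show "h \<in> borel_measurable vol" using borel_measurable_continuous_onI[OF h] by simp
    have "norm (h q) \<le> norm (B * \<Phi> q)" for q
    proof (cases "q \<in> L")
      case True
      have pos: "\<Phi> q > 0" using I(3)[OF True] by (simp add: \<Phi>_def)
      have "\<bar>h q\<bar> = \<bar>h q / \<Phi> q\<bar> * \<Phi> q" using pos by (simp add: abs_mult)
      also have "\<dots> \<le> B * \<Phi> q" using B[OF True] pos by (intro mult_right_mono) auto
      finally show ?thesis by simp
    qed (use L(2) in simp)
    then show "AE q in vol. norm (h q) \<le> norm (B * \<Phi> q)" by simp
  qed
qed

text \<open>A nonempty open set in a chart is not null, since the density is positive.\<close>

lemma nonneg_integral_zero: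
  fixes h :: "'a \<Rightarrow> real"
  assumes c: "c \<in> A" and h: "continuous_on UNIV h" and K: "compact K" "K \<subseteq> cdom c" "\<And>p. p \<notin> K \<Longrightarrow> h p = 0"
    and nonneg: "\<And>p. h p \<ge> 0" and zero: "integral\<^sup>L vol h = 0"
  shows "h p = 0"
proof (rule ccontr)
  assume p: "h p \<noteq> 0"
  define G where "G = (\<lambda>y. if y \<in> crange c then tan.vol_density c y * h (cinv c y) else 0)"
  note G = chart_integrand_continuous[OF c h K, folded G_def]
  have "has_bochner_integral vol h (integral\<^sup>L lborel G)"
    using K by (intro has_integral_in_chart[OF c] borel_measurable_continuous_onI[OF h])
      (use G(4) in \<open>auto simp: G_def has_bochner_integral_integrable\<close>)
  then have "integral\<^sup>L lborel G = 0" using zero by (simp add: has_bochner_integral_integral_eq)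
  moreover have "G y \<ge> 0" for y
    using nonneg vol_density_pos(2)[OF c] by (auto simp: G_def less_imp_le)
  ultimately have AE: "AE y in lborel. G y = 0" using integral_nonneg_eq_0_iff_AE[OF G(4)] by simp
  define S where "S = {y. G y \<noteq> 0}"
  have S: "open S" unfolding S_def
    using open_Collect_neq[OF G(3) continuous_on_const] by simp
  have "p \<in> cdom c" using p K by blast
  then have "cmap c p \<in> S"
    using p c vol_density_pos(2)[OF c, of "cmap c p"] by (auto simp: S_def G_def)
  moreover have "S \<in> null_sets lborel"
    using AE S by (simp add: AE_iff_null_sets S_def)
  then have "negligible S" using null_sets_completionI negligible_iff_null_sets by blast
  ultimately show False using open_not_negligible[OF S] by blast
qed


section \<open>Integration by parts\<close>

text \<open>
  The mean curvature is built from frames chosen point by point; that its product with a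
  horizontal field is smooth follows from the formula for the divergence in a chart, with \<open>w = 1\<close>.
\<close>

lemma smooth_divergence:
  assumes X: "X \<in> sections A H UNIV"
  shows "smooth_fun_on A UNIV (\<lambda>p. div_H X p - gc p (X p) (H_perp p))"
proof (rule smooth_fun_on_locally[OF open_UNIV])
  fix p
  define c where "c = chart_at A p"
  have c: "c \<in> A" "p \<in> cdom c" by (auto simp: c_def)
  let ?Z = "\<lambda>y. tan.vol_density c y *\<^sub>R rep c X y"
  have smX: "smooth_on (crange c) (rep c X)"
    using smooth_vf_on_chart[OF sections_smooth[OF X] c(1)] by simp
  have "smooth_on (crange c) ?Z"
    using c by (intro smooth_on_scaleR smooth_vol_density smX) auto
  then have "smooth_on (crange c) (\<lambda>y. (\<Sum>i\<in>UNIV. frechet_derivative ?Z (at y) (axis i 1) $ i) / tan.vol_density c y)"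
    using c vol_density_pos(2)[OF c(1)]
    by (intro smooth_on_divide smooth_on_sum smooth_on_vec_nth smooth_on_frechet_derivative smooth_vol_density)
      (auto simp: less_imp_neq[THEN not_sym])
  moreover have "(\<Sum>i\<in>UNIV. frechet_derivative ?Z (at y) (axis i 1) $ i) / tan.vol_density c y =
      div_H X (cinv c y) - gc (cinv c y) (X (cinv c y)) (H_perp (cinv c y))" if y: "y \<in> crange c" for y
    using divergence_in_chart[OF c(1) y X smooth_fun_on_const[of UNIV "1::real"]] vol_density_pos(2)[OF c(1) y]
    by (simp add: field_simps)
  ultimately have "smooth_on (crange c) (\<lambda>y. div_H X (cinv c y) - gc (cinv c y) (X (cinv c y)) (H_perp (cinv c y)))"
    by (rule iffD1[OF smooth_on_cong[OF open_crange[OF c(1)]], rotated])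
  then show "\<exists>c T. c \<in> A \<and> open T \<and> p \<in> T \<and> T \<subseteq> cdom c \<and>
      smooth_on (cmap c ` T) (\<lambda>y. div_H X (cinv c y) - gc (cinv c y) (X (cinv c y)) (H_perp (cinv c y)))"
    using c open_cdom by blast
qed

text \<open>
  In the chart, the integrand times the volume density is the Euclidean divergence of the compactly
  supported field \<open>Z\<close>.
\<close>

lemma divergence_theorem_in_chart:
  assumes c: "c \<in> A" and X: "X \<in> sections A H UNIV" and w: "smooth_fun_on A UNIV (w :: 'a \<Rightarrow> real)"
    and K: "compact K" "K \<subseteq> cdom c" "\<And>p. p \<notin> K \<Longrightarrow> w p = 0"
  shows "has_bochner_integral vol (\<lambda>p. w p * (div_H X p - gc p (X p) (H_perp p)) + tdiff A w p (X p)) 0"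
proof -
  define h where "h = (\<lambda>p. w p * (div_H X p - gc p (X p) (H_perp p)) + tdiff A w p (X p))"
  have sm: "smooth_fun_on A UNIV h"
    unfolding h_def using w smooth_divergence[OF X] sections_smooth[OF X]
    by (intro smooth_fun_on_add smooth_fun_on_mult smooth_fun_on_tdiff) auto
  have opK: "open (- K)" using compact_imp_closed[OF K(1)] by auto
  have h0: "h p = 0" if "p \<notin> K" for p
    using tdiff_cong[OF opK, of p w "\<lambda>_. 0"] that K(3) by (simp add: h_def)
  define Z where "Z = (\<lambda>y. if y \<in> crange c then (w (cinv c y) * tan.vol_density c y) *\<^sub>R rep c X y else 0)"
  let ?C = "cmap c ` K"
  have C: "compact ?C"
    by (rule compact_continuous_image[OF continuous_on_subset[OF continuous_on_cmap[OF c] K(2)] K(1)])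
  have opC: "open (- ?C)" using compact_imp_closed[OF C] by auto
  have Z0: "Z y = 0" if "y \<notin> ?C" for y
  proof (cases "y \<in> crange c")
    case True
    then have "cinv c y \<notin> K" using that c by (metis cmap_cinv imageI)
    then show ?thesis using K(3) by (simp add: Z_def)
  qed (simp add: Z_def)
  have smZ: "smooth_on UNIV Z"
  proof (rule smooth_on_locally)
    fix y
    show "\<exists>T. open T \<and> y \<in> T \<and> smooth_on T Z"
    proof (cases "y \<in> crange c")
      case True
      have "smooth_on (crange c) (\<lambda>y. (w (cinv c y) * tan.vol_density c y) *\<^sub>R rep c X y)"
        using smooth_fun_on_chart[OF w c] smooth_vf_on_chart[OF sections_smooth[OF X] c] c
        by (intro smooth_on_scaleR smooth_on_mult smooth_vol_density) auto
      then have "smooth_on (crange c) Z"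
        by (rule iffD1[OF smooth_on_cong[OF open_crange[OF c]], rotated]) (simp add: Z_def)
      then show ?thesis using True open_crange[OF c] by blast
    next
      case False
      then have "y \<in> - ?C" using K(2) by blast
      moreover have "smooth_on (- ?C) Z"
        by (rule iffD1[OF smooth_on_cong[OF opC] smooth_on_const[of _ 0]]) (use Z0 in auto)
      ultimately show ?thesis using opC by blast
    qed
  qed
  have "(\<Sum>i\<in>UNIV. frechet_derivative Z (at y) (axis i 1) $ i) =
      (if y \<in> crange c then tan.vol_density c y * h (cinv c y) else 0)" for y
  proof (cases "y \<in> crange c")
    case True
    have "frechet_derivative Z (at y) =
        frechet_derivative (\<lambda>y. (w (cinv c y) * tan.vol_density c y) *\<^sub>R rep c X y) (at y)"
      by (rule frechet_derivative_cong_open[OF open_crange[OF c] True]) (simp add: Z_def)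
    then show ?thesis using divergence_in_chart[OF c True X w] True by (simp add: h_def)
  next
    case False
    then have "y \<in> - ?C" using K(2) by blast
    then have "frechet_derivative Z (at y) = frechet_derivative (\<lambda>_. 0) (at y)"
      by (rule frechet_derivative_cong_open[OF opC]) (use Z0 in auto)
    then show ?thesis using False by simp
  qed
  then have "has_bochner_integral lborel (\<lambda>y. if y \<in> crange c then tan.vol_density c y * h (cinv c y) else 0) 0"
    using integral_divergence[OF smZ C Z0] by simp
  then have "has_bochner_integral vol h 0"
    using h0 K(2) by (intro has_integral_in_chart[OF c]
        borel_measurable_continuous_onI[OF smooth_fun_on_continuous[OF open_UNIV sm]]) auto
  then show ?thesis by (simp add: h_def)
qed

text \<open>
  The integrand is the Riemannian divergence of \<open>w X\<close>; it depends linearly on \<open>w\<close>, which can be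
  decomposed into pieces supported in charts.
\<close>

lemma divergence_theorem:
  assumes X: "X \<in> sections A H UNIV" and w: "smooth_fun_on A UNIV (w :: 'a \<Rightarrow> real)"
    and L: "compact L" "\<And>p. p \<notin> L \<Longrightarrow> w p = 0"
  shows "has_bochner_integral vol (\<lambda>p. w p * (div_H X p - gc p (X p) (H_perp p)) + tdiff A w p (X p)) 0"
proof -
  obtain I :: "'a set" and h :: "'a \<Rightarrow> 'a \<Rightarrow> real" and K c where I: "finite I"
    "\<And>i. i \<in> I \<Longrightarrow> c i \<in> A \<and> compact (K i) \<and> K i \<subseteq> cdom (c i) \<and> smooth_fun_on A UNIV (h i) \<and> (\<forall>q. q \<notin> K i \<longrightarrow> h i q = 0)"
    and wh: "\<And>q. w q = (\<Sum>i\<in>I. h i q)"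
  proof (rule compact_support_decomposition[OF w L])
    fix I h K c
    assume "finite (I :: 'a set)"
      "\<And>i. i \<in> I \<Longrightarrow> c i \<in> A \<and> compact (K i) \<and> K i \<subseteq> cdom (c i) \<and> smooth_fun_on A UNIV (h i) \<and> (\<forall>q. q \<notin> K i \<longrightarrow> h i q = 0)"
      "\<And>q. w q = (\<Sum>i\<in>I. h i q)"
    then show thesis by (rule that)
  qed
  have "has_bochner_integral vol (\<lambda>p. h i p * (div_H X p - gc p (X p) (H_perp p)) + tdiff A (h i) p (X p)) 0"
    if "i \<in> I" for i
    using I(2)[OF that] by (intro divergence_theorem_in_chart[of "c i" X "h i" "K i"] X) auto
  then have "has_bochner_integral vol (\<lambda>p. \<Sum>i\<in>I. h i p * (div_H X p - gc p (X p) (H_perp p)) + tdiff A (h i) p (X p)) (\<Sum>i\<in>I. 0)"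
    by (intro has_bochner_integral_sum)
  moreover have "tdiff A w p (X p) = (\<Sum>i\<in>I. tdiff A (h i) p (X p))" for p
  proof -
    have "w = (\<lambda>q. \<Sum>i\<in>I. h i q)" using wh by blast
    then show ?thesis using tdiff_sum[OF open_UNIV UNIV_I, of I h p "X p"] I(2) by simp
  qed
  ultimately show ?thesis by (simp add: wh sum.distrib sum_distrib_right)
qed

end


section \<open>Test functions and the characterization\<close>

context sub_riemannian_volume
begin

abbreviation grad_H :: "('a \<Rightarrow> real) \<Rightarrow> 'a \<Rightarrow> real ^ 'n" where
  "grad_H \<equiv> hgrad A H gc"

lemma grad_H_section: "smooth_fun_on A UNIV f \<Longrightarrow> grad_H f \<in> sections A H UNIV"
  and gc_grad_H: "smooth_fun_on A UNIV f \<Longrightarrow> v \<in> H p \<Longrightarrow> gc p (grad_H f p) v = tdiff A f p v"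
  using hor.hgrad_characterization[OF horizontal_distribution] by blast+

lemma grad_H_in: "smooth_fun_on A UNIV f \<Longrightarrow> grad_H f p \<in> H p"
  using sections_in[OF grad_H_section] by simp

lemma connection_D: "connection A H D"
  using horizontal by (simp add: horizontal_connection_def metric_connection_def)

text \<open>What is left over when integrating by parts against the measure with density \<open>u\<close>.\<close>

definition defect :: "('a \<Rightarrow> real) \<Rightarrow> ('a \<Rightarrow> real) \<Rightarrow> 'a \<Rightarrow> real" where
  "defect u e p = u p * gc p (grad_H e p) (grad_H (\<lambda>p. ln (u p)) p - H_perp p)"

context
  fixes u :: "'a \<Rightarrow> real" and mu :: "'a measure"
  assumes u: "smooth_fun_on A UNIV u" and u_pos: "\<And>p. u p > 0"
    and mu: "mu = density vol (\<lambda>p. ennreal (u p))"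
begin

lemma smooth_ln_u: "smooth_fun_on A UNIV (\<lambda>p. ln (u p))"
  using u u_pos by (intro smooth_fun_on_ln) auto

lemma integral_mu:
  assumes "smooth_fun_on A UNIV h"
  shows "integral\<^sup>L mu h = (\<integral>p. u p * h p \<partial>vol)"
  unfolding mu
  using integral_density[OF smooth_measurable[OF assms] smooth_measurable[OF u]] u_pos
  by (simp add: less_imp_le)

text \<open>
  The factor \<open>u\<close> turns the gradient of \<open>ln u\<close> into the derivative of \<open>u\<close>; in this form the defect
  is visibly smooth.
\<close>

lemma defect_eq:
  assumes e: "smooth_fun_on A UNIV e"
  shows "defect u e p = u p * (div_H (grad_H e) p - gc p (grad_H e p) (H_perp p)) + tdiff A u p (grad_H e p) -
    u p * div_H (grad_H e) p"
proof -
  note in_H = grad_H_in[OF e, of p] grad_H_in[OF smooth_ln_u, of p] mean_curvature_horizontal[of p]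
  have diff: "gc p (grad_H e p) (grad_H (\<lambda>p. ln (u p)) p - H_perp p) =
      gc p (grad_H (\<lambda>p. ln (u p)) p) (grad_H e p) - gc p (grad_H e p) (H_perp p)"
  proof -
    have d: "grad_H (\<lambda>p. ln (u p)) p - H_perp p \<in> H p"
      using in_H subspace_diff[OF hor.fibre_subspace] by blast
    show ?thesis
      using hor.metric_sym[OF in_H(1) d] hor.metric_diff_left[OF in_H(2,3,1)] hor.metric_sym[OF in_H(3,1)] by simp
  qed
  have "u p * gc p (grad_H (\<lambda>p. ln (u p)) p) (grad_H e p) = tdiff A u p (grad_H e p)"
    using gc_grad_H[OF smooth_ln_u in_H(1)] tdiff_ln[OF open_UNIV UNIV_I u u_pos] u_pos[of p] by simp
  then show ?thesis unfolding defect_def diff by (simp add: right_diff_distrib)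
qed

lemma smooth_defect:
  assumes "smooth_fun_on A UNIV e"
  shows "smooth_fun_on A UNIV (defect u e)"
proof -
  let ?X = "grad_H e"
  note X = grad_H_section[OF assms]
  have "smooth_fun_on A UNIV (\<lambda>p. u p * (div_H ?X p - gc p (?X p) (H_perp p)) + tdiff A u p (?X p) - u p * div_H ?X p)"
    by (rule smooth_fun_on_diff[OF open_UNIV
          smooth_fun_on_add[OF open_UNIV smooth_fun_on_mult[OF open_UNIV u smooth_divergence[OF X]]
            smooth_fun_on_tdiff[OF open_UNIV u sections_smooth[OF X]]]
          smooth_fun_on_mult[OF open_UNIV u hor.smooth_hdiv[OF connection_D horizontal_distribution X]]])
  then show ?thesis using defect_eq[OF assms] by presburger
qed

text \<open>
  The divergence theorem for the field \<open>grad_H e\<close> and the function \<open>f u\<close>, expanded by the product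
  rule into three separately integrable terms.
\<close>

lemma integration_by_parts:
  assumes e: "smooth_fun_on A UNIV e" and f: "smooth_fun_on A UNIV f" "compact (closure {p. f p \<noteq> 0})"
  shows "(\<integral>p. hlap A k H gc D e p * f p \<partial>mu) + (\<integral>p. gc p (grad_H e p) (grad_H f p) \<partial>mu) +
    (\<integral>p. f p * defect u e p \<partial>vol) = 0"
proof -
  define X where "X = grad_H e"
  define L where "L = closure {p. f p \<noteq> 0}"
  have X: "X \<in> sections A H UNIV" unfolding X_def by (rule grad_H_section[OF e])
  have Xp: "X p \<in> H p" for p unfolding X_def by (rule grad_H_in[OF e])
  have L: "compact L" "open (- L)" using f(2) by (auto simp: L_def)
  have f0: "f p = 0" if "p \<notin> L" for p using that closure_subset[of "{p. f p \<noteq> 0}"] unfolding L_def by auto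
  have df0: "tdiff A f p v = 0" if "p \<notin> L" for p v
    using tdiff_cong[OF L(2), of p f "\<lambda>_. 0"] f0 that by simp
  have sm_div: "smooth_fun_on A UNIV (div_H X)"
    by (rule hor.smooth_hdiv[OF connection_D horizontal_distribution X])
  have sm_df: "smooth_fun_on A UNIV (\<lambda>p. tdiff A f p (X p))"
    by (rule smooth_fun_on_tdiff[OF open_UNIV f(1) sections_smooth[OF X]])
  have grad_ef: "gc p (X p) (grad_H f p) = tdiff A f p (X p)" for p
    using hor.metric_sym[OF Xp grad_H_in[OF f(1)]] gc_grad_H[OF f(1) Xp] by simp
  have lap: "hlap A k H gc D e = div_H X" by (simp add: hlap_def X_def)
  have int1: "integrable vol (\<lambda>p. u p * (div_H X p * f p))"
    by (rule compact_support_integrable[OF smooth_fun_on_continuous[OF open_UNIV] L(1)])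
      (use u sm_div f(1) f0 in \<open>auto intro!: smooth_fun_on_mult\<close>)
  have int2: "integrable vol (\<lambda>p. u p * tdiff A f p (X p))"
    by (rule compact_support_integrable[OF smooth_fun_on_continuous[OF open_UNIV] L(1)])
      (use u sm_df df0 in \<open>auto intro!: smooth_fun_on_mult\<close>)
  have int3: "integrable vol (\<lambda>p. f p * defect u e p)"
    by (rule compact_support_integrable[OF smooth_fun_on_continuous[OF open_UNIV] L(1)])
      (use smooth_defect[OF e] f(1) f0 in \<open>auto intro!: smooth_fun_on_mult\<close>)
  have "has_bochner_integral vol (\<lambda>p. f p * u p * (div_H X p - gc p (X p) (H_perp p)) + tdiff A (\<lambda>p. f p * u p) p (X p)) 0"
    by (rule divergence_theorem[OF X smooth_fun_on_mult[OF open_UNIV f(1) u] L(1)]) (simp add: f0)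
  moreover have "f p * u p * (div_H X p - gc p (X p) (H_perp p)) + tdiff A (\<lambda>p. f p * u p) p (X p) =
      u p * (div_H X p * f p) + u p * tdiff A f p (X p) + f p * defect u e p" for p
    unfolding defect_eq[OF e] tdiff_mult[OF open_UNIV UNIV_I f(1) u] X_def by (simp add: algebra_simps)
  ultimately have "integral\<^sup>L vol (\<lambda>p. u p * (div_H X p * f p) + u p * tdiff A f p (X p) + f p * defect u e p) = 0"
    by (simp add: has_bochner_integral_integral_eq)
  then have "(\<integral>p. u p * (div_H X p * f p) \<partial>vol) + (\<integral>p. u p * tdiff A f p (X p) \<partial>vol) + (\<integral>p. f p * defect u e p \<partial>vol) = 0"
    using int1 int2 int3 by simp
  moreover have "(\<integral>p. hlap A k H gc D e p * f p \<partial>mu) = (\<integral>p. u p * (div_H X p * f p) \<partial>vol)"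
    unfolding lap by (rule integral_mu[OF smooth_fun_on_mult[OF open_UNIV sm_div f(1)]])
  moreover have "(\<integral>p. gc p (grad_H e p) (grad_H f p) \<partial>mu) = (\<integral>p. u p * tdiff A f p (X p) \<partial>vol)"
    unfolding X_def[symmetric] grad_ef by (rule integral_mu[OF sm_df])
  ultimately show ?thesis by simp
qed

text \<open>A test function with prescribed positive derivative: a linear function of the chart times a bump.\<close>

lemma test_function_exists:
  assumes "v \<noteq> 0"
  obtains e where "e \<in> smooth_compact_support A" "tdiff A e p v > 0"
proof -
  define c where "c = chart_at A p"
  have c: "c \<in> A" "p \<in> cdom c" by (auto simp: c_def)
  define y where "y = cmap c p"
  have "y \<in> crange c" using c by (auto simp: y_def)
  then obtain r where r: "r > 0" "cball y r \<subseteq> crange c"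
    using open_contains_cball[of "crange c"] open_crange[OF c(1)] by blast
  obtain B where B: "smooth_on UNIV B" "\<And>z. B z \<ge> (0::real)" "\<And>z. B z > 0 \<longleftrightarrow> z \<in> ball y r"
    using smooth_bump_exists[OF r(1)] by blast
  define F where "F = (\<lambda>z. B z * ((z - y) \<bullet> v))"
  have sF: "smooth_on UNIV F"
    unfolding F_def using B(1) by (intro smooth_on_mult smooth_on_inner smooth_on_diff) auto
  have F0: "F z = 0" if "z \<notin> cball y r" for z
    using B(2)[of z] B(3)[of z] that by (auto simp: F_def)
  define e where "e = (\<lambda>q. if q \<in> cdom c then F (cmap c q) else 0)"
  have ext: "smooth_fun_on A UNIV e" "compact (cinv c ` cball y r)" "\<And>q. q \<notin> cinv c ` cball y r \<Longrightarrow> e q = 0"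
    unfolding e_def using smooth_extension_by_zero[OF c(1) sF compact_cball r(2)] F0 by blast+
  have "e \<in> smooth_compact_support A"
    using ext(1) compact_support_vanishing[OF ext(2,3)] by (simp add: smooth_compact_support_def)
  moreover have "tdiff A e p v > 0"
  proof -
    have "tdiff A e p v = frechet_derivative (\<lambda>z. e (cinv c z)) (at y) v"
      using tdiff_chart[OF c open_UNIV UNIV_I ext(1), of v] by (simp add: y_def c_def)
    also have "frechet_derivative (\<lambda>z. e (cinv c z)) (at y) = frechet_derivative F (at y)"
      by (rule frechet_derivative_cong_open[OF open_crange[OF c(1)] \<open>y \<in> crange c\<close>])
        (use c(1) in \<open>auto simp: e_def\<close>)
    also have "frechet_derivative F (at y) = (\<lambda>h. B y * (h \<bullet> v) + frechet_derivative B (at y) h * ((y - y) \<bullet> v))"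
      unfolding F_def
      by (rule frechet_derivative_eq, intro has_derivative_mult has_derivative_inner_left
          smooth_on_has_derivative[OF B(1) UNIV_I]) (auto intro!: derivative_eq_intros)
    finally have "tdiff A e p v = B y * (v \<bullet> v)" by simp
    then show ?thesis using B(3)[of y] r(1) assms by simp
  qed
  ultimately show thesis by (rule that)
qed

text \<open>
  If the vector \<open>v\<close> below is nonzero, a test function \<open>e\<close> increasing in the direction \<open>v\<close> has
  positive defect at \<open>p\<close>, hence near \<open>p\<close>, and a bump function supported there detects it.
\<close>

lemma mean_curvature_gradient_if_defect_null:
  assumes null: "\<And>e f. e \<in> smooth_compact_support A \<Longrightarrow> f \<in> smooth_compact_support A \<Longrightarrow>
      (\<integral>p. f p * defect u e p \<partial>vol) = 0"
  shows "grad_H (\<lambda>p. ln (u p)) = H_perp"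
proof (rule ext, rule ccontr)
  fix p
  define v where "v = grad_H (\<lambda>p. ln (u p)) p - H_perp p"
  assume "grad_H (\<lambda>p. ln (u p)) p \<noteq> H_perp p"
  then have "v \<noteq> 0" by (simp add: v_def)
  then obtain e where e: "e \<in> smooth_compact_support A" "tdiff A e p v > 0"
    by (rule test_function_exists)
  have se: "smooth_fun_on A UNIV e" using e(1) by (simp add: smooth_compact_support_def)
  have "v \<in> H p"
    unfolding v_def using grad_H_in[OF smooth_ln_u] mean_curvature_horizontal
    by (intro subspace_diff[OF hor.fibre_subspace])
  then have pos: "defect u e p > 0"
    using e(2) u_pos[of p] gc_grad_H[OF se] by (simp add: defect_def v_def)
  have cont: "continuous_on UNIV (defect u e)"
    by (rule smooth_fun_on_continuous[OF open_UNIV smooth_defect[OF se]])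
  have op: "open {q. defect u e q > 0}" by (rule open_Collect_less[OF continuous_on_const cont])
  have "p \<in> {q. defect u e q > 0}" using pos by simp
  then obtain c K b where b: "c \<in> A" "p \<in> cdom c" "compact K" "K \<subseteq> cdom c \<inter> {q. defect u e q > 0}"
    "smooth_fun_on A UNIV b" "\<And>q. b q \<ge> (0::real)" "b p > 0" "\<And>q. q \<notin> K \<Longrightarrow> b q = 0"
    by (rule manifold_bump_exists[OF op]) (rule that)
  have "b \<in> smooth_compact_support A"
    using b(5) compact_support_vanishing[OF b(3,8)] by (simp add: smooth_compact_support_def)
  then have zero: "(\<integral>p. b p * defect u e p \<partial>vol) = 0" by (rule null[OF e(1)])
  have nonneg: "b q * defect u e q \<ge> 0" for q
  proof (cases "q \<in> K")
    case True
    then have "defect u e q > 0" using b(4) by blast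
    then show ?thesis using b(6)[of q] by simp
  qed (simp add: b(8))
  have "continuous_on UNIV (\<lambda>q. b q * defect u e q)"
    by (intro continuous_on_mult smooth_fun_on_continuous[OF open_UNIV b(5)] cont)
  then have "b p * defect u e p = 0"
    by (rule nonneg_integral_zero[OF b(1) _ b(3) _ _ nonneg zero]) (use b(4) b(8) in auto)
  then show False using b(7) pos by simp
qed

end

end

theorem theorem1p2:
  fixes A :: "('a::{t2_space,second_countable_topology}, 'n::finite) atlas"
    and k :: nat
    and H V :: "('a, 'n) distribution"
    and gc g :: "('a, 'n) fibre_form"
    and D nabla :: "('a, 'n) conn"
    and vol mu :: "'a measure"
    and u :: "'a \<Rightarrow> real"
  assumes "sub_riemannian A k H gc"
    and "splitting A k H V"
    and "orthogonal_extension A H V gc g"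
    and "horizontal_connection A H V gc D"
    and "levi_civita A g nabla"
    and "riemannian_measure A g vol"
    and "smooth_fun_on A UNIV u" and "\<And>p. u p > 0"
    and "mu = density vol (\<lambda>p. ennreal (u p))"
  shows "(\<forall>e\<in>smooth_compact_support A. \<forall>f\<in>smooth_compact_support A.
            - (\<integral>p. hlap A k H gc D e p * f p \<partial>mu) =
              (\<integral>p. gc p (hgrad A H gc e p) (hgrad A H gc f p) \<partial>mu))
         \<longleftrightarrow> hgrad A H gc (\<lambda>p. ln (u p)) = mean_curvature A k H V g nabla"
proof -
  interpret sub_riemannian_volume A k H V gc g D nabla vol
    using assms(1-6) by unfold_locales
  have parts: "(\<integral>p. hlap A k H gc D e p * f p \<partial>mu) + (\<integral>p. gc p (grad_H e p) (grad_H f p) \<partial>mu) +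
      (\<integral>p. f p * defect u e p \<partial>vol) = 0"
    if "e \<in> smooth_compact_support A" "f \<in> smooth_compact_support A" for e f
    using that by (intro integration_by_parts[OF assms(7-9)]) (auto simp: smooth_compact_support_def)
  show ?thesis
  proof (intro iffI ballI)
    assume sym: "\<forall>e\<in>smooth_compact_support A. \<forall>f\<in>smooth_compact_support A.
            - (\<integral>p. hlap A k H gc D e p * f p \<partial>mu) =
              (\<integral>p. gc p (hgrad A H gc e p) (hgrad A H gc f p) \<partial>mu)"
    have "(\<integral>p. f p * defect u e p \<partial>vol) = 0"
      if "e \<in> smooth_compact_support A" "f \<in> smooth_compact_support A" for e f
      using parts[OF that] bspec[OF bspec[OF sym that(1)] that(2)] by linarith
    then show "hgrad A H gc (\<lambda>p. ln (u p)) = mean_curvature A k H V g nabla"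
      by (rule mean_curvature_gradient_if_defect_null[OF assms(7-9)])
  next
    fix e f assume eq: "hgrad A H gc (\<lambda>p. ln (u p)) = mean_curvature A k H V g nabla"
      and ef: "e \<in> smooth_compact_support A" "f \<in> smooth_compact_support A"
    have se: "smooth_fun_on A UNIV e" using ef by (simp add: smooth_compact_support_def)
    have "gc p (grad_H e p) 0 = 0" for p
      using hor.metric_sym[OF grad_H_in[OF se] subspace_0[OF hor.fibre_subspace]]
        hor.metric_zero_left[OF grad_H_in[OF se]] by simp
    then have "defect u e p = 0" for p unfolding defect_def eq by simp
    then show "- (\<integral>p. hlap A k H gc D e p * f p \<partial>mu) =
        (\<integral>p. gc p (hgrad A H gc e p) (hgrad A H gc f p) \<partial>mu)"
      using parts[OF ef] by simp
  qed
qed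

end
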